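(* Let $d\in\mathbb{N}$, let $H\colon \mathbb{T}^d\times\mathbb{R}^d\times\mathbb{R}^+\to\mathbb{R}$ satisfy the Monotonicity assumption and the Weak-growth assumption with parameters $\alpha>1$, $\beta>0$ (both defined in the context). Let $\bar\beta=\beta+1$, $\bar\gamma=\alpha\frac{\beta+1}{\beta}$, and let $V\in L^{\bar\beta'}(\mathbb{T}^d)$, where $\bar\beta'=\bar\beta/(\bar\beta-1)$. Then there exists $(m,u)\in L^{\bar\beta}(\mathbb{T}^d)\times W^{1,\bar\gamma}(\mathbb{T}^d)$ that is a weak solution (as defined in the context) to the system $$\begin{cases}-u-H(x,Du,m)+V(x)=0,\\ m-\operatorname{div}(mD_pH(x,Du,m))-1=0\end{cases}\quad\text{in }\mathbb{T}^d.$$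
   Context: Notation: $\mathbb{R}^+=(0,\infty)$, $\mathbb{T}^d$ is the $d$-dimensional torus; the generic argument of $H$ is $(x,p,m)$ and $D_pH$ is the gradient in $p$. Regularity condition: $H$ is measurable and, for a.e. $x\in\mathbb{T}^d$, the maps $(p,m)\mapsto H(x,p,m)$ and $(p,m)\mapsto D_pH(x,p,m)$ are continuous on $\mathbb{R}^d\times\mathbb{R}^+$. Monotonicity assumption: $H$ satisfies the Regularity condition and, for a.e. $x\in\mathbb{T}^d$ and all $(p_1,m_1),(p_2,m_2)\in\mathbb{R}^d\times\mathbb{R}^+$, $$\big(-H(x,p_1,m_1)+H(x,p_2,m_2)\big)(m_1-m_2)+\big(m_1D_pH(x,p_1,m_1)-m_2D_pH(x,p_2,m_2)\big)\cdot(p_1-p_2)\geq 0.$$ Weak-growth assumption (with parameters $\alpha>1$, $\beta>0$): $H$ satisfies the Regularity condition and there is $C>0$ such that for a.e. $x\in\mathbb{T}^d$ and all $(p,m)\in\mathbb{R}^d\times\mathbb{R}^+$: $H(x,0,m)\leq-\frac1Cm^\beta+C$; $|D_pH(x,p,m)|\leq f(p,m)$ for some continuous $f\colon\mathbb{R}^d\times\mathbb{R}^+\to\mathbb{R}$ (independent of $x$); $H(x,p,m)\geq\frac1C|p|^\alpha-C(m^\beta+1)$. Weak solution: $(m,u)\in L^1(\mathbb{T}^d)\times W^{1,1}(\mathbb{T}^d)$ with $m\geq0$ and $$0\leq\int_{\mathbb{T}^d}\Big[\big(-\upsilon-H(x,D\upsilon,\mu)+V(x)\big)(\mu-m)+\mu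 D_pH(x,D\upsilon,\mu)\cdot(D\upsilon-Du)+(\mu-1)(\upsilon-u)\Big]\,dx$$ for all $(\mu,\upsilon)\in L^\infty(\mathbb{T}^d)\times W^{1,\infty}(\mathbb{T}^d)$ with $\operatorname{ess\,inf}\mu>0$. *)

theory Defs
  imports "HOL-Analysis.Analysis" "HOL-Probability.Essential_Supremum"
begin

text \<open>
  The torus of dimension \<open>CARD('n)\<close> is \<open>\<real>^'n\<close> modulo the integer lattice.  A function on it is
  a function on \<open>real^'n\<close> that is 1-periodic in each coordinate, and integrals and
  almost-everywhere statements refer to the unit cube (whose boundary is a null set).
\<close>

definition periodic :: "(real^'n::finite \<Rightarrow> 'b) \<Rightarrow> bool" where
  "periodic f \<longleftrightarrow> (\<forall>x i. f (x + axis i 1) = f x)"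

definition torus :: "(real^'n::finite) measure" where
  "torus = lebesgue_on (cbox 0 1)"

text \<open>Spaces of functions rather than of a.e. classes; the exponent may be \<open>\<infinity>\<close>.\<close>

definition Lp :: "ereal \<Rightarrow> (real^'n::finite \<Rightarrow> 'b::euclidean_space) set" where
  "Lp p = {f. periodic f \<and> f \<in> borel_measurable torus \<and>
     (if p = \<infinity> then esssup torus (\<lambda>x. ereal (norm (f x))) < \<infinity>
      else integrable torus (\<lambda>x. norm (f x) powr real_of_ereal p))}"

definition ess_inf :: "'a measure \<Rightarrow> ('a \<Rightarrow> real) \<Rightarrow> ereal" where
  "ess_inf M f = - esssup M (\<lambda>x. ereal (- f x))"

definition grad :: "('a::real_inner \<Rightarrow> real) \<Rightarrow> 'a \<Rightarrow> 'a" where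
  "grad f x = (THE D. GDERIV f x :> D)"

primrec C_k :: "nat \<Rightarrow> (real^'n::finite \<Rightarrow> real) \<Rightarrow> bool" where
  "C_k 0 f \<longleftrightarrow> continuous_on UNIV f"
| "C_k (Suc k) f \<longleftrightarrow> f differentiable_on UNIV \<and> (\<forall>i. C_k k (\<lambda>x. grad f x $ i))"

definition smooth :: "(real^'n::finite \<Rightarrow> real) \<Rightarrow> bool" where
  "smooth f \<longleftrightarrow> (\<forall>k. C_k k f)"

definition weak_gradient :: "(real^'n::finite \<Rightarrow> real) \<Rightarrow> (real^'n \<Rightarrow> real^'n) \<Rightarrow> bool" where
  "weak_gradient u G \<longleftrightarrow> u \<in> Lp 1 \<and> G \<in> Lp 1 \<and>
     (\<forall>\<phi>. periodic \<phi> \<longrightarrow> smooth \<phi> \<longrightarrow>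
        (\<integral>x. u x *\<^sub>R grad \<phi> x \<partial>torus) = - (\<integral>x. \<phi> x *\<^sub>R G x \<partial>torus))"

text \<open>A weak gradient is unique up to a null set; \<open>wgrad u\<close> is one representative of it.\<close>

definition wgrad :: "(real^'n::finite \<Rightarrow> real) \<Rightarrow> real^'n \<Rightarrow> real^'n" where
  "wgrad u = (SOME G. weak_gradient u G)"

definition W1p :: "ereal \<Rightarrow> (real^'n::finite \<Rightarrow> real) set" where
  "W1p p = {u \<in> Lp p. \<exists>G \<in> Lp p. weak_gradient u G}"

type_synonym 'n hamiltonian = "real^'n \<Rightarrow> real^'n \<Rightarrow> real \<Rightarrow> real"

text \<open>A Hamiltonian \<open>H x p m\<close> is only meaningful for \<open>m > 0\<close>.\<close>

definition DpH :: "'n::finite hamiltonian \<Rightarrow> real^'n \<Rightarrow> real^'n \<Rightarrow> real \<Rightarrow> real^'n" where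
  "DpH H x p m = grad (\<lambda>q. H x q m) p"

definition regular :: "'n::finite hamiltonian \<Rightarrow> bool" where
  "regular H \<longleftrightarrow>
     (\<lambda>(x, p, m). H x p m) \<in> borel_measurable (lebesgue_on (cbox 0 1 \<times> UNIV \<times> {0<..})) \<and>
     (AE x in torus.
        continuous_on (UNIV \<times> {0<..}) (\<lambda>(p, m). H x p m) \<and>
        (\<forall>p. \<forall>m>0. (\<lambda>q. H x q m) differentiable (at p)) \<and>
        continuous_on (UNIV \<times> {0<..}) (\<lambda>(p, m). DpH H x p m))"

definition monotone_hamiltonian :: "'n::finite hamiltonian \<Rightarrow> bool" where
  "monotone_hamiltonian H \<longleftrightarrow> regular H \<and>
     (AE x in torus. \<forall>p1 p2. \<forall>m1>0. \<forall>m2>0.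
        (- H x p1 m1 + H x p2 m2) * (m1 - m2)
        + (m1 *\<^sub>R DpH H x p1 m1 - m2 *\<^sub>R DpH H x p2 m2) \<bullet> (p1 - p2) \<ge> 0)"

definition weak_growth :: "real \<Rightarrow> real \<Rightarrow> 'n::finite hamiltonian \<Rightarrow> bool" where
  "weak_growth \<alpha> \<beta> H \<longleftrightarrow> regular H \<and>
     (\<exists>C>0. \<exists>f :: (real^'n) \<times> real \<Rightarrow> real. continuous_on (UNIV \<times> {0<..}) f \<and>
        (AE x in torus. \<forall>p. \<forall>m>0.
           H x 0 m \<le> - (1 / C) * m powr \<beta> + C \<and>
           norm (DpH H x p m) \<le> f (p, m) \<and>
           H x p m \<ge> (1 / C) * norm p powr \<alpha> - C * (m powr \<beta> + 1)))"

definition weak_integrand ::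
  "'n::finite hamiltonian \<Rightarrow> (real^'n \<Rightarrow> real) \<Rightarrow> (real^'n \<Rightarrow> real) \<Rightarrow> (real^'n \<Rightarrow> real) \<Rightarrow>
   (real^'n \<Rightarrow> real) \<Rightarrow> (real^'n \<Rightarrow> real) \<Rightarrow> real^'n \<Rightarrow> real" where
  "weak_integrand H V m u \<mu> \<upsilon> x =
     (- \<upsilon> x - H x (wgrad \<upsilon> x) (\<mu> x) + V x) * (\<mu> x - m x)
     + (\<mu> x *\<^sub>R DpH H x (wgrad \<upsilon> x) (\<mu> x)) \<bullet> (wgrad \<upsilon> x - wgrad u x)
     + (\<mu> x - 1) * (\<upsilon> x - u x)"

text \<open>
  Integrability is demanded explicitly because the Bochner integral of a non-integrable function
  is 0, which would make the inequality hold vacuously.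
\<close>

definition weak_solution ::
  "'n::finite hamiltonian \<Rightarrow> (real^'n \<Rightarrow> real) \<Rightarrow> (real^'n \<Rightarrow> real) \<Rightarrow> (real^'n \<Rightarrow> real) \<Rightarrow> bool" where
  "weak_solution H V m u \<longleftrightarrow>
     m \<in> Lp 1 \<and> u \<in> W1p 1 \<and> (AE x in torus. m x \<ge> 0) \<and>
     (\<forall>\<mu> \<in> Lp \<infinity>. \<forall>\<upsilon> \<in> W1p \<infinity>. ess_inf torus \<mu> > 0 \<longrightarrow>
        integrable torus (weak_integrand H V m u \<mu> \<upsilon>) \<and>
        0 \<le> (\<integral>x. weak_integrand H V m u \<mu> \<upsilon> x \<partial>torus))"

end

theory Submission imports Defs begin

text \<open>
  The system is \<open>A w = 0\<close> for a monotone operator \<open>A\<close> in \<open>w = (m, u, Du)\<close>, and a weak solution is a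
  solution of its Minty variational inequality.  On the convex set \<open>K R\<close> of triples with
  \<open>1 / R \<le> m \<le> R\<close>, \<open>\<bar>u\<bar> \<le> R\<close>, \<open>\<bar>Du\<bar> \<le> R powr (\<beta> / \<alpha>)\<close> everything is bounded, so the inequality has a
  solution there, in Minty's and in Stampacchia's form.  Testing Stampacchia's form with
  \<open>(1 / 2, 0)\<close> and \<open>(2, 0)\<close> bounds \<open>m\<close> in \<open>L^(\<beta> + 1)\<close> and the mean of \<open>u\<close>; varying \<open>m\<close> alone gives
  \<open>u + H x Du m \<le> V\<close> where \<open>m < R\<close>, hence \<open>\<bar>Du\<bar> powr \<alpha> \<le> const * (\<bar>V\<bar> + \<bar>u\<bar> + m powr \<beta> + 1)\<close>, and the Poincare
  inequality closes the estimate of \<open>Du\<close> uniformly in \<open>R\<close>.  Minty's inequality is affine in the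
  solution, so it survives the limit \<open>R \<rightarrow> \<infinity>\<close>.

  Weak compactness is replaced by \<open>convex_ae_closed_fip\<close>, and periodicity of the solution is
  restored only at the end.
\<close>

section \<open>Convex sets closed under almost everywhere convergence\<close>

text \<open>\<open>DpH\<close> is bounded only by an arbitrary continuous \<open>f\<close>, which
  may blow up as m tends to 0 or to infinity. So the operator is controlled only at triples from
  some \<open>K R\<close>, and the limit need not lie in any of them: this is why the limit is taken
  in Minty's form, where \<open>H\<close> is evaluated at the test triple alone. The estimates, by
  contrast, require Stampacchia's form, where \<open>H\<close> is evaluated at the solution.
  Pointwise information comes from the first component: m can be varied locally, whereas u cannot,
  because the third component must stay the weak gradient of the second. The competitor raises m, so
  the lower barrier \<open>1 / R\<close> does not interfere with it. Carrying Du as a component of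
  its own turns the gradient constraint into a linear relation that is stable under the limits that
  occur.\<close>

lemma norm_Pair_one_midpoint_defect:
  fixes a b :: "'b::real_inner"
  defines "S \<equiv> norm (1::real, a) + norm (1::real, b)"
  shows "(norm (a - b))\<^sup>2 \<le> (S - norm (2::real, a + b)) * S ^ 3"
proof -
  define A where "A = (1::real, a)"
  define B where "B = (1::real, b)"
  have AB: "A + B = (2, a + b)" by (simp add: A_def B_def)
  have S: "S = norm A + norm B" by (simp add: S_def A_def B_def)
  let ?\<delta> = "norm A + norm B - norm (A + B)"
  let ?k = "norm A * norm B - A \<bullet> B"
  have CS: "A \<bullet> B \<le> norm A * norm B" by (rule norm_cauchy_schwarz)
  have tri: "norm (A + B) \<le> norm A + norm B" by (rule norm_triangle_ineq)
  \<comment> \<open>The defect of the triangle inequality controls \<open>?k\<close>, the defect of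
    Cauchy-Schwarz: the other factor of this difference of squares is at most
    \<open>2 * S\<close>.\<close>
  have 1: "(norm A + norm B)\<^sup>2 - (norm (A + B))\<^sup>2 = 2 * ?k"
    by (simp add: power2_norm_eq_inner inner_add inner_commute power2_sum)
  have 2: "?\<delta> * (2 * S) \<ge> 2 * ?k"
  proof -
    have "2 * ?k = ?\<delta> * (norm A + norm B + norm (A + B))"
      using 1 by (simp add: power2_eq_square algebra_simps)
    also have "\<dots> \<le> ?\<delta> * (2 * S)" using tri by (intro mult_left_mono) (auto simp: S)
    finally show ?thesis .
  qed
  \<comment> \<open>The left-hand difference of squares below is the Gram determinant of
    \<open>A\<close> and \<open>B\<close>. Their common first coordinate 1 makes it detect
    \<open>a - b\<close> even when \<open>a\<close> and \<open>b\<close> are parallel.\<close>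
  have 3: "(norm (a - b))\<^sup>2 \<le> (norm A * norm B)\<^sup>2 - (A \<bullet> B)\<^sup>2"
  proof -
    have "(norm A * norm B)\<^sup>2 - (A \<bullet> B)\<^sup>2
      = (norm (a - b))\<^sup>2 + ((norm a * norm b)\<^sup>2 - (a \<bullet> b)\<^sup>2)"
      by (simp add: A_def B_def power_mult_distrib power2_norm_eq_inner inner_diff inner_commute)
         (simp add: power2_eq_square algebra_simps)
    moreover have "(a \<bullet> b)\<^sup>2 \<le> (norm a * norm b)\<^sup>2"
      using Cauchy_Schwarz_ineq[of a b] by (simp add: power_mult_distrib power2_norm_eq_inner)
    ultimately show ?thesis by linarith
  qed
  have 4: "(norm A * norm B)\<^sup>2 - (A \<bullet> B)\<^sup>2 \<le> ?k * (2 * (norm A * norm B))"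
  proof -
    have "(norm A * norm B)\<^sup>2 - (A \<bullet> B)\<^sup>2 = ?k * (norm A * norm B + A \<bullet> B)"
      by (simp add: power2_eq_square algebra_simps)
    also have "\<dots> \<le> ?k * (2 * (norm A * norm B))"
      using CS by (intro mult_left_mono) auto
    finally show ?thesis .
  qed
  have 5: "2 * (norm A * norm B) \<le> S\<^sup>2"
    by (simp add: S power2_sum)
  have "(norm (a - b))\<^sup>2 \<le> ?k * (2 * (norm A * norm B))" using 3 4 by linarith
  also have "\<dots> \<le> ?k * S\<^sup>2" using 5 CS by (intro mult_left_mono) auto
  also have "\<dots> \<le> (?\<delta> * S) * S\<^sup>2" using 2 by (intro mult_right_mono) auto
  finally show ?thesis by (simp add: S AB power3_eq_cube power2_eq_square mult.assoc)
qed

text \<open>The product of the defect with \<open>S ^ 3\<close> cannot be integrated when only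
  \<open>S\<close> is integrable. Its fourth root is split, as in a weighted arithmetic-geometric
  mean inequality, into terms linear in the defect and in \<open>S\<close>; the free parameter
  \<open>\<eta>\<close> balances them.\<close>

lemma sqrt_norm_diff_le_midpoint_defect:
  fixes a b :: "'b::real_inner"
  defines "S \<equiv> norm (1::real, a) + norm (1::real, b)"
  assumes \<eta>: "\<eta> > 0"
  shows "sqrt (norm (a - b)) \<le> (S - norm (2::real, a + b)) / \<eta> ^ 3 + \<eta> * S"
proof -
  define \<delta> where "\<delta> = S - norm (2::real, a + b)"
  have main: "(norm (a - b))\<^sup>2 \<le> \<delta> * S ^ 3"
    using norm_Pair_one_midpoint_defect[of a b] by (simp add: S_def \<delta>_def)
  have S0: "S \<ge> 0" by (simp add: S_def)
  have d0: "\<delta> \<ge> 0"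
    using norm_triangle_ineq[of "(1::real, a)" "(1, b)"] by (simp add: \<delta>_def S_def)
  have le: "sqrt (norm (a - b)) \<le> y" if "(norm (a - b))\<^sup>2 \<le> y ^ 4" "y \<ge> 0" for y
  proof -
    have "norm (a - b) \<le> y\<^sup>2"
      by (rule power2_le_imp_le) (use that in \<open>auto simp: power_mult[symmetric]\<close>)
    then show ?thesis using that by (simp add: real_le_lsqrt)
  qed
  show ?thesis
  proof (cases "\<delta> \<le> \<eta> ^ 4 * S")
    case True
    have "(norm (a - b))\<^sup>2 \<le> (\<eta> ^ 4 * S) * S ^ 3"
      using main mult_right_mono[OF True, of "S ^ 3"] S0 by simp
    then have "(norm (a - b))\<^sup>2 \<le> (\<eta> * S) ^ 4"
      by (simp add: power4_eq_xxxx power3_eq_cube mult.assoc mult.left_commute)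
    then have "sqrt (norm (a - b)) \<le> \<eta> * S" using \<eta> S0 by (intro le) auto
    then show ?thesis using d0 \<eta> by (simp add: \<delta>_def[symmetric] add_increasing)
  next
    case False
    then have "S \<le> \<delta> / \<eta> ^ 4" using \<eta> by (simp add: field_simps)
    then have "S ^ 3 \<le> (\<delta> / \<eta> ^ 4) ^ 3" using S0 by (intro power_mono)
    then have "(norm (a - b))\<^sup>2 \<le> \<delta> * (\<delta> / \<eta> ^ 4) ^ 3"
      using main mult_left_mono[of "S ^ 3" _ \<delta>] d0 by fastforce
    also have "\<dots> = (\<delta> / \<eta> ^ 3) ^ 4"
      using \<eta> by (simp add: power_divide power_mult[symmetric] power4_eq_xxxx power3_eq_cube)
    finally have "sqrt (norm (a - b)) \<le> \<delta> / \<eta> ^ 3" using \<eta> d0 by (intro le) auto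
    then show ?thesis using S0 \<eta> by (simp add: \<delta>_def[symmetric] add_increasing2)
  qed
qed


text \<open>Near-minimisers of the strictly convex functional \<open>\<integral> norm (1, z x)\<close>, whose infimum over a finite
  intersection increases with the finite family, converge almost everywhere; their limit does not
  depend on the finite families chosen.\<close>

lemma convex_ae_closed_fip:
  fixes \<C> :: "('a \<Rightarrow> 'b::euclidean_space) set set" and M :: "'a measure"
  assumes fin: "finite_measure M" and ne: "\<C> \<noteq> {}"
    and fip: "\<And>F. finite F \<Longrightarrow> F \<noteq> {} \<Longrightarrow> F \<subseteq> \<C> \<Longrightarrow> \<Inter>F \<noteq> {}"
    and int: "\<And>C z. C \<in> \<C> \<Longrightarrow> z \<in> C \<Longrightarrow> integrable M z \<and> (\<integral>x. norm (z x) \<partial>M) \<le> B"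
    and mid: "\<And>C z w. C \<in> \<C> \<Longrightarrow> z \<in> C \<Longrightarrow> w \<in> C \<Longrightarrow> (\<lambda>x. (1/2) *\<^sub>R (z x + w x)) \<in> C"
    and closed: "\<And>C zs z. C \<in> \<C> \<Longrightarrow> (\<And>k::nat. zs k \<in> C) \<Longrightarrow> z \<in> borel_measurable M \<Longrightarrow>
                   AE x in M. (\<lambda>k. zs k x) \<longlonglongrightarrow> z x \<Longrightarrow> z \<in> C"
  shows "\<Inter>\<C> \<noteq> {}"
proof -
  interpret finite_measure M by fact
  define N where "N a = norm (1::real, a::'b)" for a
  define J where "J z = (\<integral>x. N (z x) \<partial>M)" for z
  define U where "U = \<Union>\<C>"
  have N_le: "N a \<le> 1 + norm a" for a
    unfolding N_def using norm_Pair_le[of "1::real" a] by simp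
  have N0: "N a \<ge> 0" for a by (simp add: N_def)
  have meas: "z \<in> borel_measurable M" "integrable M z" if "z \<in> U" for z
    using int that unfolding U_def by (auto dest: borel_measurable_integrable)
  have Nm: "(\<lambda>x. N (z x)) \<in> borel_measurable M" if "z \<in> borel_measurable M" for z
    unfolding N_def using that by measurable
  have Nint: "integrable M (\<lambda>x. N (z x))" if "integrable M z" for z
    by (rule Bochner_Integration.integrable_bound[where f="\<lambda>x. 1 + norm (z x)"])
       (use that N_le N0 in \<open>auto intro!: Nm\<close>)
  define L where "L = measure M (space M) + B"
  have JL: "J z \<le> L" if "z \<in> U" for z
  proof -
    have "J z \<le> (\<integral>x. 1 + norm (z x) \<partial>M)"
      unfolding J_def by (intro integral_mono Nint) (use that meas N_le in auto)
    also have "\<dots> = measure M (space M) + (\<integral>x. norm (z x) \<partial>M)"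
      using meas[OF that] by (subst Bochner_Integration.integral_add) auto
    also have "\<dots> \<le> L" using int that unfolding L_def U_def by auto
    finally show ?thesis .
  qed
  have J0: "J z \<ge> 0" for z unfolding J_def by (simp add: N0)
  define I where "I F = Inf (J ` \<Inter>F)" for F
  define FF where "FF = {F. finite F \<and> F \<noteq> {} \<and> F \<subseteq> \<C>}"
  have sub: "\<Inter>F \<subseteq> U" if "F \<in> FF" for F
    using that unfolding FF_def U_def by auto
  have bdd: "bdd_below (J ` A)" for A using J0 by (intro bdd_belowI[of _ 0]) auto
  have neI: "\<Inter>F \<noteq> {}" if "F \<in> FF" for F using fip that unfolding FF_def by auto
  have IL: "I F \<le> L" if "F \<in> FF" for F
  proof -
    from neI[OF that] obtain z where z: "z \<in> \<Inter>F" by blast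
    have "I F \<le> J z" unfolding I_def by (rule cINF_lower[OF bdd z])
    also have "J z \<le> L" using z sub[OF that] by (intro JL) auto
    finally show ?thesis .
  qed
  have neFF: "FF \<noteq> {}"
  proof -
    obtain C where "C \<in> \<C>" using ne by auto
    then have "{C} \<in> FF" by (auto simp: FF_def)
    then show ?thesis by auto
  qed
  have bda: "bdd_above (I ` FF)" using IL by (intro bdd_aboveI[of _ L]) auto
  define d where "d = Sup (I ` FF)"
  have Id: "I F \<le> d" if "F \<in> FF" for F unfolding d_def using that bda by (auto intro: cSUP_upper)
  have Imono: "I F \<le> I F'" if "F \<subseteq> F'" "F \<in> FF" "F' \<in> FF" for F F'
    unfolding I_def
    by (rule cInf_superset_mono[OF _ bdd image_mono[OF Inter_anti_mono[OF that(1)]]]) (use neI[OF that(3)] in blast)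
  \<comment> \<open>The base 16 is chosen so that, with \<open>\<eta> = (1/2) ^ k\<close> below,
    both \<open>\<epsilon> k / \<eta> ^ 3\<close> and \<open>\<eta>\<close> equal
    \<open>(1/2) ^ k\<close>, which is summable.\<close>
  define \<epsilon> :: "nat \<Rightarrow> real" where "\<epsilon> k = (1/16) ^ k" for k
  have e0: "\<epsilon> k > 0" for k by (simp add: \<epsilon>_def)
  have "\<exists>F\<in>FF. I F > d - \<epsilon> k" for k
    using less_cSUP_iff[OF neFF bda, of "d - \<epsilon> k"] e0[of k] unfolding d_def by auto
  then obtain G where G: "\<And>k. G k \<in> FF" "\<And>k. I (G k) > d - \<epsilon> k" by metis
  \<comment> \<open>Cumulative unions make the sets \<open>\<Inter>(F k)\<close> decrease, so that
    each near-minimiser can be compared with its predecessor.\<close>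
  define F where "F k = (\<Union>j\<le>k. G j)" for k
  have F: "F k \<in> FF" for k using G(1) unfolding F_def FF_def by (auto simp: atMost_def)
  have FI: "I (F k) > d - \<epsilon> k" for k
  proof -
    have "I (G k) \<le> I (F k)" by (rule Imono) (use F G in \<open>auto simp: F_def\<close>)
    then show ?thesis using G(2)[of k] by linarith
  qed
  have near: "\<exists>z\<in>\<Inter>F'. J z < d + \<epsilon> k" if "F' \<in> FF" for F' k
  proof -
    have "I F' < d + \<epsilon> k" using Id[OF that] e0[of k] by linarith
    then show ?thesis unfolding I_def
      using cINF_less_iff[OF neI[OF that] bdd] by blast
  qed
  have "\<exists>z\<in>\<Inter>(F k). J z < d + \<epsilon> k" for k using near[OF F] .
  then obtain z where z: "\<And>k. z k \<in> \<Inter>(F k)" "\<And>k. J (z k) < d + \<epsilon> k" by metis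
  \<comment> \<open>near-minimisers in the \<open>k\<close>-th set are within \<open>O(2 ^ - k)\<close> of each other\<close>
  have dist: "integrable M (\<lambda>x. sqrt (norm (v x - w x))) \<and>
      (\<integral>x. sqrt (norm (v x - w x)) \<partial>M) \<le> (4 + 2 * L) * (1/2) ^ k"
    if v: "v \<in> \<Inter>(F k)" "J v < d + \<epsilon> k" and w: "w \<in> \<Inter>(F k)" "J w < d + \<epsilon> k" for v w k
  proof -
    have vU: "v \<in> U" "w \<in> U" using v w sub[OF F, of k] by blast+
    define \<eta> :: real where "\<eta> = (1/2) ^ k"
    have \<eta>: "\<eta> > 0" by (simp add: \<eta>_def)
    define h where "h x = (1/2) *\<^sub>R (v x + w x)" for x
    have h: "h \<in> \<Inter>(F k)" using v w mid F[of k] unfolding h_def FF_def by blast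
    \<comment> \<open>The midpoint stays in \<open>\<Inter>(F k)\<close>, where the infimum of
      \<open>J\<close> exceeds \<open>d - \<epsilon> k\<close>; so
      \<open>J v + J w - 2 * J h\<close> is at most \<open>4 * \<epsilon> k\<close>.\<close>
    then have Jh: "J h > d - \<epsilon> k"
      using order_less_le_trans[OF FI[of k], of "J h"] cINF_lower[OF bdd h] unfolding I_def by auto
    have hU: "h \<in> U" using h sub[OF F, of k] by blast
    have Nh: "norm (2::real, v x + w x) = 2 * N (h x)" for x
    proof -
      have "(2::real, v x + w x) = 2 *\<^sub>R (1, h x)" by (simp add: h_def)
      then show ?thesis unfolding N_def by (metis norm_scaleR abs_numeral)
    qed
    let ?R = "\<lambda>x. (N (v x) + N (w x) - 2 * N (h x)) / \<eta> ^ 3 + \<eta> * (N (v x) + N (w x))"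
    have pt: "sqrt (norm (v x - w x)) \<le> ?R x" for x
      using sqrt_norm_diff_le_midpoint_defect[OF \<eta>, of "v x" "w x"] unfolding Nh by (simp add: N_def)
    have iv: "integrable M (\<lambda>x. N (v x))" "integrable M (\<lambda>x. N (w x))" "integrable M (\<lambda>x. N (h x))"
      using Nint meas vU hU by auto
    have iR: "integrable M ?R" using iv by auto
    have isq: "integrable M (\<lambda>x. sqrt (norm (v x - w x)))"
    proof (rule Bochner_Integration.integrable_bound[OF iR])
      show "(\<lambda>x. sqrt (norm (v x - w x))) \<in> borel_measurable M"
        using meas(1)[OF vU(1)] meas(1)[OF vU(2)] by measurable
      show "AE x in M. norm (sqrt (norm (v x - w x))) \<le> norm (?R x)"
        using pt by (intro always_eventually allI) (metis abs_of_nonneg norm_ge_zero order_trans real_norm_def real_sqrt_ge_zero abs_ge_self)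
    qed
    have "(\<integral>x. sqrt (norm (v x - w x)) \<partial>M) \<le> (\<integral>x. ?R x \<partial>M)"
      by (intro integral_mono isq iR pt)
    also have "\<dots> = (J v + J w - 2 * J h) / \<eta> ^ 3 + \<eta> * (J v + J w)"
      unfolding J_def using iv by simp
    also have "\<dots> \<le> (4 * \<epsilon> k) / \<eta> ^ 3 + \<eta> * (2 * L)"
    proof (intro add_mono divide_right_mono mult_left_mono)
      show "J v + J w - 2 * J h \<le> 4 * \<epsilon> k" using v(2) w(2) Jh by linarith
      show "J v + J w \<le> 2 * L" using JL[OF vU(1)] JL[OF vU(2)] by linarith
    qed (use \<eta> in auto)
    also have "\<epsilon> k / \<eta> ^ 3 = \<eta>"
      unfolding \<epsilon>_def \<eta>_def by (simp add: power_mult[symmetric] power_add[symmetric] power_divide field_simps) (simp add: power_mult mult.commute[of k] power_mult_distrib[symmetric] flip: power_add)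
    then have "(4 * \<epsilon> k) / \<eta> ^ 3 + \<eta> * (2 * L) = (4 + 2 * L) * (1/2) ^ k"
      unfolding times_divide_eq_right[symmetric] by (simp add: \<eta>_def algebra_simps)
    finally show ?thesis using isq by blast
  qed
  have Finc: "\<Inter>(F j) \<subseteq> \<Inter>(F k)" if "k \<le> j" for k j
    using that unfolding F_def by (intro Inter_anti_mono) (auto dest: order_trans)
  have z_step: "z (Suc k) \<in> \<Inter>(F k)" "J (z (Suc k)) < d + \<epsilon> k" for k
  proof -
    show "z (Suc k) \<in> \<Inter>(F k)" using z(1)[of "Suc k"] Finc[of k "Suc k"] by auto
    have "\<epsilon> (Suc k) \<le> \<epsilon> k" by (simp add: \<epsilon>_def)
    then show "J (z (Suc k)) < d + \<epsilon> k" using z(2)[of "Suc k"] by linarith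
  qed
  have summ: "summable (\<lambda>k. (4 + 2 * L) * (1/2::real) ^ k)"
    by (intro summable_mult summable_geometric) auto
  have ae_sum: "AE x in M. summable (\<lambda>k. f k x)"
    if f: "\<And>k. integrable M (f k)" "\<And>k x. f k x \<ge> 0" "\<And>k. (\<integral>x. f k x \<partial>M) \<le> (4 + 2 * L) * (1/2) ^ k"
    for f :: "nat \<Rightarrow> 'a \<Rightarrow> real"
  proof -
    have [measurable]: "f k \<in> borel_measurable M" for k using f(1) by auto
    have "(\<integral>\<^sup>+x. (\<Sum>k. ennreal (f k x)) \<partial>M) = (\<Sum>k. \<integral>\<^sup>+x. ennreal (f k x) \<partial>M)"
      by (rule nn_integral_suminf) auto
    also have "\<dots> = (\<Sum>k. ennreal (\<integral>x. f k x \<partial>M))"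
      using f by (simp add: nn_integral_eq_integral)
    also have "\<dots> \<le> (\<Sum>k. ennreal ((4 + 2 * L) * (1/2) ^ k))"
      by (intro suminf_le ennreal_leI f(3)) auto
    also have "\<dots> < \<infinity>"
    proof -
      have "(4 + 2 * L) * (1/2) ^ k \<ge> 0" for k
        using f(3)[of k] Bochner_Integration.integral_nonneg[of M "f k"] f(2) by (meson order_trans)
      then show ?thesis using summ by (simp add: suminf_ennreal2)
    qed
    finally have "AE x in M. (\<Sum>k. ennreal (f k x)) \<noteq> \<infinity>"
      by (intro nn_integral_noteq_infinite) auto
    then show ?thesis
    proof eventually_elim
      case (elim x)
      then show ?case using f(2) by (intro summable_suminf_not_top) auto
    qed
  qed
  have conv: "AE x in M. convergent (\<lambda>k. z k x)"
  proof -
    have "AE x in M. summable (\<lambda>k. sqrt (norm (z (Suc k) x - z k x)))"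
      by (rule ae_sum) (use dist[OF z_step z] in auto)
    then show ?thesis
    proof eventually_elim
      case (elim x)
      let ?s = "\<lambda>k. sqrt (norm (z (Suc k) x - z k x))"
      have "?s \<longlonglongrightarrow> 0" by (rule summable_LIMSEQ_zero[OF elim])
      then have "eventually (\<lambda>k. ?s k < 1) sequentially" by (rule order_tendstoD) auto
      \<comment> \<open>Numbers below 1 are below their square roots, so summability of the roots
        passes to the increments.\<close>
      then have "eventually (\<lambda>k. norm (norm (z (Suc k) x - z k x)) \<le> ?s k) sequentially"
      proof eventually_elim
        case (elim k)
        have "norm (z (Suc k) x - z k x) = ?s k * ?s k" by simp
        also have "\<dots> \<le> ?s k * 1" using elim by (intro mult_left_mono) auto
        finally show ?case by simp
      qed
      then have "summable (\<lambda>k. norm (z (Suc k) x - z k x))"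
        by (rule summable_comparison_test_ev) (rule elim)
      then have "summable (\<lambda>k. z (Suc k) x - z k x)" by (rule summable_norm_cancel)
      then obtain l where "(\<lambda>k. z (Suc k) x - z k x) sums l" by (auto simp: summable_def)
      then have "(\<lambda>n. z n x - z 0 x) \<longlonglongrightarrow> l"
        unfolding sums_def by (subst (asm) sum_lessThan_telescope)
      then have "(\<lambda>n. (z n x - z 0 x) + z 0 x) \<longlonglongrightarrow> l + z 0 x" by (intro tendsto_add tendsto_const)
      then show ?case by (auto simp: convergent_def)
    qed
  qed
  define zl where "zl x = lim (\<lambda>k. z k x)" for x
  have zm [measurable]: "z k \<in> borel_measurable M" for k
    using z(1)[of k] sub[OF F, of k] meas(1)[of "z k"] by blast
  have zl_m: "zl \<in> borel_measurable M" unfolding zl_def by (rule borel_measurable_lim_metric) auto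
  have zl: "AE x in M. (\<lambda>k. z k x) \<longlonglongrightarrow> zl x"
    using conv unfolding zl_def by eventually_elim (simp add: convergent_LIMSEQ_iff)
  have "zl \<in> C" if C: "C \<in> \<C>" for C
  proof -
    \<comment> \<open>Adjoining \<open>C\<close> yields points \<open>w k\<close> of
      \<open>C\<close> that are still near-minimal in \<open>\<Inter>(F k)\<close>, hence
      asymptotically equal to \<open>z k\<close>. So \<open>zl\<close> is also a limit of points of
      \<open>C\<close>.\<close>
    have iF: "insert C (F k) \<in> FF" for k using F[of k] C unfolding FF_def by auto
    have "\<exists>w\<in>\<Inter>(insert C (F k)). J w < d + \<epsilon> k" for k using near[OF iF] .
    then obtain w where w: "\<And>k. w k \<in> \<Inter>(insert C (F k))" "\<And>k. J (w k) < d + \<epsilon> k" by metis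
    have wF: "w k \<in> \<Inter>(F k)" for k using w(1)[of k] by auto
    have "AE x in M. summable (\<lambda>k. sqrt (norm (w k x - z k x)))"
      by (rule ae_sum) (use dist[OF wF w(2) z] in auto)
    with zl have "AE x in M. (\<lambda>k. w k x) \<longlonglongrightarrow> zl x"
    proof eventually_elim
      case (elim x)
      have "(\<lambda>k. sqrt (norm (w k x - z k x))) \<longlonglongrightarrow> 0"
        by (rule summable_LIMSEQ_zero[OF elim(2)])
      then have "(\<lambda>k. (sqrt (norm (w k x - z k x)))\<^sup>2) \<longlonglongrightarrow> 0\<^sup>2" by (intro tendsto_power)
      then have "(\<lambda>k. w k x - z k x) \<longlonglongrightarrow> 0" by (simp add: tendsto_norm_zero_iff)
      from tendsto_add[OF this elim(1)] show ?case by simp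
    qed
    then show ?thesis using closed[OF C _ zl_m, of w] w(1) by auto
  qed
  then show ?thesis by auto
qed

section \<open>Monotone variational inequalities\<close>

text \<open>A point \<open>t\<close> of the simplex minimising the squared norm of the negative part \<open>r\<close> of \<open>a t\<close> must
  have \<open>r = 0\<close>: otherwise moving towards the normalisation of \<open>r\<close> would decrease it.\<close>

lemma skew_matrix_nonneg:
  fixes a :: "'i \<Rightarrow> 'i \<Rightarrow> real"
  assumes fin: "finite I" and ne: "I \<noteq> {}"
    and skew: "\<And>i j. i \<in> I \<Longrightarrow> j \<in> I \<Longrightarrow> a i j + a j i \<ge> 0"
  shows "\<exists>t. (\<forall>i\<in>I. t i \<ge> 0) \<and> (\<Sum>i\<in>I. t i) = 1 \<and> (\<forall>i\<in>I. (\<Sum>j\<in>I. a i j * t j) \<ge> 0)"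
proof -
  \<comment> \<open>Coordinates outside \<open>I\<close> are pinned to 0, which makes the simplex
    compact in the product topology on all functions.\<close>
  define P :: "('i \<Rightarrow> real) set" where "P = PiE UNIV (\<lambda>i. if i \<in> I then {0..1} else {0})"
  define S where "S = P \<inter> {t. (\<Sum>i\<in>I. t i) = 1}"
  have contc: "continuous_on A (\<lambda>t::'i \<Rightarrow> real. t i)" for A i
    by (rule continuous_on_subset[OF continuous_on_product_coordinates]) auto
  have "compactin (product_topology (\<lambda>i. euclidean) UNIV) P"
    unfolding P_def by (subst compactin_PiE) auto
  then have cP: "compact P"
    by (simp add: euclidean_product_topology)
  have "closed {t::'i \<Rightarrow> real. (\<Sum>i\<in>I. t i) = 1}"
    by (intro closed_Collect_eq continuous_intros contc)
  with cP have cS: "compact S" unfolding S_def by blast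
  have SI: "t \<in> S" if "\<And>i. i \<in> I \<Longrightarrow> t i \<ge> 0" "\<And>i. i \<notin> I \<Longrightarrow> t i = 0" "(\<Sum>i\<in>I. t i) = 1" for t
  proof -
    have "t i \<le> 1" if "i \<in> I" for i
      using member_le_sum[of i I t] that \<open>\<And>i. i \<in> I \<Longrightarrow> t i \<ge> 0\<close> fin \<open>(\<Sum>i\<in>I. t i) = 1\<close> by auto
    then show ?thesis using that by (auto simp: S_def P_def)
  qed
  have SD: "t i \<ge> 0" if "t \<in> S" "i \<in> I" for t i
    using that unfolding S_def P_def PiE_def Pi_def by (auto dest!: spec[of _ i])
  have SD0: "t i = 0" if "t \<in> S" "i \<notin> I" for t i
    using that unfolding S_def P_def PiE_def Pi_def by (auto dest!: spec[of _ i])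
  have SD1: "(\<Sum>i\<in>I. t i) = 1" if "t \<in> S" for t
    using that unfolding S_def by auto
  obtain i0 where i0: "i0 \<in> I" using ne by auto
  have neS: "S \<noteq> {}"
  proof -
    have "(\<lambda>i. if i = i0 then 1 else 0) \<in> S"
      by (rule SI) (use i0 fin in auto)
    then show ?thesis by auto
  qed
  define L where "L i t = (\<Sum>j\<in>I. a i j * t j)" for i t
  define F where "F t = (\<Sum>i\<in>I. (max 0 (- L i t))\<^sup>2)" for t
  have "continuous_on S F"
    unfolding F_def L_def by (intro continuous_intros contc)
  then obtain t where t: "t \<in> S" and tmin: "\<And>s. s \<in> S \<Longrightarrow> F t \<le> F s"
    using continuous_attains_inf[OF cS neS] by blast
  define r where "r i = max 0 (- L i t)" for i
  have r0: "r i \<ge> 0" for i by (simp add: r_def)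
  have rL: "r i * L i t = - (r i)\<^sup>2" for i
    by (simp add: r_def max_def power2_eq_square)
  have "r i = 0" if "i \<in> I" for i
  proof (rule ccontr)
    assume ri: "r i \<noteq> 0"
    define \<sigma> where "\<sigma> = (\<Sum>i\<in>I. r i)"
    have "r i \<le> \<sigma>" unfolding \<sigma>_def by (rule member_le_sum) (use that fin r0 in auto)
    then have \<sigma>: "\<sigma> > 0" using ri r0[of i] by linarith
    define s where "s i = (if i \<in> I then r i / \<sigma> else 0)" for i
    have s: "s \<in> S"
    proof (rule SI)
      have "(\<Sum>i\<in>I. s i) = (\<Sum>i\<in>I. r i / \<sigma>)" by (rule sum.cong) (auto simp: s_def)
      also have "\<dots> = 1" using \<sigma> by (simp add: sum_divide_distrib[symmetric] \<sigma>_def[symmetric])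
      finally show "(\<Sum>i\<in>I. s i) = 1" .
    qed (use r0 \<sigma> in \<open>auto simp: s_def\<close>)
    \<comment> \<open>Up to the factor \<open>1 / \<sigma>\<close> this is the quadratic form of
      \<open>a\<close> at \<open>r\<close>. Only its symmetric part counts, whose entries are
      nonnegative by \<open>skew\<close>, and so is \<open>r\<close>.\<close>
    have rAr: "(\<Sum>i\<in>I. r i * L i s) \<ge> 0"
    proof -
      have "(\<Sum>i\<in>I. r i * L i s) = (\<Sum>i\<in>I. \<Sum>j\<in>I. a i j * r i * r j) / \<sigma>"
        unfolding L_def sum_distrib_left sum_divide_distrib
        by (intro sum.cong refl) (auto simp: s_def)
      moreover have "2 * (\<Sum>i\<in>I. \<Sum>j\<in>I. a i j * r i * r j) = (\<Sum>i\<in>I. \<Sum>j\<in>I. (a i j + a j i) * r i * r j)"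
      proof -
        have "(\<Sum>i\<in>I. \<Sum>j\<in>I. a i j * r i * r j) = (\<Sum>i\<in>I. \<Sum>j\<in>I. a j i * r i * r j)"
          by (subst sum.swap) (intro sum.cong refl, simp)
        then show ?thesis by (simp add: distrib_right sum.distrib)
      qed
      moreover have "(\<Sum>i\<in>I. \<Sum>j\<in>I. (a i j + a j i) * r i * r j) \<ge> 0"
        by (intro sum_nonneg mult_nonneg_nonneg skew r0) auto
      ultimately show ?thesis using \<sigma> by simp
    qed
    define R2 where "R2 = (\<Sum>i\<in>I. (r i)\<^sup>2)"
    have "(r i)\<^sup>2 \<le> R2" unfolding R2_def by (rule member_le_sum) (use that fin in auto)
    then have R2: "R2 > 0" using ri by (smt (verit) zero_less_power2)
    define Q where "Q = (\<Sum>i\<in>I. (L i s - L i t)\<^sup>2)"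
    \<comment> \<open>Expansion of \<open>F\<close> along the segment from \<open>t\<close> to
      \<open>s\<close>. The first-order term is at most \<open>- 2 * \<epsilon> * R2\<close>,
      because \<open>rL\<close> evaluates \<open>r i * L i t\<close>; minimality of \<open>t\<close>
      forces the quadratic remainder to compensate for it.\<close>
    have ineq: "2 * \<epsilon> * R2 \<le> \<epsilon>\<^sup>2 * Q" if e: "0 < \<epsilon>" "\<epsilon> \<le> 1" for \<epsilon>
    proof -
      define w where "w i = (1 - \<epsilon>) * t i + \<epsilon> * s i" for i
      have w: "w \<in> S"
      proof (rule SI)
        show "(\<Sum>i\<in>I. w i) = 1"
          unfolding w_def sum.distrib sum_distrib_left[symmetric] SD1[OF t] SD1[OF s] by simp
      qed (use SD[OF t] SD[OF s] SD0[OF t] SD0[OF s] e in \<open>auto simp: w_def\<close>)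
      have Lw: "L i w = L i t + \<epsilon> * (L i s - L i t)" for i
        unfolding L_def w_def by (simp add: algebra_simps sum.distrib sum_subtractf sum_distrib_left)
      have "F t \<le> F w" by (rule tmin[OF w])
      also have "F w \<le> (\<Sum>i\<in>I. (r i - \<epsilon> * (L i s - L i t))\<^sup>2)"
        unfolding F_def
      proof (rule sum_mono)
        fix i
        have "max 0 (- L i w) \<le> \<bar>r i - \<epsilon> * (L i s - L i t)\<bar>"
          unfolding Lw r_def by linarith
        then show "(max 0 (- L i w))\<^sup>2 \<le> (r i - \<epsilon> * (L i s - L i t))\<^sup>2"
          by (metis abs_ge_zero abs_le_square_iff abs_of_nonneg max.cobounded1)
      qed
      also have "\<dots> = (\<Sum>i\<in>I. (r i)\<^sup>2 + \<epsilon>\<^sup>2 * (L i s - L i t)\<^sup>2 - 2 * \<epsilon> * (r i * L i s) - 2 * \<epsilon> * (r i)\<^sup>2)"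
        by (intro sum.cong refl) (use rL in \<open>simp add: power2_eq_square algebra_simps\<close>)
      also have "\<dots> = R2 + \<epsilon>\<^sup>2 * Q - 2 * \<epsilon> * (\<Sum>i\<in>I. r i * L i s) - 2 * \<epsilon> * R2"
        by (simp add: R2_def Q_def sum.distrib sum_subtractf sum_distrib_left)
      also have "F t = R2" by (simp add: F_def R2_def r_def)
      finally have "2 * \<epsilon> * R2 \<le> \<epsilon>\<^sup>2 * Q - 2 * \<epsilon> * (\<Sum>i\<in>I. r i * L i s)" by linarith
      moreover have "2 * \<epsilon> * (\<Sum>i\<in>I. r i * L i s) \<ge> 0" using rAr e by simp
      ultimately show ?thesis by linarith
    qed
    have Q0: "Q \<ge> 0" unfolding Q_def by (intro sum_nonneg) auto
    \<comment> \<open>Small enough for \<open>\<epsilon> * Q \<le> R2\<close>, which contradicts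
      \<open>2 * R2 \<le> \<epsilon> * Q\<close>. The cap 1 keeps the point on the segment, and
      \<open>Q + 1\<close> avoids a division by 0.\<close>
    define \<epsilon> where "\<epsilon> = min 1 (R2 / (Q + 1))"
    have e: "0 < \<epsilon>" "\<epsilon> \<le> 1" using R2 Q0 by (auto simp: \<epsilon>_def)
    have "\<epsilon> * Q \<le> R2"
    proof -
      have "\<epsilon> * Q \<le> R2 / (Q + 1) * Q" using Q0 by (intro mult_right_mono) (auto simp: \<epsilon>_def)
      also have "\<dots> \<le> R2" using Q0 R2 by (simp add: field_simps)
      finally show ?thesis .
    qed
    moreover have "2 * R2 \<le> \<epsilon> * Q" using ineq[OF e] e by (simp add: power2_eq_square)
    ultimately show False using R2 by linarith
  qed
  then have "\<forall>i\<in>I. L i t \<ge> 0" unfolding r_def by (metis max.cobounded2 neg_le_0_iff_le)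
  then show ?thesis using SD[OF t] SD1[OF t] unfolding L_def by blast
qed

section \<open>Limits in Lebesgue spaces\<close>

text \<open>Compare \<open>b\<close> with \<open>\<epsilon> * a powr (p - 1)\<close>: if it is
  smaller, the first term on the right dominates; otherwise \<open>a\<close> is bounded by a power
  of \<open>b / \<epsilon>\<close> and the second term does.\<close>

lemma Young_eps:
  fixes p \<epsilon> :: real
  assumes "p > 1" "\<epsilon> > 0"
  shows "\<exists>K\<ge>0. \<forall>a\<ge>0. \<forall>b\<ge>0. a * b \<le> \<epsilon> * a powr p + K * b powr (p / (p - 1))"
proof (intro exI conjI allI impI)
  let ?K = "(1 / \<epsilon>) powr (1 / (p - 1))"
  show "?K \<ge> 0" by simp
  fix a b :: real assume ab: "a \<ge> 0" "b \<ge> 0"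
  show "a * b \<le> \<epsilon> * a powr p + ?K * b powr (p / (p - 1))"
  proof (cases "b \<le> \<epsilon> * a powr (p - 1)")
    case True
    have "a * b \<le> a * (\<epsilon> * a powr (p - 1))" using True ab by (intro mult_left_mono)
    also have "\<dots> = \<epsilon> * a powr p"
      using ab by (cases "a = 0") (auto simp: powr_diff)
    finally show ?thesis by (simp add: add_increasing2)
  next
    case False
    then have b0: "b > 0" using ab assms by (smt (verit) mult_nonneg_nonneg powr_ge_zero)
    have "a powr (p - 1) \<le> b / \<epsilon>" using False assms by (simp add: field_simps)
    then have "(a powr (p - 1)) powr (1 / (p - 1)) \<le> (b / \<epsilon>) powr (1 / (p - 1))"
      using assms by (intro powr_mono2) auto
    then have "a \<le> (b / \<epsilon>) powr (1 / (p - 1))" using ab assms by (simp add: powr_powr)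
    then have "a * b \<le> (b * (1 / \<epsilon>)) powr (1 / (p - 1)) * b"
      using b0 by (intro mult_right_mono) auto
    also have "\<dots> = ?K * (b powr (1 / (p - 1)) * b powr 1)"
      using b0 assms by (subst powr_mult) auto
    also have "b powr (1 / (p - 1)) * b powr 1 = b powr (p / (p - 1))"
      unfolding powr_add[symmetric] using assms by (intro arg_cong[where f="\<lambda>s. b powr s"]) (simp add: field_simps)
    finally show ?thesis using assms by (simp add: add_increasing)
  qed
qed

lemma powr_add_le:
  fixes a b p :: real
  assumes "a \<ge> 0" "b \<ge> 0" "p \<ge> 0"
  shows "(a + b) powr p \<le> 2 powr p * (a powr p + b powr p)"
proof -
  have "(a + b) powr p \<le> (2 * max a b) powr p" using assms by (intro powr_mono2) auto
  also have "\<dots> = 2 powr p * max a b powr p" using assms by (subst powr_mult) auto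
  also have "\<dots> \<le> 2 powr p * (a powr p + b powr p)"
    by (intro mult_left_mono) (auto simp: max_def)
  finally show ?thesis .
qed

lemma Fatou_powr:
  fixes f :: "nat \<Rightarrow> 'a \<Rightarrow> 'b::euclidean_space"
  assumes f: "\<And>k. f k \<in> borel_measurable M" "l \<in> borel_measurable M"
    and int: "\<And>k. integrable M (\<lambda>x. norm (f k x) powr p)" "\<And>k. (\<integral>x. norm (f k x) powr p \<partial>M) \<le> B"
    and lim: "AE x in M. (\<lambda>k. f k x) \<longlonglongrightarrow> l x" and p: "p > 0"
  shows "integrable M (\<lambda>x. norm (l x) powr p)" "(\<integral>x. norm (l x) powr p \<partial>M) \<le> B"
proof -
  note [measurable] = f
  have B0: "B \<ge> 0" by (rule order_trans[OF _ int(2)[of 0]]) simp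
  have l: "AE x in M. (\<lambda>k. norm (f k x) powr p) \<longlonglongrightarrow> norm (l x) powr p"
    using lim by eventually_elim (use p in \<open>auto intro!: tendsto_powr' tendsto_norm\<close>)
  have "(\<integral>\<^sup>+x. ennreal (norm (l x) powr p) \<partial>M) = (\<integral>\<^sup>+x. liminf (\<lambda>k. ennreal (norm (f k x) powr p)) \<partial>M)"
    using l
  proof (intro nn_integral_cong_AE, eventually_elim)
    case (elim x)
    have "(\<lambda>k. ennreal (norm (f k x) powr p)) \<longlonglongrightarrow> ennreal (norm (l x) powr p)"
      using elim by (intro tendsto_ennrealI)
    then show ?case using lim_imp_Liminf[OF trivial_limit_sequentially] by metis
  qed
  also have "\<dots> \<le> liminf (\<lambda>k. \<integral>\<^sup>+x. ennreal (norm (f k x) powr p) \<partial>M)"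
    by (rule nn_integral_liminf) auto
  also have "\<dots> \<le> ennreal B"
  proof (rule Liminf_le[OF trivial_limit_sequentially])
    show "\<forall>\<^sub>F k in sequentially. (\<integral>\<^sup>+x. ennreal (norm (f k x) powr p) \<partial>M) \<le> ennreal B"
      using int by (subst nn_integral_eq_integral) (auto intro!: always_eventually ennreal_leI)
  qed
  finally have *: "(\<integral>\<^sup>+x. ennreal (norm (l x) powr p) \<partial>M) \<le> ennreal B" .
  show "integrable M (\<lambda>x. norm (l x) powr p)"
    by (rule integrableI_bounded) (use * in \<open>auto simp: le_less_trans[OF _ ennreal_less_top]\<close>)
  from nn_integral_eq_integral[OF this] * B0 show "(\<integral>x. norm (l x) powr p \<partial>M) \<le> B"
    by auto
qed

text \<open>Brezis--Lieb style: after subtracting \<open>\<epsilon> * norm (f k x - l x) powr p\<close>, the integrand is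
  dominated by a multiple of \<open>\<bar>g\<bar>\<close> to the conjugate exponent.\<close>

lemma Lp_bounded_ae_lim_weighted:
  fixes f :: "nat \<Rightarrow> 'a \<Rightarrow> 'b::euclidean_space" and g :: "'a \<Rightarrow> real"
  assumes f: "\<And>k. f k \<in> borel_measurable M" "l \<in> borel_measurable M"
    and int: "\<And>k. integrable M (\<lambda>x. norm (f k x) powr p)" "\<And>k. (\<integral>x. norm (f k x) powr p \<partial>M) \<le> B"
    and lim: "AE x in M. (\<lambda>k. f k x) \<longlonglongrightarrow> l x" and p: "p > 1"
    and g: "g \<in> borel_measurable M" "integrable M (\<lambda>x. \<bar>g x\<bar> powr (p / (p - 1)))"
  shows "(\<lambda>k. \<integral>x. norm (f k x - l x) * \<bar>g x\<bar> \<partial>M) \<longlonglongrightarrow> 0"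
    and "integrable M (\<lambda>x. norm (f k x - l x) * \<bar>g x\<bar>)"
proof -
  note [measurable] = f g(1)
  have B0: "B \<ge> 0" by (rule order_trans[OF _ int(2)[of 0]]) simp
  have l: "integrable M (\<lambda>x. norm (l x) powr p)" "(\<integral>x. norm (l x) powr p \<partial>M) \<le> B"
    by (rule Fatou_powr[OF f int lim]; use p in simp)+
  define d where "d k x = norm (f k x - l x)" for k x
  have [measurable]: "d k \<in> borel_measurable M" for k unfolding d_def by measurable
  have d0: "d k x \<ge> 0" for k x by (simp add: d_def)
  let ?R = "\<lambda>k x. 2 powr p * (norm (f k x) powr p + norm (l x) powr p)"
  have dp: "d k x powr p \<le> ?R k x" for k x
  proof -
    have "d k x powr p \<le> (norm (f k x) + norm (l x)) powr p"
      unfolding d_def using p by (intro powr_mono2 norm_triangle_ineq4) auto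
    also have "\<dots> \<le> ?R k x" using p by (intro powr_add_le) auto
    finally show ?thesis .
  qed
  have Rint: "integrable M (?R k)" for k using int(1) l(1) by auto
  have dint: "integrable M (\<lambda>x. d k x powr p)" for k
    by (rule Bochner_Integration.integrable_bound[OF Rint[of k]]) (use dp in auto)
  define D where "D = 2 powr p * (2 * B)"
  have dB: "(\<integral>x. d k x powr p \<partial>M) \<le> D" for k
  proof -
    have "(\<integral>x. d k x powr p \<partial>M) \<le> (\<integral>x. ?R k x \<partial>M)" by (intro integral_mono dint Rint dp)
    also have "\<dots> = 2 powr p * ((\<integral>x. norm (f k x) powr p \<partial>M) + (\<integral>x. norm (l x) powr p \<partial>M))"
      using int(1) l(1) by simp
    also have "\<dots> \<le> D" unfolding D_def using int(2)[of k] l(2) by (intro mult_left_mono) auto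
    finally show ?thesis .
  qed
  have D0: "D \<ge> 0" using B0 by (simp add: D_def)
  let ?q = "p / (p - 1)"
  have iprod: "integrable M (\<lambda>x. d k x * \<bar>g x\<bar>)" for k
  proof -
    obtain K where K: "K \<ge> 0" "\<And>a b. a \<ge> 0 \<Longrightarrow> b \<ge> 0 \<Longrightarrow> a * b \<le> 1 * a powr p + K * b powr ?q"
      using Young_eps[OF p, of 1] by auto
    show ?thesis
    proof (rule Bochner_Integration.integrable_bound[where f="\<lambda>x. d k x powr p + K * \<bar>g x\<bar> powr ?q"])
      show "integrable M (\<lambda>x. d k x powr p + K * \<bar>g x\<bar> powr ?q)" using dint g(2) by auto
      show "AE x in M. norm (d k x * \<bar>g x\<bar>) \<le> norm (d k x powr p + K * \<bar>g x\<bar> powr ?q)"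
        using K(2)[OF d0, of "\<bar>g _\<bar>"] d0 K(1) by (auto simp: abs_mult)
    qed measurable
  qed
  then show "integrable M (\<lambda>x. norm (f k x - l x) * \<bar>g x\<bar>)" unfolding d_def .
  show "(\<lambda>k. \<integral>x. norm (f k x - l x) * \<bar>g x\<bar> \<partial>M) \<longlonglongrightarrow> 0"
    unfolding d_def[symmetric]
  proof (rule LIMSEQ_I)
    fix e :: real assume e: "e > 0"
    \<comment> \<open>The subtracted part integrates to at most
      \<open>\<epsilon> * D \<le> e / 2\<close>, which leaves half of \<open>e\<close> for the
      integral of \<open>r\<close>.\<close>
    define \<epsilon> where "\<epsilon> = e / (2 * (D + 1))"
    have \<epsilon>: "\<epsilon> > 0" using e D0 by (simp add: \<epsilon>_def)
    have \<epsilon>D: "\<epsilon> * D \<le> e / 2"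
    proof -
      have "\<epsilon> * D \<le> \<epsilon> * (D + 1)" using \<epsilon> by simp
      also have "\<dots> = e / 2" using D0 by (simp add: \<epsilon>_def field_simps)
      finally show ?thesis .
    qed
    obtain K where K: "K \<ge> 0" "\<And>a b. a \<ge> 0 \<Longrightarrow> b \<ge> 0 \<Longrightarrow> a * b \<le> \<epsilon> * a powr p + K * b powr ?q"
      using Young_eps[OF p \<epsilon>] by auto
    define r where "r k x = max 0 (d k x * \<bar>g x\<bar> - \<epsilon> * d k x powr p)" for k x
    have [measurable]: "r k \<in> borel_measurable M" for k unfolding r_def by measurable
    have rb: "AE x in M. norm (r k x) \<le> K * \<bar>g x\<bar> powr ?q" for k
      using K(2)[OF d0, of "\<bar>g _\<bar>"] K(1) by (auto simp: r_def max_def algebra_simps)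
    have rl: "AE x in M. (\<lambda>k. r k x) \<longlonglongrightarrow> 0"
      using lim
    proof eventually_elim
      case (elim x)
      have "(\<lambda>k. d k x) \<longlonglongrightarrow> 0"
        unfolding d_def using elim by (intro tendsto_norm_zero) (simp add: LIM_zero_iff)
      then have "(\<lambda>k. d k x * \<bar>g x\<bar> - \<epsilon> * d k x powr p) \<longlonglongrightarrow> 0 * \<bar>g x\<bar> - \<epsilon> * 0 powr p"
        using p d0 by (intro tendsto_intros tendsto_powr') auto
      then have "(\<lambda>k. max 0 (d k x * \<bar>g x\<bar> - \<epsilon> * d k x powr p)) \<longlonglongrightarrow> max 0 (0 * \<bar>g x\<bar> - \<epsilon> * 0 powr p)"
        by (intro tendsto_max tendsto_const)
      then show ?case by (simp add: r_def)
    qed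
    have gint: "integrable M (\<lambda>x. K * \<bar>g x\<bar> powr ?q)" using g(2) by auto
    have "(\<lambda>k. \<integral>x. r k x \<partial>M) \<longlonglongrightarrow> (\<integral>x. 0 \<partial>M)"
      by (rule integral_dominated_convergence[OF _ _ gint rl rb]) auto
    moreover have rint: "integrable M (r k)" for k
      by (rule Bochner_Integration.integrable_bound[OF gint]) (use rb[of k] in auto)
    ultimately obtain N where N: "\<And>k. k \<ge> N \<Longrightarrow> \<bar>\<integral>x. r k x \<partial>M\<bar> < e / 2"
      using LIMSEQ_D[of "\<lambda>k. \<integral>x. r k x \<partial>M" 0 "e / 2"] e by auto
    show "\<exists>N. \<forall>k\<ge>N. norm ((\<integral>x. d k x * \<bar>g x\<bar> \<partial>M) - 0) < e"
    proof (intro exI allI impI)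
      fix k assume k: "N \<le> k"
      have "(\<integral>x. d k x * \<bar>g x\<bar> \<partial>M) \<le> (\<integral>x. r k x + \<epsilon> * d k x powr p \<partial>M)"
        by (intro integral_mono iprod Bochner_Integration.integrable_add rint) (use dint in \<open>auto simp: r_def\<close>)
      also have "\<dots> = (\<integral>x. r k x \<partial>M) + \<epsilon> * (\<integral>x. d k x powr p \<partial>M)"
        using rint dint by simp
      also have "\<dots> < e / 2 + e / 2"
        using N[OF k] \<epsilon>D mult_left_mono[OF dB[of k], of \<epsilon>] \<epsilon> by linarith
      finally have "(\<integral>x. d k x * \<bar>g x\<bar> \<partial>M) < e" by simp
      moreover have "(\<integral>x. d k x * \<bar>g x\<bar> \<partial>M) \<ge> 0" using d0 by (intro Bochner_Integration.integral_nonneg) auto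
      ultimately show "norm ((\<integral>x. d k x * \<bar>g x\<bar> \<partial>M) - 0) < e" by simp
    qed
  qed
qed

section \<open>Convex combinations and the existence theorem of Minty and Stampacchia type\<close>

lemma convex_comb_closed:
  fixes K :: "('a \<Rightarrow> 'b::real_vector) set"
  assumes conv: "\<And>z w t. z \<in> K \<Longrightarrow> w \<in> K \<Longrightarrow> 0 \<le> t \<Longrightarrow> t \<le> 1 \<Longrightarrow> (\<lambda>x. (1 - t) *\<^sub>R z x + t *\<^sub>R w x) \<in> K"
    and "finite I" "I \<noteq> {}"
  shows "I \<subseteq> K \<Longrightarrow> (\<And>j. j \<in> I \<Longrightarrow> c j \<ge> 0) \<Longrightarrow> (\<Sum>j\<in>I. c j) = (1::real) \<Longrightarrow> (\<lambda>x. \<Sum>j\<in>I. c j *\<^sub>R j x) \<in> K"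
  using assms(2,3)
proof (induction arbitrary: c rule: finite_ne_induct)
  case (singleton i)
  then show ?case by simp
next
  case (insert i I)
  define s where "s = (\<Sum>j\<in>I. c j)"
  have s: "s \<ge> 0" "c i = 1 - s" using insert by (auto simp: s_def intro!: sum_nonneg)
  have ci: "c i \<ge> 0" using insert by auto
  show ?case
  proof (cases "s = 0")
    case True
    then have "\<forall>j\<in>I. c j = 0"
      using insert unfolding s_def by (subst (asm) sum_nonneg_eq_0_iff) auto
    then have "(\<lambda>x. \<Sum>j\<in>insert i I. c j *\<^sub>R j x) = i"
      using insert True s by (auto simp: fun_eq_iff)
    then show ?thesis using insert by auto
  next
    case False
    have "(\<lambda>x. \<Sum>j\<in>I. (c j / s) *\<^sub>R j x) \<in> K"
    proof (rule insert.IH)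
      show "(\<Sum>j\<in>I. c j / s) = 1" using False by (simp add: sum_divide_distrib[symmetric] s_def[symmetric])
    qed (use insert s in auto)
    from conv[OF _ this, of i s] have "(\<lambda>x. (1 - s) *\<^sub>R i x + s *\<^sub>R (\<Sum>j\<in>I. (c j / s) *\<^sub>R j x)) \<in> K"
      using insert s ci by auto
    also have "(\<lambda>x. (1 - s) *\<^sub>R i x + s *\<^sub>R (\<Sum>j\<in>I. (c j / s) *\<^sub>R j x)) = (\<lambda>x. \<Sum>j\<in>insert i I. c j *\<^sub>R j x)"
      using insert False s by (auto simp: fun_eq_iff scaleR_sum_right)
    finally show ?thesis .
  qed
qed

text \<open>A monotone operator on a bounded convex set: finitely many Minty inequalities are solved
  inside the convex hull of the test points by \<open>skew_matrix_nonneg\<close>, all of them by compactness,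
  and the Stampacchia form follows by letting the test point approach the solution along
  segments.\<close>

theorem monotone_variational_inequality:
  fixes A :: "'a \<Rightarrow> 'b::euclidean_space \<Rightarrow> 'b" and K :: "('a \<Rightarrow> 'b) set"
  assumes fin: "finite_measure M" and ne: "K \<noteq> {}"
    and conv: "\<And>z w t. z \<in> K \<Longrightarrow> w \<in> K \<Longrightarrow> 0 \<le> t \<Longrightarrow> t \<le> 1 \<Longrightarrow> (\<lambda>x. (1 - t) *\<^sub>R z x + t *\<^sub>R w x) \<in> K"
    and meas: "\<And>z. z \<in> K \<Longrightarrow> z \<in> borel_measurable M"
    and bound: "\<And>z. z \<in> K \<Longrightarrow> AE x in M. norm (z x) \<le> \<rho>"
    and closed: "\<And>zs z. (\<And>k::nat. zs k \<in> K) \<Longrightarrow> z \<in> borel_measurable M \<Longrightarrow>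
                   AE x in M. (\<lambda>k. zs k x) \<longlonglongrightarrow> z x \<Longrightarrow> z \<in> K"
    and A_meas: "\<And>z. z \<in> K \<Longrightarrow> (\<lambda>x. A x (z x)) \<in> borel_measurable M"
    and \<kappa>: "integrable M \<kappa>"
    and A_bound: "\<And>z. z \<in> K \<Longrightarrow> AE x in M. norm (A x (z x)) \<le> \<kappa> x"
    and mono: "\<And>z w. z \<in> K \<Longrightarrow> w \<in> K \<Longrightarrow> AE x in M. 0 \<le> (A x (z x) - A x (w x)) \<bullet> (z x - w x)"
    and hemi: "\<And>z w. z \<in> K \<Longrightarrow> w \<in> K \<Longrightarrow>
       AE x in M. ((\<lambda>t. A x ((1 - t) *\<^sub>R z x + t *\<^sub>R w x)) \<longlongrightarrow> A x (z x)) (at_right 0)"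
  shows "\<exists>z\<in>K. \<forall>w\<in>K. 0 \<le> (\<integral>x. A x (z x) \<bullet> (w x - z x) \<partial>M) \<and> 0 \<le> (\<integral>x. A x (w x) \<bullet> (w x - z x) \<partial>M)"
proof -
  interpret finite_measure M by fact
  note [measurable] = meas A_meas
  have pair_bound: "AE x in M. norm (A x (v x) \<bullet> (w x - z x)) \<le> 2 * \<rho> * \<kappa> x" if "v \<in> K" "w \<in> K" "z \<in> K" for v w z
    using bound[OF that(2)] bound[OF that(3)] A_bound[OF that(1)]
  proof eventually_elim
    case (elim x)
    have "norm (A x (v x) \<bullet> (w x - z x)) \<le> norm (A x (v x)) * norm (w x - z x)"
      using Cauchy_Schwarz_ineq2 by auto
    also have "norm (w x - z x) \<le> 2 * \<rho>" using elim norm_triangle_ineq4[of "w x" "z x"] by linarith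
    then have "norm (A x (v x)) * norm (w x - z x) \<le> \<kappa> x * (2 * \<rho>)"
      using elim by (intro mult_mono) (auto intro: order_trans[OF norm_ge_zero])
    finally show ?case by (simp add: mult.commute)
  qed
  have \<kappa>2: "integrable M (\<lambda>x. 2 * \<rho> * \<kappa> x)" using \<kappa> by auto
  have pair_int: "integrable M (\<lambda>x. A x (v x) \<bullet> (w x - z x))" if "v \<in> K" "w \<in> K" "z \<in> K" for v w z
    by (rule Bochner_Integration.integrable_bound[OF \<kappa>2])
       (use that pair_bound[OF that] in \<open>auto intro!: borel_measurable_inner\<close>)
  \<comment> \<open>Minty's inequality for one test point is affine in \<open>z\<close>, so that
    \<open>C w\<close> is convex and closed under a.e. limits.\<close>
  define C where "C w = {z\<in>K. 0 \<le> (\<integral>x. A x (w x) \<bullet> (w x - z x) \<partial>M)}" for w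
  have "\<Inter>(C ` K) \<noteq> {}"
  proof (rule convex_ae_closed_fip[where M=M and B="\<rho> * measure M (space M)"])
    show "finite_measure M" by fact
    show "C ` K \<noteq> {}" using ne by simp
  next
    fix F assume F: "finite F" "F \<noteq> {}" "F \<subseteq> C ` K"
    then obtain I where I: "I \<subseteq> K" "finite I" "F = C ` I"
      by (meson finite_subset_image)
    have neI: "I \<noteq> {}" using F I by auto
    \<comment> \<open>For a convex combination of the test points Minty's integrals are linear in
      the weights, with matrix \<open>a\<close>; monotonicity is what gives the sign of
      \<open>a v w + a w v\<close>.\<close>
    define a where "a v w = (\<integral>x. A x (v x) \<bullet> (v x - w x) \<partial>M)" for v w
    have "a v w + a w v \<ge> 0" if "v \<in> I" "w \<in> I" for v w
    proof -
      have K: "v \<in> K" "w \<in> K" using that I by auto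
      have "a v w + a w v = (\<integral>x. A x (v x) \<bullet> (v x - w x) + A x (w x) \<bullet> (w x - v x) \<partial>M)"
        unfolding a_def using pair_int K by (intro Bochner_Integration.integral_add[symmetric]) auto
      also have "\<dots> \<ge> 0"
      proof (rule integral_nonneg_AE)
        show "AE x in M. 0 \<le> A x (v x) \<bullet> (v x - w x) + A x (w x) \<bullet> (w x - v x)"
          using mono[OF K] by eventually_elim (simp add: algebra_simps)
      qed
      finally show ?thesis .
    qed
    from skew_matrix_nonneg[of I a, OF I(2) neI this]
    obtain c where c: "\<And>i. i \<in> I \<Longrightarrow> c i \<ge> 0" "(\<Sum>i\<in>I. c i) = 1" "\<And>i. i \<in> I \<Longrightarrow> (\<Sum>j\<in>I. a i j * c j) \<ge> 0"
      by auto
    define z where "z x = (\<Sum>j\<in>I. c j *\<^sub>R j x)" for x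
    have z: "z \<in> K" unfolding z_def by (rule convex_comb_closed[OF conv I(2) neI I(1) c(1,2)])
    have "z \<in> C w" if w: "w \<in> I" for w
    proof -
      have wK: "w \<in> K" using w I by auto
      have "w x = (\<Sum>j\<in>I. c j *\<^sub>R w x)" for x
        using c(2) by (simp add: scaleR_sum_left[symmetric])
      then have "w x - z x = (\<Sum>j\<in>I. c j *\<^sub>R (w x - j x))" for x
        unfolding z_def scaleR_diff_right sum_subtractf by metis
      then have "A x (w x) \<bullet> (w x - z x) = (\<Sum>j\<in>I. (A x (w x) \<bullet> (w x - j x)) * c j)" for x
        by (simp add: inner_sum_right mult.commute)
      then have "(\<integral>x. A x (w x) \<bullet> (w x - z x) \<partial>M) = (\<integral>x. (\<Sum>j\<in>I. (A x (w x) \<bullet> (w x - j x)) * c j) \<partial>M)"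
        by simp
      also have "\<dots> = (\<Sum>j\<in>I. a w j * c j)"
        unfolding a_def using pair_int wK I
        by (subst Bochner_Integration.integral_sum) auto
      finally show ?thesis using c(3)[OF w] z by (simp add: C_def)
    qed
    then show "\<Inter>F \<noteq> {}" using I by auto
  next
    fix D z assume "D \<in> C ` K" "z \<in> D"
    then have z: "z \<in> K" by (auto simp: C_def)
    show "integrable M z \<and> (\<integral>x. norm (z x) \<partial>M) \<le> \<rho> * measure M (space M)"
    proof
      show i: "integrable M z" by (rule integrable_const_bound[OF bound[OF z]]) (use z in auto)
      have "(\<integral>x. norm (z x) \<partial>M) \<le> (\<integral>x. \<rho> \<partial>M)"
        by (intro integral_mono_AE) (use i bound[OF z] in auto)
      then show "(\<integral>x. norm (z x) \<partial>M) \<le> \<rho> * measure M (space M)" by (simp add: mult.commute)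
    qed
  next
    fix D z v assume "D \<in> C ` K" "z \<in> D" "v \<in> D"
    then obtain w where w: "w \<in> K" "D = C w" and zv: "z \<in> K" "v \<in> K" and
      i: "0 \<le> (\<integral>x. A x (w x) \<bullet> (w x - z x) \<partial>M)" "0 \<le> (\<integral>x. A x (w x) \<bullet> (w x - v x) \<partial>M)"
      by (auto simp: C_def)
    have h: "(\<lambda>x. (1/2) *\<^sub>R (z x + v x)) \<in> K"
      using conv[OF zv, of "1/2"] by (simp add: scaleR_add_right)
    have "(\<integral>x. A x (w x) \<bullet> (w x - (1/2) *\<^sub>R (z x + v x)) \<partial>M)
        = (\<integral>x. (1/2) * (A x (w x) \<bullet> (w x - z x)) + (1/2) * (A x (w x) \<bullet> (w x - v x)) \<partial>M)"
      by (intro Bochner_Integration.integral_cong refl) (simp add: inner_diff_right inner_add_right field_simps)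
    also have "\<dots> \<ge> 0" using i pair_int w zv by simp
    finally show "(\<lambda>x. (1/2) *\<^sub>R (z x + v x)) \<in> D" using h w by (simp add: C_def)
  next
    fix D and zs :: "nat \<Rightarrow> 'a \<Rightarrow> 'b" and z
    assume D: "D \<in> C ` K" and zs: "\<And>k. zs k \<in> D" and zm: "z \<in> borel_measurable M"
      and lim: "AE x in M. (\<lambda>k. zs k x) \<longlonglongrightarrow> z x"
    then obtain w where w: "w \<in> K" "D = C w" by auto
    have zsK: "zs k \<in> K" and i: "0 \<le> (\<integral>x. A x (w x) \<bullet> (w x - zs k x) \<partial>M)" for k
      using zs[of k] w by (auto simp: C_def)
    have zK: "z \<in> K" by (rule closed[OF zsK zm lim])
    have "(\<lambda>k. \<integral>x. A x (w x) \<bullet> (w x - zs k x) \<partial>M) \<longlonglongrightarrow> (\<integral>x. A x (w x) \<bullet> (w x - z x) \<partial>M)"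
    proof (rule integral_dominated_convergence[OF _ _ \<kappa>2 _ pair_bound[OF w(1) w(1) zsK]])
      show "AE x in M. (\<lambda>k. A x (w x) \<bullet> (w x - zs k x)) \<longlonglongrightarrow> A x (w x) \<bullet> (w x - z x)"
        using lim by eventually_elim (intro tendsto_intros)
    qed (rule borel_measurable_integrable[OF pair_int[OF w(1) w(1)]], rule zK zsK)+
    then have "0 \<le> (\<integral>x. A x (w x) \<bullet> (w x - z x) \<partial>M)"
      by (rule LIMSEQ_le_const) (use i in auto)
    then show "z \<in> D" using zK w by (simp add: C_def)
  qed
  then obtain z where "z \<in> \<Inter>(C ` K)" by blast
  then have z: "z \<in> K" and minty: "\<And>w. w \<in> K \<Longrightarrow> 0 \<le> (\<integral>x. A x (w x) \<bullet> (w x - z x) \<partial>M)"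
    using ne by (auto simp: C_def)
  have "0 \<le> (\<integral>x. A x (z x) \<bullet> (w x - z x) \<partial>M)" if w: "w \<in> K" for w
  proof -
    \<comment> \<open>Minty's inequality at a point of the segment from \<open>z\<close> to
      \<open>w\<close> carries the factor \<open>t k\<close>. Divide by it; as \<open>t k\<close>
      tends to 0, the operator is evaluated at \<open>z\<close> itself.\<close>
    define t where "t k = inverse (real (Suc k))" for k
    have t: "0 < t k" "t k \<le> 1" for k by (auto simp: t_def divide_simps)
    define v where "v k x = (1 - t k) *\<^sub>R z x + t k *\<^sub>R w x" for k x
    have v: "v k \<in> K" for k unfolding v_def using t[of k] by (intro conv z w) auto
    have "0 \<le> (\<integral>x. A x (v k x) \<bullet> (w x - z x) \<partial>M)" for k
    proof -
      have "0 \<le> (\<integral>x. A x (v k x) \<bullet> (v k x - z x) \<partial>M)" by (rule minty[OF v])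
      also have "\<dots> = (\<integral>x. t k * (A x (v k x) \<bullet> (w x - z x)) \<partial>M)"
      proof (intro Bochner_Integration.integral_cong refl)
        fix x
        have "v k x - z x = t k *\<^sub>R (w x - z x)" by (simp add: v_def algebra_simps)
        then show "A x (v k x) \<bullet> (v k x - z x) = t k * (A x (v k x) \<bullet> (w x - z x))" by simp
      qed
      also have "\<dots> = t k * (\<integral>x. A x (v k x) \<bullet> (w x - z x) \<partial>M)" by simp
      finally show ?thesis using t(1)[of k] by (simp add: zero_le_mult_iff)
    qed
    moreover have "(\<lambda>k. \<integral>x. A x (v k x) \<bullet> (w x - z x) \<partial>M) \<longlonglongrightarrow> (\<integral>x. A x (z x) \<bullet> (w x - z x) \<partial>M)"
    proof (rule integral_dominated_convergence[OF _ _ \<kappa>2 _ pair_bound[OF v w z]])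
      have tl: "filterlim t (at_right 0) sequentially"
        unfolding filterlim_at using t LIMSEQ_inverse_real_of_nat by (auto simp: t_def[abs_def])
      show "AE x in M. (\<lambda>k. A x (v k x) \<bullet> (w x - z x)) \<longlonglongrightarrow> A x (z x) \<bullet> (w x - z x)"
        using hemi[OF z w]
      proof eventually_elim
        case (elim x)
        from filterlim_compose[OF elim tl] show ?case
          unfolding v_def by (intro tendsto_intros)
      qed
    qed (rule borel_measurable_integrable[OF pair_int[OF _ w z]], rule v z)+
    ultimately show ?thesis by (intro LIMSEQ_le_const) auto
  qed
  then show ?thesis using z minty by blast
qed

section \<open>The torus and trigonometric polynomials\<close>

lemma space_torus [simp]: "space torus = cbox 0 1"
  by (simp add: torus_def space_restrict_space)

lemma emeasure_torus [simp]: "emeasure (torus :: (real^'n::finite) measure) (cbox 0 1) = 1"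
proof -
  have "emeasure (torus :: (real^'n) measure) (cbox 0 1) = emeasure lborel (cbox 0 (1::real^'n))"
    unfolding torus_def by (subst emeasure_restrict_space) auto
  also have "\<dots> = 1"
  proof -
    have "(\<Prod>b\<in>Basis. (1::real^'n) \<bullet> b) = 1"
      by (rule prod.neutral) (auto simp: Basis_vec_def inner_axis)
    then show ?thesis by (subst emeasure_lborel_cbox_eq) (auto simp: Basis_vec_def inner_axis)
  qed
  finally show ?thesis .
qed

lemma measure_torus [simp]: "measure torus (cbox 0 1) = 1"
  by (simp add: measure_def)

lemma finite_measure_torus: "finite_measure torus"
  by (rule finite_measureI) simp

text \<open>\<open>torus\<close> restricts the completed Lebesgue measure, so a change on a null set
  cannot destroy measurability.\<close>

lemma borel_measurable_torus_AE:
  fixes f g :: "real^'n::finite \<Rightarrow> 'b::euclidean_space"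
  assumes f: "f \<in> borel_measurable torus" and ae: "AE x in torus. f x = g x"
  shows "g \<in> borel_measurable torus"
proof -
  have *: "h \<in> borel_measurable torus \<longleftrightarrow> (\<lambda>x. if x \<in> cbox 0 1 then h x else 0) \<in> borel_measurable lebesgue"
    for h :: "real^'n \<Rightarrow> 'b"
    unfolding torus_def by (rule borel_measurable_if[symmetric]) auto
  have "AE x in lebesgue. x \<in> cbox 0 1 \<longrightarrow> f x = g x"
    using ae unfolding torus_def by (subst (asm) AE_restrict_space_iff) auto
  then have "AE x in lebesgue. (if x \<in> cbox 0 1 then f x else 0) = (if x \<in> cbox 0 1 then g x else 0)"
    by eventually_elim auto
  then show ?thesis using f unfolding * by (rule borel_measurable_AE[rotated])
qed

lemma continuous_borel_measurable_torus:
  "continuous_on UNIV f \<Longrightarrow> f \<in> borel_measurable torus"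
  unfolding torus_def by (intro continuous_imp_measurable_on_sets_lebesgue) (auto intro: continuous_on_subset)

lemma continuous_bounded_torus:
  fixes f :: "real^'n::finite \<Rightarrow> 'b::real_normed_vector"
  assumes "continuous_on UNIV f"
  obtains B where "B > 0" "\<And>x. x \<in> cbox 0 1 \<Longrightarrow> norm (f x) \<le> B"
proof -
  have "bounded (f ` cbox 0 1)"
    by (intro compact_imp_bounded compact_continuous_image continuous_on_subset[OF assms]) auto
  then show ?thesis using that by (auto simp: bounded_pos)
qed

lemma AE_torus_interior: "AE x in torus. x \<in> box 0 (1::real^'n::finite)"
proof -
  have "cbox 0 1 - box 0 (1::real^'n) \<in> null_sets lebesgue"
    using negligible_frontier_interval[of 0 "1::real^'n"] by (simp add: negligible_iff_null_sets)
  then have "AE x in lebesgue. x \<notin> cbox 0 1 - box 0 (1::real^'n)" by (rule AE_not_in)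
  then have "AE x in lebesgue. x \<in> cbox 0 1 \<longrightarrow> x \<in> box 0 (1::real^'n)" by eventually_elim auto
  then show ?thesis unfolding torus_def by (subst AE_restrict_space_iff) auto
qed

section \<open>Gradients and trigonometric polynomials\<close>

lemma GDERIV_unique: "GDERIV f x :> D \<Longrightarrow> GDERIV f x :> D' \<Longrightarrow> D = D'"
  unfolding gderiv_def by (drule (1) has_derivative_unique) (metis vector_eq_ldot)

lemma grad_eqI: "GDERIV f x :> D \<Longrightarrow> grad f x = D"
  unfolding grad_def by (rule the_equality) (auto intro: GDERIV_unique)

lemma GDERIV_grad:
  fixes f :: "'a::euclidean_space \<Rightarrow> real"
  assumes "f differentiable (at x)"
  shows "GDERIV f x :> grad f x"
proof -
  obtain f' where f': "(f has_derivative f') (at x)" using assms by (auto simp: differentiable_def)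
  then have lin: "linear f'" by (rule has_derivative_linear)
  have "f' h = h \<bullet> (\<Sum>b\<in>Basis. f' b *\<^sub>R b)" for h
  proof -
    have "f' h = f' (\<Sum>b\<in>Basis. (h \<bullet> b) *\<^sub>R b)" by (simp only: euclidean_representation)
    also have "\<dots> = (\<Sum>b\<in>Basis. (h \<bullet> b) * f' b)" by (simp add: linear_sum[OF lin] linear_cmul[OF lin])
    also have "\<dots> = h \<bullet> (\<Sum>b\<in>Basis. f' b *\<^sub>R b)" by (simp add: inner_sum_right mult.commute)
    finally show ?thesis .
  qed
  then have "f' = (\<lambda>h. h \<bullet> (\<Sum>b\<in>Basis. f' b *\<^sub>R b))" by (rule ext)
  with f' have "GDERIV f x :> (\<Sum>b\<in>Basis. f' b *\<^sub>R b)" unfolding gderiv_def by metis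
  then show ?thesis by (simp only: grad_eqI)
qed

text \<open>The algebra generated by the sines and cosines of the coordinates. Closure rules make
  periodicity, boundedness and stability under derivatives and translations short inductions; the
  class supplies all concrete test functions for weak gradients.\<close>

inductive trig :: "(real^'n::finite \<Rightarrow> real) \<Rightarrow> bool" where
  const: "trig (\<lambda>x. c)"
| cos: "trig (\<lambda>x. cos (2 * pi * x $ i))"
| sin: "trig (\<lambda>x. sin (2 * pi * x $ i))"
| add: "trig f \<Longrightarrow> trig g \<Longrightarrow> trig (\<lambda>x. f x + g x)"
| mult: "trig f \<Longrightarrow> trig g \<Longrightarrow> trig (\<lambda>x. f x * g x)"

lemma trig_GDERIV:
  "trig f \<Longrightarrow> \<exists>D. (\<forall>x. GDERIV f x :> D x) \<and> (\<forall>i. trig (\<lambda>x. D x $ i))"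
proof (induction rule: trig.induct)
  case (const c)
  then show ?case by (intro exI[of _ "\<lambda>x. 0"]) (auto intro: GDERIV_const trig.const)
next
  case (cos i)
  have "GDERIV (\<lambda>x::real^'a. 2 * pi * x $ i) x :> (2 * pi) *\<^sub>R axis i 1" for x
    unfolding gderiv_def
    by (auto intro!: derivative_eq_intros bounded_linear_imp_has_derivative[OF bounded_linear_vec_nth] simp: inner_axis mult.commute)
  from GDERIV_DERIV_compose[OF this DERIV_cos]
  have "GDERIV (\<lambda>x::real^'a. cos (2 * pi * x $ i)) x :> - sin (2 * pi * x $ i) *\<^sub>R (2 * pi) *\<^sub>R axis i 1" for x .
  moreover have "trig (\<lambda>x. (- (2 * pi) * axis i 1 $ j) * sin (2 * pi * x $ i))" for j
    by (intro trig.mult trig.const trig.sin)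
  ultimately show ?case
    by (intro exI[of _ "\<lambda>x. - sin (2 * pi * x $ i) *\<^sub>R (2 * pi) *\<^sub>R axis i 1"]) (auto simp: mult_ac)
next
  case (sin i)
  have "GDERIV (\<lambda>x::real^'a. 2 * pi * x $ i) x :> (2 * pi) *\<^sub>R axis i 1" for x
    unfolding gderiv_def
    by (auto intro!: derivative_eq_intros bounded_linear_imp_has_derivative[OF bounded_linear_vec_nth] simp: inner_axis mult.commute)
  from GDERIV_DERIV_compose[OF this DERIV_sin]
  have "GDERIV (\<lambda>x::real^'a. sin (2 * pi * x $ i)) x :> cos (2 * pi * x $ i) *\<^sub>R (2 * pi) *\<^sub>R axis i 1" for x .
  moreover have "trig (\<lambda>x. ((2 * pi) * axis i 1 $ j) * cos (2 * pi * x $ i))" for j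
    by (intro trig.mult trig.const trig.cos)
  ultimately show ?case
    by (intro exI[of _ "\<lambda>x. cos (2 * pi * x $ i) *\<^sub>R (2 * pi) *\<^sub>R axis i 1"]) (auto simp: mult_ac)
next
  case (add f g)
  then obtain D E where "\<And>x. GDERIV f x :> D x" "\<And>i. trig (\<lambda>x. D x $ i)"
    "\<And>x. GDERIV g x :> E x" "\<And>i. trig (\<lambda>x. E x $ i)" by auto
  then show ?case
    by (intro exI[of _ "\<lambda>x. D x + E x"]) (auto intro!: GDERIV_add trig.add)
next
  case (mult f g)
  then obtain D E where "\<And>x. GDERIV f x :> D x" "\<And>i. trig (\<lambda>x. D x $ i)"
    "\<And>x. GDERIV g x :> E x" "\<And>i. trig (\<lambda>x. E x $ i)" by auto
  then show ?case using mult.hyps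
    by (intro exI[of _ "\<lambda>x. f x *\<^sub>R E x + g x *\<^sub>R D x"]) (auto intro!: GDERIV_mult trig.add trig.mult)
qed

lemma trig_differentiable: "trig f \<Longrightarrow> f differentiable (at x)"
  using trig_GDERIV[of f] unfolding gderiv_def differentiable_def by blast

lemma trig_grad: "trig f \<Longrightarrow> trig (\<lambda>x. grad f x $ i)"
proof -
  assume "trig f"
  then obtain D where D: "\<And>x. GDERIV f x :> D x" "\<And>i. trig (\<lambda>x. D x $ i)" using trig_GDERIV by metis
  then have "grad f = D" using grad_eqI by blast
  then show ?thesis using D by simp
qed

lemma trig_continuous: "trig f \<Longrightarrow> continuous_on UNIV f"
  using trig_differentiable by (meson continuous_at_imp_continuous_on differentiable_imp_continuous_within)

lemma trig_smooth: "trig f \<Longrightarrow> smooth f"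
proof -
  have "trig f \<Longrightarrow> C_k k f" for k
  proof (induction k arbitrary: f)
    case 0
    then show ?case by (simp add: trig_continuous)
  next
    case (Suc k)
    then have "f differentiable_on UNIV"
      unfolding differentiable_on_def by (blast intro: differentiable_at_withinI trig_differentiable)
    then show ?case using Suc.IH[OF trig_grad[OF Suc.prems]] by simp
  qed
  then show "trig f \<Longrightarrow> smooth f" by (auto simp: smooth_def)
qed

lemma trig_periodic: "trig f \<Longrightarrow> periodic f"
  by (induction rule: trig.induct) (auto simp: periodic_def axis_def distrib_left)

lemma trig_sum: "finite I \<Longrightarrow> (\<And>i. i \<in> I \<Longrightarrow> trig (f i)) \<Longrightarrow> trig (\<lambda>x. \<Sum>i\<in>I. f i x)"
  by (induction I rule: finite_induct) (auto intro: trig.intros)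

text \<open>The embedding of the torus into a product of circles. Polynomials on the target pull
  back to \<open>trig\<close> functions, which gives access to the Stone-Weierstrass
  theorem.\<close>

definition circles :: "real^'n::finite \<Rightarrow> (real^'n) \<times> (real^'n)" where
  "circles x = (\<chi> i. cos (2 * pi * x $ i), \<chi> i. sin (2 * pi * x $ i))"

lemma trig_polynomial:
  fixes p :: "(real^'n::finite) \<times> (real^'n) \<Rightarrow> real"
  shows "real_polynomial_function p \<Longrightarrow> trig (\<lambda>x. p (circles x))"
proof (induction rule: real_polynomial_function.induct)
  case (linear f)
  then interpret bounded_linear f .
  have "f (circles x) = (\<Sum>i\<in>UNIV. cos (2 * pi * x $ i) * f (axis i 1, 0)) + (\<Sum>i\<in>UNIV. sin (2 * pi * x $ i) * f (0, axis i 1))" for x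
  proof -
    have v: "(\<Sum>i\<in>UNIV. v $ i *\<^sub>R axis i 1) = v" for v :: "real^'n"
      using basis_expansion[of v] by (simp add: scalar_mult_eq_scaleR)
    have "f (v, w) = (\<Sum>i\<in>UNIV. v $ i * f (axis i 1, 0)) + (\<Sum>i\<in>UNIV. w $ i * f (0, axis i 1))" for v w
    proof -
      have "f (v, w) = f (v, 0) + f (0, w)" by (simp flip: add)
      also have "(v, 0) = (\<Sum>i\<in>UNIV. v $ i *\<^sub>R (axis i 1, 0::real^'n))"
        by (simp add: prod_eq_iff fst_sum snd_sum v)
      also have "(0, w) = (\<Sum>i\<in>UNIV. w $ i *\<^sub>R (0::real^'n, axis i 1))"
        by (simp add: prod_eq_iff fst_sum snd_sum v)
      finally show ?thesis unfolding sum scaleR by simp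
    qed
    from this[of "\<chi> i. cos (2 * pi * x $ i)" "\<chi> i. sin (2 * pi * x $ i)"]
    show ?thesis by (simp add: circles_def)
  qed
  moreover have "trig (\<lambda>x. (\<Sum>i\<in>UNIV. cos (2 * pi * x $ i) * f (axis i 1, 0)) + (\<Sum>i\<in>UNIV. sin (2 * pi * x $ i) * f (0, axis i 1)))"
    by (intro trig.add trig_sum trig.mult trig.const trig.cos trig.sin) auto
  ultimately show ?case by simp
qed (auto intro: trig.intros)

text \<open>Equal sines and cosines leave an integer difference in each coordinate, and between
  points of the unit interval a nonzero integer difference joins its two ends. So
  \<open>circles\<close> identifies boundary points of the cube only.\<close>

lemma circles_eqD:
  fixes x y :: "real^'n::finite"
  assumes "circles x = circles y" "x \<in> cbox 0 1" "y \<in> cbox 0 1"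
  shows "x = y \<or> (x \<notin> box 0 1 \<and> y \<notin> box 0 1)"
proof (cases "x = y")
  case False
  then obtain i where i: "x $ i \<noteq> y $ i" by (auto simp: vec_eq_iff)
  have "cos (2 * pi * x $ i) = cos (2 * pi * y $ i)" "sin (2 * pi * x $ i) = sin (2 * pi * y $ i)"
    using assms(1) by (auto simp: circles_def vec_eq_iff)
  then obtain n :: int where n: "2 * pi * x $ i = 2 * pi * y $ i + 2 * pi * of_int n"
    using sin_cos_eq_iff[of "2 * pi * x $ i" "2 * pi * y $ i"] by auto
  have "2 * pi * x $ i = 2 * pi * (y $ i + of_int n)" unfolding distrib_left n ..
  then have n: "x $ i = y $ i + of_int n" by simp
  have b: "0 \<le> x $ i" "x $ i \<le> 1" "0 \<le> y $ i" "y $ i \<le> 1"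
    using assms by (auto simp: mem_box_cart)
  have "\<bar>of_int n :: real\<bar> \<le> 1" "n \<noteq> 0" using n b i by auto
  then have "n = 1 \<or> n = -1" by linarith
  then have "x $ i = 0 \<or> x $ i = 1" "y $ i = 0 \<or> y $ i = 1" using n b by auto
  then show ?thesis by (auto simp: mem_box_cart intro!: exI[of _ i])
qed auto

text \<open>Vanishing on the boundary makes \<open>f\<close> constant on the fibres of
  \<open>circles\<close>, so it factors through the compact image, where polynomials are uniformly
  dense.\<close>

lemma trig_uniformly_dense:
  fixes f :: "real^'n::finite \<Rightarrow> real"
  assumes f: "continuous_on (cbox 0 1) f" and bd: "\<And>x. x \<in> cbox 0 1 \<Longrightarrow> x \<notin> box 0 1 \<Longrightarrow> f x = 0"
    and e: "e > 0"
  shows "\<exists>\<phi>. trig \<phi> \<and> (\<forall>x\<in>cbox 0 1. \<bar>f x - \<phi> x\<bar> < e)"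
proof -
  let ?Q = "cbox 0 (1::real^'n)"
  define K where "K = circles ` ?Q"
  have cc: "continuous_on A circles" for A :: "(real^'n) set"
    unfolding circles_def by (intro continuous_intros)
  have K: "compact K" unfolding K_def by (intro compact_continuous_image cc) auto
  define F where "F y = f (SOME x. x \<in> ?Q \<and> circles x = y)" for y
  have F: "F (circles x) = f x" if x: "x \<in> ?Q" for x
  proof -
    define x' where "x' = (SOME x'. x' \<in> ?Q \<and> circles x' = circles x)"
    have x': "x' \<in> ?Q" "circles x' = circles x"
      unfolding x'_def by (rule someI2[of _ x]; use x in simp)+
    have "f x' = f x" using circles_eqD[OF x'(2,1) x] bd[OF x'(1)] bd[OF x] by auto
    then show ?thesis by (simp add: F_def x'_def)
  qed
  \<comment> \<open>\<open>circles\<close> is a closed map on the compact cube: the preimage of a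
    closed set under \<open>F\<close> is the image of a compact set.\<close>
  have "continuous_on K F"
    unfolding continuous_on_closed_vimage[OF compact_imp_closed[OF K]]
  proof (intro allI impI)
    fix C :: "real set" assume C: "closed C"
    have "compact (?Q \<inter> f -` C)"
      using continuous_closed_preimage[OF f _ C] by (auto intro: bounded_subset simp: compact_eq_bounded_closed)
    then have "compact (circles ` (?Q \<inter> f -` C))" by (intro compact_continuous_image cc)
    moreover have "circles ` (?Q \<inter> f -` C) = F -` C \<inter> K"
      unfolding K_def using F by auto
    ultimately show "closed (F -` C \<inter> K)" by (metis compact_imp_closed)
  qed
  then obtain g where g: "real_polynomial_function g" "\<And>y. y \<in> K \<Longrightarrow> \<bar>F y - g y\<bar> < e"
    using Stone_Weierstrass_real_polynomial_function[OF K _ e] by metis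
  have "\<bar>f x - g (circles x)\<bar> < e" if "x \<in> ?Q" for x
    using g(2)[of "circles x"] F[OF that] that by (simp add: K_def)
  then show ?thesis using trig_polynomial[OF g(1)] by blast
qed

text \<open>\<open>measurable_on\<close> provides continuous functions converging a.e. Clipping them
  at \<open>B\<close> and multiplying by a cutoff that vanishes on the faces and tends to 1 inside
  makes \<open>trig_uniformly_dense\<close> applicable. The extra 1 in the bound is room for the
  approximation error.\<close>

lemma trig_dense_ae:
  fixes g :: "real^'n::finite \<Rightarrow> real"
  assumes g: "g \<in> borel_measurable torus" and B: "\<And>x. x \<in> cbox 0 1 \<Longrightarrow> \<bar>g x\<bar> \<le> B"
  shows "\<exists>\<phi>::nat \<Rightarrow> real^'n \<Rightarrow> real. (\<forall>k. trig (\<phi> k) \<and> (\<forall>x\<in>cbox 0 1. \<bar>\<phi> k x\<bar> \<le> B + 1))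
    \<and> (AE x in torus. (\<lambda>k. \<phi> k x) \<longlonglongrightarrow> g x)"
proof -
  let ?Q = "cbox 0 (1::real^'n)" and ?I = "box 0 (1::real^'n)"
  have B0: "B \<ge> 0" using B[of 0] by (auto simp: mem_box_cart)
  have "g measurable_on ?Q"
    using g by (subst measurable_on_iff_borel_measurable) (auto simp: torus_def)
  then obtain N h where N: "negligible N" and h: "\<And>k. continuous_on UNIV (h k)"
    and lim: "\<And>x. x \<notin> N \<Longrightarrow> (\<lambda>k. h k x) \<longlonglongrightarrow> (if x \<in> ?Q then g x else 0)"
    unfolding measurable_on_def by blast
  define c where "c k x = min 1 (real k * infdist x (- ?I))" for k x
  define f where "f k x = max (- B) (min B (h k x)) * c k x" for k x
  have "(0::real^'n) \<in> - ?I" by (simp add: mem_box_cart)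
  then have closed: "closed (- ?I)" "- ?I \<noteq> {}"
    by (auto simp only: closed_Compl[OF open_box] empty_iff)
  have c0: "c k x = 0" if "x \<notin> ?I" for k x
    using that closed in_closed_iff_infdist_zero[OF closed, of x] by (simp add: c_def)
  have cb: "0 \<le> c k x" "c k x \<le> 1" for k x by (auto simp: c_def infdist_nonneg)
  have cl: "(\<lambda>k. c k x) \<longlonglongrightarrow> 1" if "x \<in> ?I" for x
  proof -
    have d: "infdist x (- ?I) > 0" using infdist_pos_not_in_closed[OF closed, of x] that by simp
    obtain K :: nat where K: "1 < real K * infdist x (- ?I)" using reals_Archimedean3[OF d] by blast
    have "c k x = 1" if "k \<ge> K" for k
    proof -
      have "real K * infdist x (- ?I) \<le> real k * infdist x (- ?I)" using that d by (intro mult_right_mono) auto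
      then show ?thesis using K by (simp add: c_def)
    qed
    then show ?thesis by (intro tendsto_eventually eventually_sequentiallyI[of K])
  qed
  have fb: "\<bar>f k x\<bar> \<le> B" for k x
  proof -
    have "\<bar>f k x\<bar> = \<bar>max (- B) (min B (h k x))\<bar> * c k x" using cb by (simp add: f_def abs_mult)
    also have "\<dots> \<le> B * 1" using cb B0 by (intro mult_mono) auto
    finally show ?thesis by simp
  qed
  have fc: "continuous_on ?Q (f k)" for k
    unfolding f_def c_def by (intro continuous_intros continuous_on_subset[OF h]) auto
  have "\<exists>\<phi>. trig \<phi> \<and> (\<forall>x\<in>?Q. \<bar>f k x - \<phi> x\<bar> < inverse (real (Suc k)))" for k
    by (rule trig_uniformly_dense[OF fc]) (use c0 in \<open>auto simp: f_def\<close>)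
  then obtain \<phi> where \<phi>: "\<And>k. trig (\<phi> k)" "\<And>k x. x \<in> ?Q \<Longrightarrow> \<bar>f k x - \<phi> k x\<bar> < inverse (real (Suc k))"
    by metis
  have "\<bar>\<phi> k x\<bar> \<le> B + 1" if "x \<in> ?Q" for k x
  proof -
    have "inverse (real (Suc k)) \<le> 1" by (simp add: divide_simps)
    then show ?thesis using \<phi>(2)[OF that, of k] fb[of k x] by linarith
  qed
  moreover have "AE x in torus. (\<lambda>k. \<phi> k x) \<longlonglongrightarrow> g x"
  proof -
    have "AE x in lebesgue. x \<notin> N" using N by (intro AE_not_in) (simp add: negligible_iff_null_sets)
    then have "AE x in torus. x \<notin> N" unfolding torus_def by (subst AE_restrict_space_iff) auto
    with AE_torus_interior show ?thesis
    proof eventually_elim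
      case (elim x)
      then have xQ: "x \<in> ?Q" using box_subset_cbox by blast
      have "(\<lambda>k. f k x) \<longlonglongrightarrow> max (- B) (min B (g x)) * 1"
        unfolding f_def using lim[OF elim(2)] xQ cl[OF elim(1)]
        by (intro tendsto_intros tendsto_max tendsto_min) auto
      moreover have "max (- B) (min B (g x)) = g x" using B[OF xQ] by auto
      moreover have "(\<lambda>k. \<phi> k x - f k x) \<longlonglongrightarrow> 0"
      proof (rule Lim_null_comparison[OF _ LIMSEQ_inverse_real_of_nat])
        show "\<forall>\<^sub>F k in sequentially. norm (\<phi> k x - f k x) \<le> inverse (real (Suc k))"
          using \<phi>(2)[OF xQ] by (intro always_eventually) (auto simp: abs_minus_commute less_imp_le)
      qed
      ultimately have "(\<lambda>k. (\<phi> k x - f k x) + f k x) \<longlonglongrightarrow> 0 + g x" by (intro tendsto_add) auto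
      then show ?case by simp
    qed
  qed
  ultimately show ?thesis using \<phi>(1) by blast
qed

section \<open>Weak gradients and the Poincare inequality\<close>

lemma smooth_C_k: "smooth \<phi> \<Longrightarrow> C_k k \<phi>"
  by (simp add: smooth_def)

lemma smooth_continuous: "smooth \<phi> \<Longrightarrow> continuous_on UNIV \<phi>"
  using smooth_C_k[of \<phi> 0] by simp

lemma smooth_grad_continuous:
  fixes \<phi> :: "real^'n::finite \<Rightarrow> real"
  assumes "smooth \<phi>"
  shows "continuous_on UNIV (grad \<phi>)"
proof -
  have "continuous_on UNIV (\<lambda>x. grad \<phi> x $ i)" for i
    using smooth_C_k[OF assms, of "Suc 0"] by simp
  then have "continuous_on UNIV (\<lambda>x. \<chi> i. grad \<phi> x $ i)" by (intro continuous_on_vec_lambda)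
  then show ?thesis by simp
qed

section \<open>Translation invariance of integrals of periodic functions\<close>

definition half_open_cube :: "(real^'n) set" where
  "half_open_cube = {x. \<forall>i. 0 \<le> x $ i \<and> x $ i < 1}"

lemma half_open_cube_borel [measurable]: "(half_open_cube :: (real^'n::finite) set) \<in> sets borel"
proof -
  have "half_open_cube = (\<Inter>i. {x. 0 \<le> x $ i} \<inter> {x::real^'n. x $ i < 1})"
    by (auto simp: half_open_cube_def)
  also have "\<dots> \<in> sets borel"
  proof (intro sets.finite_INT)
    fix i :: 'n
    have [measurable]: "(\<lambda>x::real^'n. x $ i) \<in> borel_measurable borel"
      by (intro borel_measurable_continuous_onI continuous_intros)
    show "{x. 0 \<le> x $ i} \<inter> {x::real^'n. x $ i < 1} \<in> sets borel" by measurable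
  qed auto
  finally show ?thesis .
qed

lemma half_open_cube_subset: "box 0 1 \<subseteq> half_open_cube" "half_open_cube \<subseteq> cbox 0 1"
  by (auto simp: half_open_cube_def mem_box_cart less_imp_le)

text \<open>The integer translates of the half-open cube are disjoint, so it can be cut and
  reassembled exactly. It misses only boundary points of the cube in \<open>torus\<close>, and
  \<open>lborel\<close> is where translation invariance is available.\<close>

lemma integral_torus_lborel:
  fixes f :: "real^'n::finite \<Rightarrow> real"
  assumes f: "f \<in> borel_measurable borel"
  shows "(\<integral>x. f x \<partial>torus) = (\<integral>x. indicator half_open_cube x * f x \<partial>lborel)"
proof -
  note [measurable] = f
  have "(\<integral>x. f x \<partial>torus) = (\<integral>x. indicator (cbox 0 1) x *\<^sub>R f x \<partial>lebesgue)"
    unfolding torus_def by (rule integral_restrict_space) auto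
  also have "\<dots> = (\<integral>x. indicator (cbox 0 1) x *\<^sub>R f x \<partial>lborel)"
    by (rule integral_completion) measurable
  also have "\<dots> = (\<integral>x. indicator half_open_cube x * f x \<partial>lborel)"
  proof (rule integral_cong_AE)
    have "cbox 0 1 - box 0 (1::real^'n) \<in> null_sets lborel"
      using negligible_frontier_interval[of 0 "1::real^'n"]
      by (auto simp: negligible_iff_null_sets null_sets_completion_iff)
    then have "AE x in lborel. x \<notin> cbox 0 1 - box 0 (1::real^'n)" by (rule AE_not_in)
    then show "AE x in lborel. indicator (cbox 0 1) x *\<^sub>R f x = indicator half_open_cube x * f x"
    proof eventually_elim
      case (elim x)
      then show ?case using half_open_cube_subset by (auto simp: indicator_def)
    qed
  qed measurable
  finally show ?thesis .
qed

lemma lborel_translate: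
  fixes g :: "'a::euclidean_space \<Rightarrow> real"
  assumes "g \<in> borel_measurable borel"
  shows "(\<integral>x. g (x + c) \<partial>lborel) = (\<integral>x. g x \<partial>lborel)"
    and "integrable lborel (\<lambda>x. g (x + c)) \<longleftrightarrow> integrable lborel g"
proof -
  have d: "distr lborel borel ((+) c) = (lborel :: 'a measure)" by (rule lborel_distr_plus)
  have m: "(+) c \<in> lborel \<rightarrow>\<^sub>M borel" by simp
  show "(\<integral>x. g (x + c) \<partial>lborel) = (\<integral>x. g x \<partial>lborel)"
    using integral_distr[OF m assms] unfolding d by (simp add: add.commute)
  show "integrable lborel (\<lambda>x. g (x + c)) \<longleftrightarrow> integrable lborel g"
    using integrable_distr_eq[OF m assms] unfolding d by (simp add: add.commute)
qed

text \<open>Cut the cube at height \<open>s\<close> in direction \<open>i\<close>. The translated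
  cube consists of the upper slab \<open>A\<close> and of the lower slab \<open>B\<close> moved by
  one period, and periodicity of \<open>f\<close> moves \<open>B\<close> back.\<close>

lemma integral_torus_translate_axis:
  fixes f :: "real^'n::finite \<Rightarrow> real"
  assumes f: "continuous_on UNIV f" "periodic f" and s: "0 \<le> s" "s \<le> 1"
  shows "(\<integral>x. f (x + s *\<^sub>R axis i 1) \<partial>torus) = (\<integral>x. f x \<partial>torus)"
proof -
  let ?Q = "half_open_cube :: (real^'n) set" and ?e = "axis i 1 :: real^'n"
  have fm [measurable]: "f \<in> borel_measurable borel" using f by (intro borel_measurable_continuous_onI)
  have [measurable]: "(\<lambda>x::real^'n. x $ i) \<in> borel_measurable borel"
    by (intro borel_measurable_continuous_onI continuous_intros)
  define A where "A = {y \<in> ?Q. s \<le> y $ i}"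
  define B where "B = {y \<in> ?Q. y $ i < s}"
  have AB [measurable]: "A \<in> sets borel" "B \<in> sets borel"
    unfolding A_def B_def by measurable
  obtain b where b: "\<And>x. x \<in> cbox 0 1 \<Longrightarrow> norm (f x) \<le> b" using continuous_bounded_torus[OF f(1)] by metis
  have int: "integrable lborel (\<lambda>y. indicator S y * f y)" if [measurable]: "S \<in> sets borel" and S: "S \<subseteq> ?Q" for S
  proof (rule Bochner_Integration.integrable_bound)
    show "integrable lborel (\<lambda>y. b * indicator (cbox 0 (1::real^'n)) y)"
      by (intro integrable_mult_right integrable_real_indicator) (auto simp: emeasure_lborel_cbox_finite[unfolded infinity_ennreal_def])
    show "AE y in lborel. norm (indicator S y * f y) \<le> norm (b * indicator (cbox 0 1) y)"
      using b S half_open_cube_subset(2) by (intro always_eventually allI) (fastforce simp: indicator_def)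
  qed measurable
  have split: "indicator ?Q (y - s *\<^sub>R ?e) = indicator A y + (indicator B (y - ?e) :: real)" for y
  proof -
    have nth: "(y - r *\<^sub>R ?e) $ j = (if j = i then y $ j - r else y $ j)" for r j
      by (simp add: axis_def)
    have nth1: "(y - ?e) $ j = (if j = i then y $ j - 1 else y $ j)" for j
      by (simp add: axis_def)
    have "(y - s *\<^sub>R ?e \<in> ?Q) = (y \<in> A \<or> y - ?e \<in> B)" "\<not> (y \<in> A \<and> y - ?e \<in> B)"
    proof -
      have sp: "(\<forall>j. R j) = ((\<forall>j. j \<noteq> i \<longrightarrow> R j) \<and> R i)" for R :: "'n \<Rightarrow> bool" by metis
      let ?P = "\<forall>j. j \<noteq> i \<longrightarrow> 0 \<le> y $ j \<and> y $ j < 1"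
      have 1: "(y - s *\<^sub>R ?e \<in> ?Q) = (?P \<and> 0 \<le> y $ i - s \<and> y $ i - s < 1)"
        unfolding half_open_cube_def mem_Collect_eq nth by (subst sp) auto
      have 2: "(y \<in> A) = (?P \<and> 0 \<le> y $ i \<and> y $ i < 1 \<and> s \<le> y $ i)"
        unfolding A_def half_open_cube_def mem_Collect_eq by (subst sp) auto
      have 3: "(y - ?e \<in> B) = (?P \<and> 0 \<le> y $ i - 1 \<and> y $ i - 1 < 1 \<and> y $ i - 1 < s)"
        unfolding B_def half_open_cube_def mem_Collect_eq nth1 by (subst sp) auto
      show "(y - s *\<^sub>R ?e \<in> ?Q) = (y \<in> A \<or> y - ?e \<in> B)" "\<not> (y \<in> A \<and> y - ?e \<in> B)"
        unfolding 1 2 3 using s by auto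
    qed
    then show ?thesis by (auto simp: indicator_def)
  qed
  have per: "f (y + ?e) = f y" for y using f(2) by (simp add: periodic_def)
  let ?g = "\<lambda>y. indicator B (y - ?e) * f y"
  have g_shift: "(\<lambda>y. ?g (y + ?e)) = (\<lambda>y. indicator B y * f y)" by (simp add: per)
  have gm: "?g \<in> borel_measurable borel" by measurable
  have gi: "integrable lborel ?g" "(\<integral>y. ?g y \<partial>lborel) = (\<integral>y. indicator B y * f y \<partial>lborel)"
    using lborel_translate[OF gm, of ?e] int[of B] unfolding g_shift by (auto simp: B_def)
  have "(\<integral>x. f (x + s *\<^sub>R ?e) \<partial>torus) = (\<integral>x. indicator ?Q x * f (x + s *\<^sub>R ?e) \<partial>lborel)"
    by (rule integral_torus_lborel) measurable
  also have "\<dots> = (\<integral>x. indicator ?Q ((x + s *\<^sub>R ?e) - s *\<^sub>R ?e) * f (x + s *\<^sub>R ?e) \<partial>lborel)"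
    by simp
  also have "\<dots> = (\<integral>y. indicator ?Q (y - s *\<^sub>R ?e) * f y \<partial>lborel)"
    by (rule lborel_translate(1)[of "\<lambda>y. indicator ?Q (y - s *\<^sub>R ?e) * f y"]) measurable
  also have "\<dots> = (\<integral>y. indicator A y * f y + ?g y \<partial>lborel)"
    unfolding split by (simp add: distrib_right)
  also have "\<dots> = (\<integral>y. indicator A y * f y \<partial>lborel) + (\<integral>y. ?g y \<partial>lborel)"
    using gi int[of A] by (intro Bochner_Integration.integral_add) (auto simp: A_def)
  also have "\<dots> = (\<integral>y. indicator A y * f y + indicator B y * f y \<partial>lborel)"
    unfolding gi(2) using int[of B] int[of A] by (intro Bochner_Integration.integral_add[symmetric]) (auto simp: A_def B_def)
  also have "\<dots> = (\<integral>y. indicator ?Q y * f y \<partial>lborel)"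
    by (intro Bochner_Integration.integral_cong refl) (auto simp: A_def B_def indicator_def)
  also have "\<dots> = (\<integral>x. f x \<partial>torus)" by (rule integral_torus_lborel[symmetric]) measurable
  finally show ?thesis .
qed

lemma integral_torus_translate:
  fixes f :: "real^'n::finite \<Rightarrow> real"
  assumes f: "continuous_on UNIV f" "periodic f" and h: "h \<in> cbox 0 1"
  shows "(\<integral>x. f (x + h) \<partial>torus) = (\<integral>x. f x \<partial>torus)"
proof -
  \<comment> \<open>One coordinate is translated at a time. The induction is for all
    \<open>f\<close>, because each step replaces \<open>f\<close> by a translate of it.\<close>
  have *: "(\<integral>x. f (x + (\<Sum>i\<in>S. h $ i *\<^sub>R axis i 1)) \<partial>torus) = (\<integral>x. f x \<partial>torus)" if "finite S" for S
    using that f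
  proof (induction S arbitrary: f rule: finite_induct)
    case empty
    then show ?case by simp
  next
    case (insert i S)
    let ?f = "\<lambda>x. f (x + h $ i *\<^sub>R axis i 1)"
    have c: "continuous_on UNIV ?f"
      by (rule continuous_on_compose2[OF insert.prems(1)]) (auto intro!: continuous_intros)
    have p: "periodic ?f"
      unfolding periodic_def
    proof (intro allI)
      fix x j
      have "f (x + axis j 1 + h $ i *\<^sub>R axis i 1) = f ((x + h $ i *\<^sub>R axis i 1) + axis j 1)"
        by (simp add: algebra_simps)
      also have "\<dots> = f (x + h $ i *\<^sub>R axis i 1)" using insert.prems(2) unfolding periodic_def by blast
      finally show "f (x + axis j 1 + h $ i *\<^sub>R axis i 1) = f (x + h $ i *\<^sub>R axis i 1)" .
    qed
    have "(\<integral>x. f (x + (\<Sum>i\<in>insert i S. h $ i *\<^sub>R axis i 1)) \<partial>torus)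
        = (\<integral>x. ?f (x + (\<Sum>i\<in>S. h $ i *\<^sub>R axis i 1)) \<partial>torus)"
      using insert.hyps by (simp add: add_ac)
    also have "\<dots> = (\<integral>x. ?f x \<partial>torus)" by (rule insert.IH[OF c p])
    also have "\<dots> = (\<integral>x. f x \<partial>torus)"
      by (rule integral_torus_translate_axis[OF insert.prems]) (use h in \<open>auto simp: mem_box_cart\<close>)
    finally show ?case .
  qed
  have "(\<Sum>i\<in>UNIV. h $ i *\<^sub>R axis i 1) = h"
    using basis_expansion[of h] by (simp add: scalar_mult_eq_scaleR)
  with *[of UNIV] show ?thesis by simp
qed

text \<open>\<open>weak_gradient\<close> without periodicity of \<open>u\<close> and
  \<open>G\<close>: the relation then depends only on their values a.e. in the cube, as is
  appropriate for functions obtained as a.e. limits.\<close>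

definition torus_weak_gradient :: "(real^'n::finite \<Rightarrow> real) \<Rightarrow> (real^'n \<Rightarrow> real^'n) \<Rightarrow> bool" where
  "torus_weak_gradient u G \<longleftrightarrow> integrable torus u \<and> integrable torus G \<and>
     (\<forall>\<phi>. periodic \<phi> \<longrightarrow> smooth \<phi> \<longrightarrow>
        (\<integral>x. u x *\<^sub>R grad \<phi> x \<partial>torus) = - (\<integral>x. \<phi> x *\<^sub>R G x \<partial>torus))"

lemma torus_weak_gradientD:
  assumes "torus_weak_gradient u G"
  shows "integrable torus u" "integrable torus G"
    "periodic \<phi> \<Longrightarrow> smooth \<phi> \<Longrightarrow> (\<integral>x. u x *\<^sub>R grad \<phi> x \<partial>torus) = - (\<integral>x. \<phi> x *\<^sub>R G x \<partial>torus)"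
  using assms by (auto simp: torus_weak_gradient_def)

lemma integrable_scaleR_continuous:
  fixes g :: "real^'n::finite \<Rightarrow> 'b::euclidean_space" and \<phi> :: "real^'n \<Rightarrow> real"
  assumes g: "integrable torus g" and \<phi>: "continuous_on UNIV \<phi>"
  shows "integrable torus (\<lambda>x. \<phi> x *\<^sub>R g x)"
proof -
  obtain b where b: "b > 0" "\<And>x. x \<in> cbox 0 1 \<Longrightarrow> norm (\<phi> x) \<le> b" using continuous_bounded_torus[OF \<phi>] by metis
  note [measurable] = continuous_borel_measurable_torus[OF \<phi>] borel_measurable_integrable[OF g]
  show ?thesis
  proof (rule Bochner_Integration.integrable_bound[where f="\<lambda>x. b * norm (g x)"])
    show "AE x in torus. norm (\<phi> x *\<^sub>R g x) \<le> norm (b * norm (g x))"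
      using b by (intro AE_I2) (auto intro: mult_right_mono)
  qed (use g in auto)
qed

lemma integrable_scaleR_continuous':
  fixes g :: "real^'n::finite \<Rightarrow> 'b::euclidean_space" and u :: "real^'n \<Rightarrow> real"
  assumes u: "integrable torus u" and g: "continuous_on UNIV g"
  shows "integrable torus (\<lambda>x. u x *\<^sub>R g x)"
proof -
  obtain b where b: "b > 0" "\<And>x. x \<in> cbox 0 1 \<Longrightarrow> norm (g x) \<le> b" using continuous_bounded_torus[OF g] by metis
  note [measurable] = continuous_borel_measurable_torus[OF g] borel_measurable_integrable[OF u]
  show ?thesis
  proof (rule Bochner_Integration.integrable_bound[where f="\<lambda>x. b * norm (u x)"])
    show "AE x in torus. norm (u x *\<^sub>R g x) \<le> norm (b * norm (u x))"
      using b by (intro AE_I2) (auto simp: abs_mult mult.commute[of b] intro!: mult_left_mono)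
  qed (use u in auto)
qed

lemma torus_weak_gradient_cong:
  assumes w: "torus_weak_gradient u G" and u: "AE x in torus. u x = u' x" and G: "AE x in torus. G x = G' x"
  shows "torus_weak_gradient u' G'"
proof -
  note i = torus_weak_gradientD[OF w]
  have m: "u' \<in> borel_measurable torus" "G' \<in> borel_measurable torus"
    using borel_measurable_torus_AE[OF _ u] borel_measurable_torus_AE[OF _ G] i(1,2) by auto
  have i': "integrable torus u'" "integrable torus G'"
    using i(1,2) u G m integrable_cong_AE[of u torus u'] integrable_cong_AE[of G torus G'] by auto
  show ?thesis
    unfolding torus_weak_gradient_def
  proof (intro conjI i' allI impI)
    fix \<phi> :: "real^'a \<Rightarrow> real" assume \<phi>: "periodic \<phi>" "smooth \<phi>"
    note c = smooth_continuous[OF \<phi>(2)] smooth_grad_continuous[OF \<phi>(2)]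
    have "(\<integral>x. u' x *\<^sub>R grad \<phi> x \<partial>torus) = (\<integral>x. u x *\<^sub>R grad \<phi> x \<partial>torus)"
      using u integrable_scaleR_continuous'[OF i(1) c(2)] integrable_scaleR_continuous'[OF i'(1) c(2)]
      by (intro integral_cong_AE) (auto elim!: eventually_mono)
    moreover have "(\<integral>x. \<phi> x *\<^sub>R G' x \<partial>torus) = (\<integral>x. \<phi> x *\<^sub>R G x \<partial>torus)"
      using G integrable_scaleR_continuous[OF i(2) c(1)] integrable_scaleR_continuous[OF i'(2) c(1)]
      by (intro integral_cong_AE) (auto elim!: eventually_mono)
    ultimately show "(\<integral>x. u' x *\<^sub>R grad \<phi> x \<partial>torus) = - (\<integral>x. \<phi> x *\<^sub>R G' x \<partial>torus)"
      using i(3)[OF \<phi>] by simp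
  qed
qed

lemma torus_weak_gradient_lincomb:
  assumes "torus_weak_gradient u G" "torus_weak_gradient v F"
  shows "torus_weak_gradient (\<lambda>x. a * u x + b * v x) (\<lambda>x. a *\<^sub>R G x + b *\<^sub>R F x)"
proof -
  note i = torus_weak_gradientD[OF assms(1)] and j = torus_weak_gradientD[OF assms(2)]
  show ?thesis
    unfolding torus_weak_gradient_def
  proof (intro conjI allI impI)
    fix \<phi> :: "real^'a \<Rightarrow> real" assume \<phi>: "periodic \<phi>" "smooth \<phi>"
    note c = smooth_continuous[OF \<phi>(2)] smooth_grad_continuous[OF \<phi>(2)]
    note k = integrable_scaleR_continuous'[OF i(1) c(2)] integrable_scaleR_continuous'[OF j(1) c(2)]
      integrable_scaleR_continuous[OF i(2) c(1)] integrable_scaleR_continuous[OF j(2) c(1)]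
    have "(\<integral>x. (a * u x + b * v x) *\<^sub>R grad \<phi> x \<partial>torus)
        = (\<integral>x. a *\<^sub>R (u x *\<^sub>R grad \<phi> x) + b *\<^sub>R (v x *\<^sub>R grad \<phi> x) \<partial>torus)"
      by (simp add: scaleR_add_left)
    also have "\<dots> = a *\<^sub>R (\<integral>x. u x *\<^sub>R grad \<phi> x \<partial>torus) + b *\<^sub>R (\<integral>x. v x *\<^sub>R grad \<phi> x \<partial>torus)"
      using k by (simp del: scaleR_scaleR)
    also have "\<dots> = - (\<integral>x. a *\<^sub>R (\<phi> x *\<^sub>R G x) + b *\<^sub>R (\<phi> x *\<^sub>R F x) \<partial>torus)"
      using k i(3)[OF \<phi>] j(3)[OF \<phi>] by (simp del: scaleR_scaleR)
    also have "\<dots> = - (\<integral>x. \<phi> x *\<^sub>R (a *\<^sub>R G x + b *\<^sub>R F x) \<partial>torus)"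
      by (simp add: scaleR_add_right mult.commute)
    finally show "(\<integral>x. (a * u x + b * v x) *\<^sub>R grad \<phi> x \<partial>torus) = - (\<integral>x. \<phi> x *\<^sub>R (a *\<^sub>R G x + b *\<^sub>R F x) \<partial>torus)" .
  qed (use i j in auto)
qed

text \<open>Trigonometric polynomials converging a.e. to the sign of a component of
  \<open>G - G'\<close> turn the vanishing pairings into the integral of the absolute value of that
  component.\<close>

lemma torus_weak_gradient_unique:
  assumes "torus_weak_gradient u G" "torus_weak_gradient u G'"
  shows "AE x in torus. G x = G' x"
proof -
  define D where "D x = G x - G' x" for x
  have iD: "integrable torus D" unfolding D_def using assms by (auto dest: torus_weak_gradientD)
  have z: "(\<integral>x. \<phi> x *\<^sub>R D x \<partial>torus) = 0" if "trig \<phi>" for \<phi>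
  proof -
    note \<phi> = trig_periodic[OF that] trig_smooth[OF that] trig_continuous[OF that]
    have "(\<integral>x. \<phi> x *\<^sub>R D x \<partial>torus) = (\<integral>x. \<phi> x *\<^sub>R G x - \<phi> x *\<^sub>R G' x \<partial>torus)"
      by (simp add: D_def scaleR_diff_right)
    also have "\<dots> = (\<integral>x. \<phi> x *\<^sub>R G x \<partial>torus) - (\<integral>x. \<phi> x *\<^sub>R G' x \<partial>torus)"
      using integrable_scaleR_continuous[OF _ \<phi>(3)] assms
      by (intro Bochner_Integration.integral_diff) (auto dest: torus_weak_gradientD)
    also have "\<dots> = 0"
      using torus_weak_gradientD(3)[OF assms(1) \<phi>(1,2)] torus_weak_gradientD(3)[OF assms(2) \<phi>(1,2)] by simp
    finally show ?thesis .
  qed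
  have "AE x in torus. D x $ i = 0" for i
  proof -
    have iDi: "integrable torus (\<lambda>x. D x $ i)" by (rule integrable_bounded_linear[OF bounded_linear_vec_nth iD])
    note [measurable] = borel_measurable_integrable[OF iDi]
    have "(\<lambda>x. sgn (D x $ i)) \<in> borel_measurable torus" by measurable
    then obtain \<phi> where \<phi>: "\<And>k. trig (\<phi> k)" "\<And>k x. x \<in> cbox 0 1 \<Longrightarrow> \<bar>\<phi> k x\<bar> \<le> 1 + 1"
      "AE x in torus. (\<lambda>k. \<phi> k x) \<longlonglongrightarrow> sgn (D x $ i)"
      using trig_dense_ae[of "\<lambda>x. sgn (D x $ i)" 1] by (auto simp: abs_sgn_eq)
    have [measurable]: "\<phi> k \<in> borel_measurable torus" for k
      by (intro continuous_borel_measurable_torus trig_continuous \<phi>)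
    have "(\<lambda>k. \<integral>x. \<phi> k x * D x $ i \<partial>torus) \<longlonglongrightarrow> (\<integral>x. sgn (D x $ i) * D x $ i \<partial>torus)"
    proof (rule integral_dominated_convergence[where w="\<lambda>x. 2 * \<bar>D x $ i\<bar>"])
      show "AE x in torus. (\<lambda>k. \<phi> k x * D x $ i) \<longlonglongrightarrow> sgn (D x $ i) * D x $ i"
        using \<phi>(3) by eventually_elim (intro tendsto_intros)
      show "AE x in torus. norm (\<phi> k x * D x $ i) \<le> 2 * \<bar>D x $ i\<bar>" for k
        using \<phi>(2)[of _ k] by (intro AE_I2) (auto simp: abs_mult intro!: mult_right_mono)
    qed (use iDi in auto)
    moreover have "(\<integral>x. \<phi> k x * D x $ i \<partial>torus) = 0" for k
    proof -
      have "(\<integral>x. (\<phi> k x *\<^sub>R D x) $ i \<partial>torus) = (\<integral>x. \<phi> k x *\<^sub>R D x \<partial>torus) $ i"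
        by (rule integral_bounded_linear[OF bounded_linear_vec_nth integrable_scaleR_continuous[OF iD trig_continuous[OF \<phi>(1)]]])
      then show ?thesis using z[OF \<phi>(1)] by simp
    qed
    ultimately have "(\<integral>x. sgn (D x $ i) * D x $ i \<partial>torus) = 0" by (simp add: LIMSEQ_const_iff)
    then have "(\<integral>x. \<bar>D x $ i\<bar> \<partial>torus) = 0" by (simp add: abs_sgn mult.commute)
    then show ?thesis using iDi by (subst (asm) integral_nonneg_eq_0_iff_AE) auto
  qed
  then have "AE x in torus. \<forall>i. D x $ i = 0" by (simp add: AE_all_countable)
  then show ?thesis by eventually_elim (auto simp: D_def vec_eq_iff)
qed

lemma torus_weak_gradient_limit:
  fixes u :: "nat \<Rightarrow> real^'n::finite \<Rightarrow> real"
  assumes w: "\<And>k. torus_weak_gradient (u k) (G k)"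
    and i: "integrable torus v" "integrable torus F"
    and u: "(\<lambda>k. \<integral>x. norm (u k x - v x) \<partial>torus) \<longlonglongrightarrow> 0"
    and G: "(\<lambda>k. \<integral>x. norm (G k x - F x) \<partial>torus) \<longlonglongrightarrow> 0"
  shows "torus_weak_gradient v F"
  unfolding torus_weak_gradient_def
proof (intro conjI i allI impI)
  fix \<phi> :: "real^'n \<Rightarrow> real" assume \<phi>: "periodic \<phi>" "smooth \<phi>"
  note c = smooth_continuous[OF \<phi>(2)] smooth_grad_continuous[OF \<phi>(2)]
  note wd = torus_weak_gradientD[OF w]
  obtain b where b: "b > 0" "\<And>x. x \<in> cbox 0 1 \<Longrightarrow> norm (grad \<phi> x) \<le> b" using continuous_bounded_torus[OF c(2)] by metis
  obtain b' where b': "b' > 0" "\<And>x. x \<in> cbox 0 1 \<Longrightarrow> norm (\<phi> x) \<le> b'" using continuous_bounded_torus[OF c(1)] by metis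
  have 1: "(\<lambda>k. \<integral>x. u k x *\<^sub>R grad \<phi> x \<partial>torus) \<longlonglongrightarrow> (\<integral>x. v x *\<^sub>R grad \<phi> x \<partial>torus)"
  proof (rule Lim_transform)
    show "(\<lambda>k. \<integral>x. v x *\<^sub>R grad \<phi> x \<partial>torus) \<longlonglongrightarrow> (\<integral>x. v x *\<^sub>R grad \<phi> x \<partial>torus)" by simp
    have bl: "norm ((\<integral>x. u k x *\<^sub>R grad \<phi> x \<partial>torus) - (\<integral>x. v x *\<^sub>R grad \<phi> x \<partial>torus)) \<le> (\<integral>x. norm (u k x - v x) \<partial>torus) * b" for k
    proof -
      have "(\<integral>x. u k x *\<^sub>R grad \<phi> x \<partial>torus) - (\<integral>x. v x *\<^sub>R grad \<phi> x \<partial>torus) = (\<integral>x. (u k x - v x) *\<^sub>R grad \<phi> x \<partial>torus)"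
        unfolding scaleR_diff_left
        by (intro Bochner_Integration.integral_diff[symmetric] integrable_scaleR_continuous' i wd c)
      also have "norm \<dots> \<le> (\<integral>x. norm (u k x - v x) * b \<partial>torus)"
        using wd(1)[of k] i b
        by (intro Bochner_Integration.integral_norm_bound_integral integrable_scaleR_continuous' c)
           (auto simp: abs_minus_commute intro!: mult_left_mono)
      finally show ?thesis by simp
    qed
    show "(\<lambda>k. (\<integral>x. u k x *\<^sub>R grad \<phi> x \<partial>torus) - (\<integral>x. v x *\<^sub>R grad \<phi> x \<partial>torus)) \<longlonglongrightarrow> 0"
      by (rule Lim_null_comparison[OF always_eventually[OF allI[OF bl]]]) (rule tendsto_mult_left_zero[OF u])
  qed
  have 2: "(\<lambda>k. \<integral>x. \<phi> x *\<^sub>R G k x \<partial>torus) \<longlonglongrightarrow> (\<integral>x. \<phi> x *\<^sub>R F x \<partial>torus)"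
  proof (rule Lim_transform)
    show "(\<lambda>k. \<integral>x. \<phi> x *\<^sub>R F x \<partial>torus) \<longlonglongrightarrow> (\<integral>x. \<phi> x *\<^sub>R F x \<partial>torus)" by simp
    have bl: "norm ((\<integral>x. \<phi> x *\<^sub>R G k x \<partial>torus) - (\<integral>x. \<phi> x *\<^sub>R F x \<partial>torus)) \<le> (\<integral>x. norm (G k x - F x) \<partial>torus) * b'" for k
    proof -
      have "(\<integral>x. \<phi> x *\<^sub>R G k x \<partial>torus) - (\<integral>x. \<phi> x *\<^sub>R F x \<partial>torus) = (\<integral>x. \<phi> x *\<^sub>R (G k x - F x) \<partial>torus)"
        unfolding scaleR_diff_right
        by (intro Bochner_Integration.integral_diff[symmetric] integrable_scaleR_continuous i wd c)
      also have "norm \<dots> \<le> (\<integral>x. norm (G k x - F x) * b' \<partial>torus)"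
        using wd(2)[of k] i b'
        by (intro Bochner_Integration.integral_norm_bound_integral integrable_scaleR_continuous c)
           (auto simp: mult.commute[of _ b'] intro!: mult_right_mono)
      finally show ?thesis by simp
    qed
    show "(\<lambda>k. (\<integral>x. \<phi> x *\<^sub>R G k x \<partial>torus) - (\<integral>x. \<phi> x *\<^sub>R F x \<partial>torus)) \<longlonglongrightarrow> 0"
      by (rule Lim_null_comparison[OF always_eventually[OF allI[OF bl]]]) (rule tendsto_mult_left_zero[OF G])
  qed
  have "(\<lambda>k. \<integral>x. u k x *\<^sub>R grad \<phi> x \<partial>torus) \<longlonglongrightarrow> - (\<integral>x. \<phi> x *\<^sub>R F x \<partial>torus)"
    using tendsto_minus[OF 2] wd(3)[OF \<phi>] by simp
  with 1 show "(\<integral>x. v x *\<^sub>R grad \<phi> x \<partial>torus) = - (\<integral>x. \<phi> x *\<^sub>R F x \<partial>torus)" by (rule LIMSEQ_unique)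
qed

section \<open>Translations of test functions and the Poincare inequality\<close>

lemma trig_bounded: "trig f \<Longrightarrow> \<exists>B. \<forall>x. \<bar>f x\<bar> \<le> B"
proof (induction rule: trig.induct)
  case (add f g)
  then obtain B B' where "\<And>x. \<bar>f x\<bar> \<le> B" "\<And>x. \<bar>g x\<bar> \<le> B'" by auto
  then show ?case by (intro exI[of _ "B + B'"]) (auto intro: order_trans[OF abs_triangle_ineq add_mono])
next
  case (mult f g)
  then obtain B B' where B: "\<And>x. \<bar>f x\<bar> \<le> B" "\<And>x. \<bar>g x\<bar> \<le> B'" by auto
  have "\<bar>f x * g x\<bar> \<le> B * B'" for x
    unfolding abs_mult by (rule mult_mono) (use B order_trans[OF abs_ge_zero B(1)] in auto)
  then show ?case by blast
qed (auto intro: exI[of _ 1])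

lemma trig_grad_bounded:
  fixes f :: "real^'n::finite \<Rightarrow> real"
  assumes "trig f"
  obtains L where "L \<ge> 0" "\<And>x. norm (grad f x) \<le> L"
proof -
  have "\<forall>i. \<exists>B. \<forall>x. \<bar>grad f x $ i\<bar> \<le> B" using trig_bounded[OF trig_grad[OF assms]] by blast
  then obtain B where B: "\<And>i x. \<bar>grad f x $ i\<bar> \<le> B i" by metis
  have "norm (grad f x) \<le> (\<Sum>i\<in>UNIV. B i)" for x
    using norm_le_l1_cart[of "grad f x"] sum_mono[of UNIV "\<lambda>i. \<bar>grad f x $ i\<bar>" B] B by fastforce
  moreover then have "(\<Sum>i\<in>UNIV. B i) \<ge> 0" using order_trans[OF norm_ge_zero] by blast
  ultimately show ?thesis using that by blast
qed

lemma trig_translate: "trig f \<Longrightarrow> trig (\<lambda>x. f (x + h))"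
proof (induction rule: trig.induct)
  case (cos i)
  have "trig (\<lambda>x. cos (2 * pi * x $ i) * cos (2 * pi * h $ i) + (- sin (2 * pi * h $ i)) * sin (2 * pi * x $ i))"
    by (intro trig.intros)
  then show ?case by (simp add: distrib_left cos_add mult.commute)
next
  case (sin i)
  have "trig (\<lambda>x. sin (2 * pi * x $ i) * cos (2 * pi * h $ i) + cos (2 * pi * x $ i) * sin (2 * pi * h $ i))"
    by (intro trig.intros)
  then show ?case by (simp add: distrib_left sin_add)
qed (auto intro: trig.intros)

lemma grad_translate:
  fixes f :: "'a::euclidean_space \<Rightarrow> real"
  assumes "f differentiable (at (x + h))"
  shows "grad (\<lambda>x. f (x + h)) x = grad f (x + h)"
proof (rule grad_eqI)
  have "(f has_derivative (\<lambda>k. k \<bullet> grad f (x + h))) (at (x + h))"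
    using GDERIV_grad[OF assms] by (simp only: gderiv_def)
  moreover have "((\<lambda>x. x + h) has_derivative (\<lambda>k. k)) (at x)"
    by (auto intro!: derivative_eq_intros)
  ultimately show "GDERIV (\<lambda>x. f (x + h)) x :> grad f (x + h)"
    using has_derivative_compose[of "\<lambda>x. x + h" "\<lambda>k. k" x UNIV f] unfolding gderiv_def by blast
qed

lemma trig_line_DERIV:
  fixes \<phi> :: "real^'n::finite \<Rightarrow> real"
  assumes "trig \<phi>"
  shows "((\<lambda>t. \<phi> (x + t *\<^sub>R h)) has_real_derivative grad \<phi> (x + t *\<^sub>R h) \<bullet> h) (at t)"
proof -
  have "(\<phi> has_derivative (\<lambda>k. k \<bullet> grad \<phi> (x + t *\<^sub>R h))) (at (x + t *\<^sub>R h))"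
    using GDERIV_grad[OF trig_differentiable[OF assms]] by (simp only: gderiv_def)
  moreover have "((\<lambda>t. x + t *\<^sub>R h) has_derivative (\<lambda>s. s *\<^sub>R h)) (at t)"
    by (auto intro!: derivative_eq_intros)
  ultimately have "((\<lambda>t. \<phi> (x + t *\<^sub>R h)) has_derivative (\<lambda>s. (s *\<^sub>R h) \<bullet> grad \<phi> (x + t *\<^sub>R h))) (at t)"
    using has_derivative_compose[of "\<lambda>t. x + t *\<^sub>R h" "\<lambda>s. s *\<^sub>R h" t UNIV \<phi>] by blast
  then show ?thesis
    unfolding has_field_derivative_def by (simp add: inner_commute mult.commute[of _ "inner _ _"])
qed

text \<open>The translation acts on the trigonometric factor because \<open>u\<close> is merely
  integrable; the bound on the gradient of \<open>\<phi>\<close> dominates the difference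
  quotients.\<close>

lemma integral_translate_DERIV:
  fixes u :: "real^'n::finite \<Rightarrow> real"
  assumes u: "integrable torus u" and \<phi>: "trig \<phi>"
  shows "((\<lambda>t. \<integral>x. u x * \<phi> (x + t *\<^sub>R h) \<partial>torus) has_real_derivative
          (\<integral>x. u x * (grad \<phi> (x + t *\<^sub>R h) \<bullet> h) \<partial>torus)) (at t)"
proof -
  obtain L where L: "L \<ge> 0" "\<And>x. norm (grad \<phi> x) \<le> L" using trig_grad_bounded[OF \<phi>] by metis
  have tr: "trig (\<lambda>x. \<phi> (x + k))" for k by (rule trig_translate[OF \<phi>])
  have int: "integrable torus (\<lambda>x. u x * \<phi> (x + k))" for k
    using integrable_scaleR_continuous'[OF u trig_continuous[OF tr]] by simp
  have lip: "\<bar>\<phi> (x + (t + s) *\<^sub>R h) - \<phi> (x + t *\<^sub>R h)\<bar> \<le> \<bar>s\<bar> * (L * norm h)" for x s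
  proof -
    have "norm ((\<lambda>t. \<phi> (x + t *\<^sub>R h)) (t + s) - (\<lambda>t. \<phi> (x + t *\<^sub>R h)) t) \<le> (L * norm h) * norm ((t + s) - t)"
    proof (rule field_differentiable_bound[of UNIV])
      show "norm (grad \<phi> (x + t *\<^sub>R h) \<bullet> h) \<le> L * norm h" for t
        using Cauchy_Schwarz_ineq2[of "grad \<phi> (x + t *\<^sub>R h)" h] mult_right_mono[OF L(2)[of "x + t *\<^sub>R h"] norm_ge_zero[of h]]
          by simp
    qed (auto intro: trig_line_DERIV[OF \<phi>])
    then show ?thesis by (simp add: mult.commute)
  qed
  show ?thesis
    unfolding DERIV_def tendsto_at_iff_sequentially
  proof (intro allI impI)
    fix X :: "nat \<Rightarrow> real" assume X: "\<forall>i. X i \<in> UNIV - {0}" "X \<longlonglongrightarrow> 0"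
    let ?d = "\<lambda>k x. (\<phi> (x + (t + X k) *\<^sub>R h) - \<phi> (x + t *\<^sub>R h)) / X k"
    have "(\<lambda>k. \<integral>x. u x * ?d k x \<partial>torus) \<longlonglongrightarrow> (\<integral>x. u x * (grad \<phi> (x + t *\<^sub>R h) \<bullet> h) \<partial>torus)"
    proof (rule integral_dominated_convergence[where w="\<lambda>x. \<bar>u x\<bar> * (L * norm h)"])
      have [measurable]: "(\<lambda>x. \<phi> (x + k)) \<in> borel_measurable torus" for k
        by (intro continuous_borel_measurable_torus trig_continuous tr)
      have [measurable]: "u \<in> borel_measurable torus" using u by auto
      show "(\<lambda>x. u x * ?d k x) \<in> borel_measurable torus" for k by measurable
      have "continuous_on UNIV (\<lambda>x. grad \<phi> (x + t *\<^sub>R h) \<bullet> h)"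
        using smooth_grad_continuous[OF trig_smooth[OF tr[of "t *\<^sub>R h"]]] grad_translate[OF trig_differentiable[OF \<phi>]]
        by (intro continuous_intros) (simp add: ext)
      then have [measurable]: "(\<lambda>x. grad \<phi> (x + t *\<^sub>R h) \<bullet> h) \<in> borel_measurable torus"
        by (rule continuous_borel_measurable_torus)
      show "(\<lambda>x. u x * (grad \<phi> (x + t *\<^sub>R h) \<bullet> h)) \<in> borel_measurable torus" by measurable
      show "integrable torus (\<lambda>x. \<bar>u x\<bar> * (L * norm h))" using u by auto
      have "(\<lambda>k. ?d k x) \<longlonglongrightarrow> grad \<phi> (x + t *\<^sub>R h) \<bullet> h" for x
        using trig_line_DERIV[OF \<phi>, of x h t] X
        unfolding DERIV_def tendsto_at_iff_sequentially by (auto simp: o_def)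
      then show "AE x in torus. (\<lambda>k. u x * ?d k x) \<longlonglongrightarrow> u x * (grad \<phi> (x + t *\<^sub>R h) \<bullet> h)"
        by (intro AE_I2 tendsto_intros)
      have "\<bar>?d k x\<bar> \<le> L * norm h" for k x
        using lip[of x "X k"] X(1) by (simp add: abs_divide divide_le_eq mult.commute)
      then show "AE x in torus. norm (u x * ?d k x) \<le> \<bar>u x\<bar> * (L * norm h)" for k
        unfolding real_norm_def abs_mult by (intro AE_I2 mult_left_mono) auto
    qed
    moreover have "(\<integral>x. u x * ?d k x \<partial>torus)
       = ((\<integral>x. u x * \<phi> (x + (t + X k) *\<^sub>R h) \<partial>torus) - (\<integral>x. u x * \<phi> (x + t *\<^sub>R h) \<partial>torus)) / X k" for k
    proof -
      have "(\<integral>x. u x * ?d k x \<partial>torus)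
          = (\<integral>x. (u x * \<phi> (x + (t + X k) *\<^sub>R h) - u x * \<phi> (x + t *\<^sub>R h)) / X k \<partial>torus)"
        by (intro Bochner_Integration.integral_cong refl) (simp add: right_diff_distrib)
      then show ?thesis using int by simp
    qed
    ultimately show "((\<lambda>s. ((\<integral>x. u x * \<phi> (x + (t + s) *\<^sub>R h) \<partial>torus) - (\<integral>x. u x * \<phi> (x + t *\<^sub>R h) \<partial>torus)) / s) \<circ> X)
       \<longlonglongrightarrow> (\<integral>x. u x * (grad \<phi> (x + t *\<^sub>R h) \<bullet> h) \<partial>torus)"
      by (simp only: o_def)
  qed
qed

text \<open>A mean value formula for \<open>u\<close> in dual form. The derivative in the
  translation parameter pairs \<open>u\<close> with a gradient, which the weak gradient relation
  transfers to \<open>G\<close>; a single intermediate \<open>t\<close> takes the place of an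
  integral over the segment.\<close>

lemma weak_gradient_translate:
  fixes u :: "real^'n::finite \<Rightarrow> real"
  assumes w: "torus_weak_gradient u G" and \<phi>: "trig \<phi>"
  shows "\<exists>t. 0 < t \<and> t < 1 \<and>
    (\<integral>x. u x * \<phi> (x + h) \<partial>torus) - (\<integral>x. u x * \<phi> x \<partial>torus) = - (\<integral>x. \<phi> (x + t *\<^sub>R h) * (G x \<bullet> h) \<partial>torus)"
proof -
  note wd = torus_weak_gradientD[OF w]
  let ?\<Psi> = "\<lambda>t. \<integral>x. u x * \<phi> (x + t *\<^sub>R h) \<partial>torus"
  obtain t where t: "0 < t" "t < 1" "?\<Psi> 1 - ?\<Psi> 0 = (1 - 0) * (\<integral>x. u x * (grad \<phi> (x + t *\<^sub>R h) \<bullet> h) \<partial>torus)"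
    using MVT2[of 0 1 ?\<Psi> "\<lambda>t. \<integral>x. u x * (grad \<phi> (x + t *\<^sub>R h) \<bullet> h) \<partial>torus"]
      integral_translate_DERIV[OF wd(1) \<phi>] by auto
  let ?\<phi> = "\<lambda>x. \<phi> (x + t *\<^sub>R h)"
  have tr: "trig ?\<phi>" by (rule trig_translate[OF \<phi>])
  have g: "grad ?\<phi> x = grad \<phi> (x + t *\<^sub>R h)" for x by (rule grad_translate[OF trig_differentiable[OF \<phi>]])
  have "(\<integral>x. u x * (grad \<phi> (x + t *\<^sub>R h) \<bullet> h) \<partial>torus) = (\<integral>x. (u x *\<^sub>R grad ?\<phi> x) \<bullet> h \<partial>torus)"
    by (simp add: g)
  also have "\<dots> = (\<integral>x. u x *\<^sub>R grad ?\<phi> x \<partial>torus) \<bullet> h"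
    by (rule integral_inner_left) (rule integrable_scaleR_continuous'[OF wd(1) smooth_grad_continuous[OF trig_smooth[OF tr]]])
  also have "\<dots> = - ((\<integral>x. ?\<phi> x *\<^sub>R G x \<partial>torus) \<bullet> h)"
    using wd(3)[OF trig_periodic[OF tr] trig_smooth[OF tr]] by simp
  also have "(\<integral>x. ?\<phi> x *\<^sub>R G x \<partial>torus) \<bullet> h = (\<integral>x. (?\<phi> x *\<^sub>R G x) \<bullet> h \<partial>torus)"
    by (rule integral_inner_left[symmetric]) (rule integrable_scaleR_continuous[OF wd(2) trig_continuous[OF tr]])
  finally have "(\<integral>x. u x * (grad \<phi> (x + t *\<^sub>R h) \<bullet> h) \<partial>torus) = - (\<integral>x. \<phi> (x + t *\<^sub>R h) * (G x \<bullet> h) \<partial>torus)"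
    by simp
  then show ?thesis using t by (intro exI[of _ t]) auto
qed

lemma cbox_norm_le: "h \<in> cbox 0 1 \<Longrightarrow> norm h \<le> real CARD('n)" for h :: "real^'n::finite"
proof -
  assume "h \<in> cbox 0 1"
  then have "(\<Sum>i\<in>UNIV. \<bar>h $ i\<bar>) \<le> (\<Sum>i\<in>(UNIV::'n set). 1)"
    by (intro sum_mono) (auto simp: mem_box_cart)
  then show ?thesis using norm_le_l1_cart[of h] by simp
qed

lemma sigma_finite_torus: "sigma_finite_measure torus"
  by (rule finite_measure.axioms(1)[OF finite_measure_torus])

text \<open>Exchange the integrals: for fixed \<open>x\<close>, averaging
  \<open>\<phi> (x + h)\<close> over \<open>h\<close> gives the mean of \<open>\<phi>\<close> by
  translation invariance.\<close>

lemma integral_torus_average: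
  fixes u :: "real^'n::finite \<Rightarrow> real"
  assumes u: "integrable torus u" and \<phi>: "continuous_on UNIV \<phi>" "periodic \<phi>" and b: "\<And>x. \<bar>\<phi> x\<bar> \<le> b"
  shows "(\<integral>h. (\<integral>x. u x * \<phi> (x + h) \<partial>torus) \<partial>torus) = (\<integral>x. u x \<partial>torus) * (\<integral>x. \<phi> x \<partial>torus)"
    and "integrable torus (\<lambda>h. \<integral>x. u x * \<phi> (x + h) \<partial>torus)"
proof -
  let ?T = "torus :: (real^'n) measure"
  interpret finite_measure ?T by (rule finite_measure_torus)
  interpret pair_sigma_finite ?T ?T
    using sigma_finite_torus by (simp add: pair_sigma_finite_def)
  have b0: "b \<ge> 0" using b[of 0] by linarith
  have [measurable]: "u \<in> borel_measurable ?T" using u by auto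
  have [measurable]: "\<phi> \<in> borel_measurable borel" using \<phi> by (intro borel_measurable_continuous_onI)
  have id [measurable]: "(\<lambda>x. x) \<in> ?T \<rightarrow>\<^sub>M borel" by (rule continuous_borel_measurable_torus) auto
  have [measurable]: "fst \<in> ?T \<Otimes>\<^sub>M ?T \<rightarrow>\<^sub>M borel" "snd \<in> ?T \<Otimes>\<^sub>M ?T \<rightarrow>\<^sub>M borel"
    using measurable_compose[OF measurable_fst id] measurable_compose[OF measurable_snd id] by (simp_all add: o_def)
  have int: "integrable (?T \<Otimes>\<^sub>M ?T) (\<lambda>(x, h). u x * \<phi> (x + h))"
  proof (rule Bochner_Integration.integrable_bound)
    have "integrable (?T \<Otimes>\<^sub>M ?T) (\<lambda>(x, h). u x)"
    proof (rule Fubini_integrable)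
      show "integrable ?T (\<lambda>x. \<integral>y. norm (case (x, y) of (x, h) \<Rightarrow> u x) \<partial>?T)"
        using u by simp
    qed (auto simp: split_beta')
    then show "integrable (?T \<Otimes>\<^sub>M ?T) (\<lambda>z. b * norm (case z of (x, h) \<Rightarrow> u x))" by auto
    show "AE z in ?T \<Otimes>\<^sub>M ?T. norm (case z of (x, h) \<Rightarrow> u x * \<phi> (x + h)) \<le> norm (b * norm (case z of (x, h) \<Rightarrow> u x))"
      using b b0 by (intro AE_I2) (auto simp: abs_mult mult.commute[of b] intro!: mult_left_mono)
  qed (simp add: split_beta')
  show "integrable torus (\<lambda>h. \<integral>x. u x * \<phi> (x + h) \<partial>torus)"
    using integrable_snd[OF int] by simp
  have "(\<integral>h. (\<integral>x. u x * \<phi> (x + h) \<partial>?T) \<partial>?T) = (\<integral>x. (\<integral>h. u x * \<phi> (x + h) \<partial>?T) \<partial>?T)"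
    using Fubini_integral[OF int] by simp
  also have "\<dots> = (\<integral>x. u x * (\<integral>h. \<phi> h \<partial>?T) \<partial>?T)"
  proof (intro Bochner_Integration.integral_cong refl)
    fix x :: "real^'n" assume "x \<in> space ?T"
    then have "(\<integral>h. \<phi> (h + x) \<partial>?T) = (\<integral>h. \<phi> h \<partial>?T)"
      by (intro integral_torus_translate \<phi>) simp
    then show "(\<integral>h. u x * \<phi> (x + h) \<partial>?T) = u x * (\<integral>h. \<phi> h \<partial>?T)" by (simp add: add.commute)
  qed
  finally show "(\<integral>h. (\<integral>x. u x * \<phi> (x + h) \<partial>torus) \<partial>torus) = (\<integral>x. u x \<partial>torus) * (\<integral>x. \<phi> x \<partial>torus)"
    by simp
qed

text \<open>The Poincare inequality by duality: test functions are moved by translations, which keeps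
  their norms, and \<open>weak_gradient_translate\<close> controls the effect on \<open>u\<close>; averaging over all
  translations produces the mean of \<open>u\<close>.\<close>

lemma torus_Poincare:
  fixes r :: real
  assumes r: "r > 1"
  shows "\<exists>C\<ge>0. \<forall>(u :: real^'n::finite \<Rightarrow> real) G B. torus_weak_gradient u G \<longrightarrow> (AE x in torus. \<bar>u x\<bar> \<le> B) \<longrightarrow>
     integrable torus (\<lambda>x. norm (G x) powr r) \<longrightarrow>
     (\<integral>x. \<bar>u x - (\<integral>y. u y \<partial>torus)\<bar> powr r \<partial>torus) \<le> C * (\<integral>x. norm (G x) powr r \<partial>torus)"
proof -
  define s where "s = r / (r - 1)"
  have s: "s > 1" "s / (s - 1) = r" "s * (r - 1) = r" using r by (auto simp: s_def field_simps)
  \<comment> \<open>The weight 1/2 allows the power of the test function to be absorbed at the end,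
    whence the factor 2 in \<open>C\<close>. \<open>N\<close> bounds the length of every translation
    vector from the cube.\<close>
  obtain K where K: "K \<ge> 0" "\<And>a b. a \<ge> 0 \<Longrightarrow> b \<ge> 0 \<Longrightarrow> a * b \<le> (1/2) * a powr s + K * b powr r"
    using Young_eps[OF s(1), of "1/2"] s(2) by auto
  define N where "N = real CARD('n)"
  define C where "C = 2 * (K * N powr r)"
  show ?thesis
  proof (intro exI[of _ C] conjI allI impI)
    show "C \<ge> 0" using K by (simp add: C_def)
    fix u :: "real^'n \<Rightarrow> real" and G B
    assume w: "torus_weak_gradient u G" and B: "AE x in torus. \<bar>u x\<bar> \<le> B"
      and Gr: "integrable torus (\<lambda>x. norm (G x) powr r)"
    note wd = torus_weak_gradientD[OF w]
    let ?T = "torus :: (real^'n) measure"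
    interpret finite_measure ?T by (rule finite_measure_torus)
    note [measurable] = borel_measurable_integrable[OF wd(1)] borel_measurable_integrable[OF wd(2)]
    define E where "E = (\<integral>x. norm (G x) powr r \<partial>?T)"
    define m where "m = (\<integral>y. u y \<partial>?T)"
    have bound: "m * (\<integral>x. \<phi> x \<partial>?T) - (\<integral>x. u x * \<phi> x \<partial>?T) \<le> (1/2) * (\<integral>x. \<bar>\<phi> x\<bar> powr s \<partial>?T) + K * N powr r * E"
      (is "_ \<le> ?R") if \<phi>: "trig \<phi>" for \<phi>
    proof -
      obtain b where b: "\<And>x. \<bar>\<phi> x\<bar> \<le> b" using trig_bounded[OF \<phi>] by blast
      have pow_cont: "continuous_on UNIV (\<lambda>x. \<bar>f x\<bar> powr s)" if "continuous_on UNIV f" for f :: "real^'n \<Rightarrow> real"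
        using that s by (intro continuous_on_powr' continuous_intros) auto
      have *: "(\<integral>x. u x * \<phi> (x + h) \<partial>?T) - (\<integral>x. u x * \<phi> x \<partial>?T) \<le> ?R" if h: "h \<in> cbox 0 1" for h
      proof -
        obtain t where t: "0 < t" "t < 1"
          "(\<integral>x. u x * \<phi> (x + h) \<partial>?T) - (\<integral>x. u x * \<phi> x \<partial>?T) = - (\<integral>x. \<phi> (x + t *\<^sub>R h) * (G x \<bullet> h) \<partial>?T)"
          using weak_gradient_translate[OF w \<phi>] by blast
        have th: "t *\<^sub>R h \<in> cbox 0 1" using h t by (auto simp: mem_box_cart mult_le_one)
        have tr: "trig (\<lambda>x. \<phi> (x + t *\<^sub>R h))" by (rule trig_translate[OF \<phi>])
        have pc: "continuous_on UNIV (\<lambda>x. \<bar>\<phi> (x + t *\<^sub>R h)\<bar> powr s)" by (rule pow_cont[OF trig_continuous[OF tr]])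
        have pi: "integrable ?T (\<lambda>x. \<bar>\<phi> (x + t *\<^sub>R h)\<bar> powr s)"
          using integrable_scaleR_continuous[of "\<lambda>_. 1::real", OF _ pc] by simp
        have "- (\<integral>x. \<phi> (x + t *\<^sub>R h) * (G x \<bullet> h) \<partial>?T) = (\<integral>x. - (\<phi> (x + t *\<^sub>R h) * (G x \<bullet> h)) \<partial>?T)" by simp
        also have "\<dots> \<le> (\<integral>x. (1/2) * \<bar>\<phi> (x + t *\<^sub>R h)\<bar> powr s + K * N powr r * norm (G x) powr r \<partial>?T)"
        proof (rule integral_mono)
          have "integrable ?T (\<lambda>x. (\<phi> (x + t *\<^sub>R h) *\<^sub>R G x) \<bullet> h)"
            by (intro integrable_inner_left integrable_scaleR_continuous wd trig_continuous tr)
          then show "integrable ?T (\<lambda>x. - (\<phi> (x + t *\<^sub>R h) * (G x \<bullet> h)))" by simp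
          show "integrable ?T (\<lambda>x. (1/2) * \<bar>\<phi> (x + t *\<^sub>R h)\<bar> powr s + K * N powr r * norm (G x) powr r)"
            using pi Gr by auto
          fix x
          have "\<bar>G x \<bullet> h\<bar> \<le> N * norm (G x)"
            using Cauchy_Schwarz_ineq2[of "G x" h] mult_left_mono[OF cbox_norm_le[OF h], of "norm (G x)"]
            by (simp add: N_def mult.commute)
          then have "\<bar>\<phi> (x + t *\<^sub>R h)\<bar> * \<bar>G x \<bullet> h\<bar> \<le> \<bar>\<phi> (x + t *\<^sub>R h)\<bar> * (N * norm (G x))"
            by (intro mult_left_mono) auto
          also have "\<dots> \<le> (1/2) * \<bar>\<phi> (x + t *\<^sub>R h)\<bar> powr s + K * (N * norm (G x)) powr r"
            by (rule K(2)) (auto simp: N_def)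
          also have "(N * norm (G x)) powr r = N powr r * norm (G x) powr r"
            by (simp add: powr_mult N_def)
          finally show "- (\<phi> (x + t *\<^sub>R h) * (G x \<bullet> h)) \<le> (1/2) * \<bar>\<phi> (x + t *\<^sub>R h)\<bar> powr s + K * N powr r * norm (G x) powr r"
            unfolding abs_mult[symmetric] by (simp add: mult.assoc)
        qed
        also have "\<dots> = (1/2) * (\<integral>x. \<bar>\<phi> (x + t *\<^sub>R h)\<bar> powr s \<partial>?T) + K * N powr r * E"
          unfolding E_def using pi Gr by simp
        also have "(\<integral>x. \<bar>\<phi> (x + t *\<^sub>R h)\<bar> powr s \<partial>?T) = (\<integral>x. \<bar>\<phi> x\<bar> powr s \<partial>?T)"
          using trig_periodic[OF \<phi>]
          by (intro integral_torus_translate[of "\<lambda>x. \<bar>\<phi> x\<bar> powr s"] pow_cont trig_continuous \<phi> th) (auto simp: periodic_def)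
        finally show ?thesis using t(3) by linarith
      qed
      \<comment> \<open>The right side of the estimate does not depend on \<open>h\<close>, so
        averaging over the cube leaves it unchanged and turns the translated integral into
        \<open>m\<close> times the mean of \<open>\<phi>\<close>.\<close>
      note av = integral_torus_average[OF wd(1) trig_continuous[OF \<phi>] trig_periodic[OF \<phi>] b]
      have "(\<integral>h. (\<integral>x. u x * \<phi> (x + h) \<partial>?T) - (\<integral>x. u x * \<phi> x \<partial>?T) \<partial>?T) \<le> (\<integral>h. ?R \<partial>?T)"
        by (rule integral_mono) (use av(2) * in auto)
      then show ?thesis using av by (simp add: m_def)
    qed
    define W where "W = B + \<bar>m\<bar>"
    \<comment> \<open>\<open>v\<close> agrees a.e. with \<open>m - u\<close>; the clipping bounds it
      everywhere, which provides the pointwise bound required by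
      \<open>trig_dense_ae\<close>.\<close>
    define v where "v x = max (- W) (min W (m - u x))" for x
    have B0: "B \<ge> 0"
    proof (rule ccontr)
      assume "\<not> B \<ge> 0"
      then have "AE x in ?T. False" using B by (auto elim!: eventually_mono)
      then show False using AE_iff_measurable[of "cbox 0 1" ?T "\<lambda>x. False"] sets.top[of ?T] by simp
    qed
    then have W0: "W \<ge> 0" by (simp add: W_def)
    have vb: "\<bar>v x\<bar> \<le> W" for x using W0 by (auto simp: v_def)
    have v: "AE x in ?T. v x = m - u x"
      using B by eventually_elim (auto simp: v_def W_def)
    have [measurable]: "v \<in> borel_measurable ?T" unfolding v_def by measurable
    \<comment> \<open>The norming function of duality: \<open>v x * g x\<close> and
      \<open>\<bar>g x\<bar> powr s\<close> both equal \<open>\<bar>v x\<bar> powr r\<close>, so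
      that in the limit both sides contain the same integral \<open>I\<close>.\<close>
    define g where "g x = sgn (v x) * \<bar>v x\<bar> powr (r - 1)" for x
    have [measurable]: "g \<in> borel_measurable ?T" unfolding g_def by measurable
    have gb: "\<bar>g x\<bar> \<le> W powr (r - 1)" for x
      using vb[of x] r by (auto simp: g_def abs_mult sgn_if intro!: powr_mono2)
    obtain \<phi> where \<phi>: "\<And>k. trig (\<phi> k)" "\<And>k x. x \<in> cbox 0 1 \<Longrightarrow> \<bar>\<phi> k x\<bar> \<le> W powr (r - 1) + 1"
      "AE x in ?T. (\<lambda>k. \<phi> k x) \<longlonglongrightarrow> g x"
      using trig_dense_ae[of g "W powr (r - 1)"] gb by auto
    have [measurable]: "\<phi> k \<in> borel_measurable ?T" for k
      by (intro continuous_borel_measurable_torus trig_continuous \<phi>)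
    have vr: "v x * g x = \<bar>v x\<bar> powr r" for x
    proof (cases "v x = 0")
      case False
      have vs: "v x * sgn (v x) = \<bar>v x\<bar>" by (auto simp: sgn_if)
      have "v x * g x = (v x * sgn (v x)) * \<bar>v x\<bar> powr (r - 1)" by (simp only: g_def mult.assoc)
      then have "v x * g x = \<bar>v x\<bar> powr 1 * \<bar>v x\<bar> powr (r - 1)" unfolding vs by simp
      then show ?thesis by (simp only: powr_add[symmetric]) simp
    qed auto
    have gs: "\<bar>g x\<bar> powr s = \<bar>v x\<bar> powr r" for x
      using s by (auto simp: g_def abs_mult sgn_if powr_powr mult.commute)
    define I where "I = (\<integral>x. \<bar>v x\<bar> powr r \<partial>?T)"
    have 1: "(\<lambda>k. \<integral>x. v x * \<phi> k x \<partial>?T) \<longlonglongrightarrow> I"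
    proof -
      have "(\<lambda>k. \<integral>x. v x * \<phi> k x \<partial>?T) \<longlonglongrightarrow> (\<integral>x. v x * g x \<partial>?T)"
      proof (rule integral_dominated_convergence[where w="\<lambda>x. W * (W powr (r - 1) + 1)"])
        show "AE x in ?T. (\<lambda>k. v x * \<phi> k x) \<longlonglongrightarrow> v x * g x"
          using \<phi>(3) by eventually_elim (intro tendsto_intros)
        show "AE x in ?T. norm (v x * \<phi> k x) \<le> W * (W powr (r - 1) + 1)" for k
          using \<phi>(2)[of _ k] vb W0 by (intro AE_I2) (auto simp: abs_mult intro!: mult_mono)
      qed auto
      then show ?thesis by (simp add: vr I_def)
    qed
    have 2: "(\<lambda>k. \<integral>x. \<bar>\<phi> k x\<bar> powr s \<partial>?T) \<longlonglongrightarrow> I"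
    proof -
      have "(\<lambda>k. \<integral>x. \<bar>\<phi> k x\<bar> powr s \<partial>?T) \<longlonglongrightarrow> (\<integral>x. \<bar>g x\<bar> powr s \<partial>?T)"
      proof (rule integral_dominated_convergence[where w="\<lambda>x. (W powr (r - 1) + 1) powr s"])
        show "AE x in ?T. (\<lambda>k. \<bar>\<phi> k x\<bar> powr s) \<longlonglongrightarrow> \<bar>g x\<bar> powr s"
          using \<phi>(3) by eventually_elim (use s in \<open>auto intro!: tendsto_powr' tendsto_rabs\<close>)
        show "AE x in ?T. norm (\<bar>\<phi> k x\<bar> powr s) \<le> (W powr (r - 1) + 1) powr s" for k
          using \<phi>(2)[of _ k] s by (intro AE_I2) (auto intro!: powr_mono2)
      qed auto
      then show ?thesis by (simp add: gs I_def)
    qed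
    have "(\<integral>x. v x * \<phi> k x \<partial>?T) \<le> (1/2) * (\<integral>x. \<bar>\<phi> k x\<bar> powr s \<partial>?T) + K * N powr r * E" for k
    proof -
      note c = trig_continuous[OF \<phi>(1)[of k]]
      have i: "integrable ?T (\<lambda>x. u x * \<phi> k x)" "integrable ?T (\<phi> k)"
        using integrable_scaleR_continuous'[OF wd(1) c] integrable_scaleR_continuous[of "\<lambda>_. 1::real", OF _ c] by auto
      have "(\<integral>x. v x * \<phi> k x \<partial>?T) = (\<integral>x. m * \<phi> k x - u x * \<phi> k x \<partial>?T)"
        using v by (intro integral_cong_AE) (auto elim!: eventually_mono simp: left_diff_distrib)
      also have "\<dots> = m * (\<integral>x. \<phi> k x \<partial>?T) - (\<integral>x. u x * \<phi> k x \<partial>?T)"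
        using i by simp
      finally show ?thesis using bound[OF \<phi>(1)] by simp
    qed
    then have "I \<le> (1/2) * I + K * N powr r * E"
      by (intro LIMSEQ_le[OF 1 tendsto_add[OF tendsto_mult[OF tendsto_const 2] tendsto_const]]) auto
    then have "I \<le> C * E" by (simp add: C_def)
    moreover have "I = (\<integral>x. \<bar>u x - m\<bar> powr r \<partial>?T)"
      unfolding I_def using v by (intro integral_cong_AE) (auto elim!: eventually_mono simp: abs_minus_commute)
    ultimately show "(\<integral>x. \<bar>u x - (\<integral>y. u y \<partial>?T)\<bar> powr r \<partial>?T) \<le> C * (\<integral>x. norm (G x) powr r \<partial>?T)"
      by (simp add: E_def m_def)
  qed
qed

section \<open>Measurability of the Hamiltonian\<close>

text \<open>Along simple functions the composition is a finite sum of measurable pieces, and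
  continuity in the second argument passes to the limit. Values outside \<open>S\<close> are
  replaced by a point of \<open>S\<close>; as \<open>S\<close> is open, this affects only finitely
  many approximations at almost every \<open>x\<close>.\<close>

lemma Caratheodory_measurable:
  fixes g :: "real^'n::finite \<Rightarrow> 'e::euclidean_space \<Rightarrow> 'f::euclidean_space"
  assumes S: "open S" and g: "\<And>y. y \<in> S \<Longrightarrow> (\<lambda>x. g x y) \<in> borel_measurable torus"
    and cont: "AE x in torus. continuous_on S (g x)"
    and y: "y \<in> borel_measurable torus" and yS: "AE x in torus. y x \<in> S"
  shows "(\<lambda>x. g x (y x)) \<in> borel_measurable torus"
proof (cases "S = {}")
  case True
  show ?thesis
    by (rule borel_measurable_torus_AE[of "\<lambda>x. 0"]) (use yS True in auto)
next
  case False
  then obtain y0 where y0: "y0 \<in> S" by auto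
  obtain F where F: "\<And>i. simple_function torus (F i)"
    "\<And>x. x \<in> space torus \<Longrightarrow> (\<lambda>i. F i x) \<longlonglongrightarrow> y x"
    using borel_measurable_implies_sequence_metric[OF y, of 0] by metis
  define Y where "Y i x = (if F i x \<in> S then F i x else y0)" for i x
  have sY: "simple_function torus (Y i)" for i
  proof -
    have "simple_function torus ((\<lambda>v. if v \<in> S then v else y0) \<circ> F i)"
      by (rule simple_function_compose[OF F(1)])
    then show ?thesis by (simp add: Y_def[abs_def] o_def)
  qed
  have YS: "Y i x \<in> S" for i x using y0 by (simp add: Y_def)
  have m: "(\<lambda>x. g x (Y i x)) \<in> borel_measurable torus" for i
  proof -
    have fin: "finite (Y i ` cbox 0 1)" using simple_functionD(1)[OF sY, of i] by simp
    have "(\<lambda>x. \<Sum>v\<in>Y i ` cbox 0 1. indicator (Y i -` {v} \<inter> space torus) x *\<^sub>R g x v) \<in> borel_measurable torus"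
      using simple_functionD(2)[OF sY, of i] YS
      by (intro borel_measurable_sum borel_measurable_scaleR borel_measurable_indicator g) auto
    moreover have "(\<Sum>v\<in>Y i ` cbox 0 1. indicator (Y i -` {v} \<inter> space torus) x *\<^sub>R g x v) = g x (Y i x)"
      if "x \<in> cbox 0 1" for x
    proof -
      have "(\<Sum>v\<in>Y i ` cbox 0 1. indicator (Y i -` {v} \<inter> space torus) x *\<^sub>R g x v)
          = (\<Sum>v\<in>Y i ` cbox 0 1. if v = Y i x then g x v else 0)"
        using that by (intro sum.cong refl) (auto simp: indicator_def)
      also have "\<dots> = g x (Y i x)" using fin that by (simp add: sum.delta)
      finally show ?thesis .
    qed
    ultimately show ?thesis by (subst measurable_cong) auto
  qed
  have "(\<lambda>x. lim (\<lambda>i. g x (Y i x))) \<in> borel_measurable torus"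
    by (intro borel_measurable_lim_metric m)
  moreover have "AE x in torus. lim (\<lambda>i. g x (Y i x)) = g x (y x)"
    using cont yS AE_space
  proof eventually_elim
    case (elim x)
    have "\<forall>\<^sub>F i in sequentially. F i x \<in> S" using topological_tendstoD[OF F(2)[OF elim(3)] S elim(2)] .
    then have "\<forall>\<^sub>F i in sequentially. F i x = Y i x" by eventually_elim (simp add: Y_def)
    then have "(\<lambda>i. Y i x) \<longlonglongrightarrow> y x" using F(2)[OF elim(3)] by (simp add: tendsto_cong)
    then have "(\<lambda>i. g x (Y i x)) \<longlonglongrightarrow> g x (y x)"
      by (rule continuous_on_tendsto_compose[OF elim(1) _ elim(2)]) (simp add: YS)
    then show ?case by (rule limI)
  qed
  ultimately show ?thesis by (rule borel_measurable_torus_AE)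
qed

text \<open>A Lebesgue measurable function differs from a Borel function on a null set, and almost
  all sections of that null set are null by Fubini's theorem.\<close>

lemma lebesgue_prod_section_measurable:
  fixes F :: "(real^'n::finite) \<times> 'e::euclidean_space \<Rightarrow> real"
  assumes F: "F \<in> borel_measurable lebesgue"
  shows "AE y in lborel. (\<lambda>x. F (x, y)) \<in> borel_measurable torus"
proof -
  obtain F' where F': "F' \<in> borel_measurable lborel" "AE z in lborel. F z = F' z"
    using completion_ex_borel_measurable_real[OF F] by auto
  obtain N where N: "N \<in> null_sets lborel" "{z. F z \<noteq> F' z} \<subseteq> N"
    using F'(2) by (auto simp: eventually_ae_filter)
  have "AE z in lborel. z \<notin> N" by (rule AE_not_in[OF N(1)])
  then have "AE z in lborel \<Otimes>\<^sub>M lborel. z \<notin> N" by (subst lborel_prod)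
  then have 1: "AE x in lborel. AE y in lborel. (x, y) \<notin> N" by (rule lborel_pair.AE_pair)
  have Ns: "N \<in> sets (lborel \<Otimes>\<^sub>M lborel)" using null_setsD2[OF N(1)] by (subst lborel_prod)
  then have "{z \<in> space (lborel \<Otimes>\<^sub>M lborel). (fst z, snd z) \<notin> N} \<in> sets ((lborel :: (real^'n) measure) \<Otimes>\<^sub>M (lborel :: 'e measure))"
    using sets.compl_sets[OF Ns] by (simp add: set_diff_eq)
  then have "AE y in lborel. AE x in lborel. (x, y) \<notin> N"
    using 1 lborel_pair.AE_commute[of "\<lambda>x y. (x, y) \<notin> N"] by auto
  then show ?thesis
  proof eventually_elim
    case (elim y)
    have "(\<lambda>x. F' (x, y)) \<in> borel_measurable borel"
      using F'(1) by measurable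
    then have m: "(\<lambda>x. F' (x, y)) \<in> borel_measurable torus"
      unfolding torus_def by (intro measurable_restrict_space1 measurable_completion) simp
    have "AE x in lebesgue. (x, y) \<notin> N" using elim by (rule AE_completion)
    then have "AE x in torus. (x, y) \<notin> N" unfolding torus_def by (subst AE_restrict_space_iff) auto
    then have "AE x in torus. F' (x, y) = F (x, y)"
    proof eventually_elim
      case (elim x)
      then show ?case using subsetD[OF N(2), of "(x, y)"] by fastforce
    qed
    with m show ?case by (rule borel_measurable_torus_AE)
  qed
qed

text \<open>Nonempty open sets are not negligible. The radii \<open>inverse (real (Suc k))\<close>
  are there to produce a convergent sequence.\<close>

lemma AE_lborel_dense:
  fixes y :: "'e::euclidean_space"
  assumes "AE y in lborel. P y" "open S" "y \<in> S"
  shows "\<exists>y'. y' \<in> S \<and> dist y' y < inverse (real (Suc k)) \<and> P y'"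
proof (rule ccontr)
  assume "\<not> ?thesis"
  then have *: "\<And>y'. y' \<in> S \<inter> ball y (inverse (real (Suc k))) \<Longrightarrow> \<not> P y'" by (auto simp: dist_commute)
  let ?U = "S \<inter> ball y (inverse (real (Suc k)))"
  have "open ?U" "y \<in> ?U" using assms by auto
  obtain N where N: "N \<in> null_sets lborel" "{z. \<not> P z} \<subseteq> N"
    using assms(1) by (auto simp: eventually_ae_filter)
  then have "?U \<subseteq> N" using * by auto
  then have "negligible ?U"
    using N(1) by (metis negligible_iff_null_sets negligible_subset null_sets_completionI)
  then show False using open_not_negligible[OF \<open>open ?U\<close>] \<open>y \<in> ?U\<close> by blast
qed

text \<open>Joint Lebesgue measurability gives measurable sections only for almost all
  \<open>(p, m)\<close>. These are dense, and continuity in \<open>(p, m)\<close> reaches the others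
  as limits.\<close>

lemma regular_measurable:
  fixes H :: "'n::finite hamiltonian"
  assumes reg: "regular H" and m: "m > 0"
  shows "(\<lambda>x. H x p m) \<in> borel_measurable torus"
proof -
  let ?S = "cbox (0::real^'n) 1 \<times> (UNIV :: (real^'n) set) \<times> {0::real<..}"
  define F where "F z = (if z \<in> ?S then (case z of (x, p, m) \<Rightarrow> H x p m) else 0)" for z
  have "cbox (0::real^'n) 1 \<times> (UNIV :: (real^'n) set) \<times> {0::real<..} \<in> sets borel"
    by (intro borel_Times) auto
  then have "F \<in> borel_measurable lebesgue"
    using reg unfolding F_def regular_def by (subst borel_measurable_if) auto
  then have dense: "AE y in lborel. (\<lambda>x. F (x, y)) \<in> borel_measurable torus"
    by (rule lebesgue_prod_section_measurable)
  have op: "open ((UNIV :: (real^'n) set) \<times> {0::real<..})" by (intro open_Times) auto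
  have "\<exists>y'. y' \<in> UNIV \<times> {0<..} \<and> dist y' (p, m) < inverse (real (Suc k)) \<and> (\<lambda>x. F (x, y')) \<in> borel_measurable torus" for k
    by (rule AE_lborel_dense[OF dense op]) (use m in auto)
  then obtain y where y: "\<And>k. y k \<in> UNIV \<times> {0<..}" "\<And>k. dist (y k) (p, m) < inverse (real (Suc k))"
    "\<And>k. (\<lambda>x. F (x, y k)) \<in> borel_measurable torus" by metis
  have yl: "y \<longlonglongrightarrow> (p, m)"
    unfolding tendsto_dist_iff[of y]
    by (rule Lim_null_comparison[OF _ LIMSEQ_inverse_real_of_nat])
       (use y(2) in \<open>auto intro!: always_eventually less_imp_le\<close>)
  have "(\<lambda>x. lim (\<lambda>k. F (x, y k))) \<in> borel_measurable torus"
    by (intro borel_measurable_lim_metric y)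
  moreover have "AE x in torus. continuous_on (UNIV \<times> {0<..}) (\<lambda>(p, m). H x p m)"
    using reg unfolding regular_def by (auto elim: eventually_mono)
  then have "AE x in torus. lim (\<lambda>k. F (x, y k)) = H x p m"
    using AE_space
  proof eventually_elim
    case (elim x)
    have "(\<lambda>k. (\<lambda>(p, m). H x p m) (y k)) \<longlonglongrightarrow> (\<lambda>(p, m). H x p m) (p, m)"
      by (rule continuous_on_tendsto_compose[OF elim(1) yl]) (use m y in auto)
    moreover have "F (x, y k) = (\<lambda>(p, m). H x p m) (y k)" for k
      using y(1)[of k] elim(2) by (auto simp: F_def)
    ultimately show ?case by (auto intro: limI)
  qed
  ultimately show ?thesis by (rule borel_measurable_torus_AE)
qed

lemma DpH_directional:
  fixes H :: "'n::finite hamiltonian"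
  assumes "(\<lambda>q. H x q m) differentiable (at (p + t *\<^sub>R h))"
  shows "((\<lambda>t. H x (p + t *\<^sub>R h) m) has_real_derivative DpH H x (p + t *\<^sub>R h) m \<bullet> h) (at t)"
proof -
  have "((\<lambda>q. H x q m) has_derivative (\<lambda>k. k \<bullet> DpH H x (p + t *\<^sub>R h) m)) (at (p + t *\<^sub>R h))"
    using GDERIV_grad[OF assms] by (simp only: gderiv_def DpH_def)
  moreover have "((\<lambda>t. p + t *\<^sub>R h) has_derivative (\<lambda>s. s *\<^sub>R h)) (at t)"
    by (auto intro!: derivative_eq_intros)
  ultimately have "((\<lambda>t. H x (p + t *\<^sub>R h) m) has_derivative (\<lambda>s. (s *\<^sub>R h) \<bullet> DpH H x (p + t *\<^sub>R h) m)) (at t)"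
    using has_derivative_compose[of "\<lambda>t. p + t *\<^sub>R h" "\<lambda>s. s *\<^sub>R h" t UNIV "\<lambda>q. H x q m"] by blast
  then show ?thesis
    unfolding has_field_derivative_def by (simp add: inner_commute mult.commute[of _ "inner _ _"])
qed

text \<open>Each component is an a.e. limit of difference quotients of \<open>H\<close>, which
  \<open>regular_measurable\<close> covers.\<close>

lemma DpH_measurable:
  fixes H :: "'n::finite hamiltonian"
  assumes reg: "regular H" and m: "m > 0"
  shows "(\<lambda>x. DpH H x p m) \<in> borel_measurable torus"
proof (subst borel_measurable_euclidean_space, intro ballI)
  fix b :: "real^'n" assume "b \<in> Basis"
  define s where "s k = inverse (real (Suc k))" for k
  have s: "s k > 0" for k by (simp add: s_def)
  have sl: "s \<longlonglongrightarrow> 0" unfolding s_def by (rule LIMSEQ_inverse_real_of_nat)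
  let ?d = "\<lambda>k x. (H x (p + s k *\<^sub>R b) m - H x p m) / s k"
  have "(\<lambda>x. lim (\<lambda>k. ?d k x)) \<in> borel_measurable torus"
    by (intro borel_measurable_lim_metric borel_measurable_divide borel_measurable_diff regular_measurable[OF reg m]) auto
  moreover have "AE x in torus. \<forall>p. \<forall>m>0. (\<lambda>q. H x q m) differentiable (at p)"
    using reg unfolding regular_def by (auto elim: eventually_mono)
  then have "AE x in torus. lim (\<lambda>k. ?d k x) = DpH H x p m \<bullet> b"
  proof eventually_elim
    case (elim x)
    have "((\<lambda>t. H x (p + t *\<^sub>R b) m) has_real_derivative DpH H x (p + 0 *\<^sub>R b) m \<bullet> b) (at 0)"
      by (rule DpH_directional) (use elim m in auto)
    then have "(\<lambda>k. ?d k x) \<longlonglongrightarrow> DpH H x p m \<bullet> b"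
      unfolding DERIV_def tendsto_at_iff_sequentially using sl s[THEN less_imp_neq] by (auto simp: o_def dest!: spec[of _ s])
    then show ?case by (rule limI)
  qed
  ultimately show "(\<lambda>x. DpH H x p m \<bullet> b) \<in> borel_measurable torus" by (rule borel_measurable_torus_AE)
qed

lemma borel_measurable_components:
  fixes z :: "'a \<Rightarrow> real \<times> real \<times> 'c::euclidean_space"
  assumes "z \<in> borel_measurable M"
  shows "(\<lambda>x. fst (z x)) \<in> borel_measurable M" "(\<lambda>x. fst (snd (z x))) \<in> borel_measurable M"
    "(\<lambda>x. snd (snd (z x))) \<in> borel_measurable M"
  by (intro borel_measurable_continuous_on[OF _ assms] continuous_intros)+

section \<open>The truncated problem\<close>

locale mfg =
  fixes H :: "'n::finite hamiltonian" and V :: "real^'n \<Rightarrow> real" and \<alpha> \<beta> C :: real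
    and f :: "(real^'n) \<times> real \<Rightarrow> real"
  assumes alpha: "\<alpha> > 1" and beta: "\<beta> > 0" and C: "C > 0"
    and reg: "regular H"
    and f_cont: "continuous_on (UNIV \<times> {0<..}) f"
    and monotone: "AE x in torus. \<forall>p1 p2. \<forall>m1>0. \<forall>m2>0.
        (- H x p1 m1 + H x p2 m2) * (m1 - m2)
        + (m1 *\<^sub>R DpH H x p1 m1 - m2 *\<^sub>R DpH H x p2 m2) \<bullet> (p1 - p2) \<ge> 0"
    and growth: "AE x in torus. \<forall>p. \<forall>m>0.
           H x 0 m \<le> - (1 / C) * m powr \<beta> + C \<and>
           norm (DpH H x p m) \<le> f (p, m) \<and>
           H x p m \<ge> (1 / C) * norm p powr \<alpha> - C * (m powr \<beta> + 1)"
    and V_meas [measurable]: "V \<in> borel_measurable torus"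
    and V_int: "integrable torus (\<lambda>x. \<bar>V x\<bar> powr ((\<beta> + 1) / \<beta>))"
begin

definition q :: real where "q = (\<beta> + 1) / \<beta>"

text \<open>Gathers the a.e. assumptions at a single point, with one exceptional set for all
  \<open>(p, m)\<close>, so that the estimates below become pointwise.\<close>

definition good :: "real^'n \<Rightarrow> bool" where
  "good x \<longleftrightarrow> continuous_on (UNIV \<times> {0<..}) (\<lambda>(p, m). H x p m)
     \<and> (\<forall>p. \<forall>m>0. (\<lambda>q. H x q m) differentiable (at p))
     \<and> continuous_on (UNIV \<times> {0<..}) (\<lambda>(p, m). DpH H x p m)
     \<and> (\<forall>p1 p2. \<forall>m1>0. \<forall>m2>0.
        (- H x p1 m1 + H x p2 m2) * (m1 - m2)
        + (m1 *\<^sub>R DpH H x p1 m1 - m2 *\<^sub>R DpH H x p2 m2) \<bullet> (p1 - p2) \<ge> 0)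
     \<and> (\<forall>p. \<forall>m>0. H x 0 m \<le> - (1 / C) * m powr \<beta> + C \<and>
           norm (DpH H x p m) \<le> f (p, m) \<and>
           H x p m \<ge> (1 / C) * norm p powr \<alpha> - C * (m powr \<beta> + 1))"

lemma AE_good: "AE x in torus. good x"
proof -
  have "AE x in torus. continuous_on (UNIV \<times> {0<..}) (\<lambda>(p, m). H x p m)
     \<and> (\<forall>p. \<forall>m>0. (\<lambda>q. H x q m) differentiable (at p))
     \<and> continuous_on (UNIV \<times> {0<..}) (\<lambda>(p, m). DpH H x p m)"
    using reg by (simp add: regular_def)
  with monotone growth show ?thesis
    unfolding good_def by eventually_elim blast
qed

text \<open>Monotonicity with \<open>m1 = m2\<close> says that \<open>DpH\<close> is monotone in \<open>p\<close>, that is,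
  \<open>H\<close> is convex in \<open>p\<close>.\<close>

lemma H_convex:
  assumes g: "good x" and m: "m > 0"
  shows "H x p m - DpH H x p m \<bullet> p \<le> H x 0 m"
proof -
  \<comment> \<open>The increment of \<open>H\<close> over the segment is a directional derivative
    at an intermediate point; monotonicity of \<open>DpH\<close> bounds it by the one at
    \<open>p\<close>.\<close>
  obtain t where t: "0 < t" "t < 1"
    "H x (0 + 1 *\<^sub>R p) m - H x (0 + 0 *\<^sub>R p) m = (1 - 0) * (DpH H x (0 + t *\<^sub>R p) m \<bullet> p)"
    using MVT2[of 0 1 "\<lambda>t. H x (0 + t *\<^sub>R p) m" "\<lambda>t. DpH H x (0 + t *\<^sub>R p) m \<bullet> p"]
      DpH_directional[of H x m 0 _ p] g m by (auto simp: good_def)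
  have "0 \<le> (m *\<^sub>R DpH H x p m - m *\<^sub>R DpH H x (t *\<^sub>R p) m) \<bullet> (p - t *\<^sub>R p)"
    using g m unfolding good_def by (metis (no_types, opaque_lifting) add.left_neutral cancel_comm_monoid_add_class.diff_cancel mult_zero_right)
  also have "\<dots> = (m * (1 - t)) * ((DpH H x p m - DpH H x (t *\<^sub>R p) m) \<bullet> p)"
    by (simp add: algebra_simps)
  finally have "DpH H x (t *\<^sub>R p) m \<bullet> p \<le> DpH H x p m \<bullet> p"
    using m t by (auto simp: zero_le_mult_iff inner_diff_left mult_le_0_iff)
  then show ?thesis using t(3) by simp
qed

lemma H_lower:
  assumes "good x" "m > 0"
  shows "(1 / C) * norm p powr \<alpha> - C * (m powr \<beta> + 1) \<le> H x p m"
  using assms unfolding good_def by blast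

lemma DpH_le: "good x \<Longrightarrow> m > 0 \<Longrightarrow> norm (DpH H x p m) \<le> f (p, m)"
  unfolding good_def by blast

text \<open>The right side is the Legendre transform of the Hamiltonian, evaluated at its slope at
  \<open>p\<close>. By convexity it is smallest at \<open>p = 0\<close>, where the growth assumption
  applies. Multiplied by \<open>m\<close>, it is the coercive term of the energy estimate.\<close>

lemma legendre_lower:
  assumes g: "good x" and m: "m > 0"
  shows "(1 / C) * m powr \<beta> - C \<le> DpH H x p m \<bullet> p - H x p m"
proof -
  have "H x 0 m \<le> - (1 / C) * m powr \<beta> + C" using assms unfolding good_def by blast
  then show ?thesis using H_convex[OF g m, of p] by linarith
qed

text \<open>The lower half is the growth assumption; the upper half follows from
  \<open>legendre_lower\<close> and Cauchy-Schwarz. It bounds the operator on compact sets of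
  \<open>(p, m)\<close>.\<close>

lemma H_abs_le:
  assumes g: "good x" and m: "m > 0"
  shows "\<bar>H x p m\<bar> \<le> C * (m powr \<beta> + 1) + f (p, m) * norm p"
proof -
  have D: "norm (DpH H x p m) \<le> f (p, m)" by (rule DpH_le[OF g m])
  then have f0: "0 \<le> f (p, m) * norm p" by (intro mult_nonneg_nonneg) (auto intro: order_trans[OF norm_ge_zero])
  have "DpH H x p m \<bullet> p \<le> norm (DpH H x p m) * norm p" by (rule norm_cauchy_schwarz)
  also have "\<dots> \<le> f (p, m) * norm p" using D by (intro mult_right_mono) auto
  finally have "H x p m \<le> f (p, m) * norm p + C - (1 / C) * m powr \<beta>" using legendre_lower[OF g m, of p] by linarith
  moreover have "(1 / C) * m powr \<beta> \<ge> 0" "C * m powr \<beta> \<ge> 0" "(1 / C) * norm p powr \<alpha> \<ge> 0" using C by auto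
  ultimately show ?thesis using H_lower[OF g m, of p] f0 unfolding distrib_left by linarith
qed

text \<open>Arguments and values are triples \<open>(\<mu>, \<upsilon>, D\<upsilon>)\<close>, so that the
  integrand in the definition of a weak solution is an inner product.\<close>

definition A :: "real^'n \<Rightarrow> real \<times> real \<times> (real^'n) \<Rightarrow> real \<times> real \<times> (real^'n)" where
  "A x z = (- fst (snd z) - H x (snd (snd z)) (fst z) + V x, fst z - 1, fst z *\<^sub>R DpH H x (snd (snd z)) (fst z))"

lemma A_monotone:
  assumes g: "good x" and "fst z > 0" "fst w > 0"
  shows "0 \<le> (A x z - A x w) \<bullet> (z - w)"
proof -
  obtain m u p where z: "z = (m, u, p)" by (cases z)
  obtain m' u' p' where w: "w = (m', u', p')" by (cases w)
  have "0 \<le> (- H x p m + H x p' m') * (m - m') + (m *\<^sub>R DpH H x p m - m' *\<^sub>R DpH H x p' m') \<bullet> (p - p')"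
    using assms unfolding good_def z w by simp
  also have "\<dots> = (A x z - A x w) \<bullet> (z - w)"
    unfolding A_def z w by (simp add: algebra_simps)
  finally show ?thesis .
qed

lemma A_continuous:
  assumes g: "good x"
  shows "continuous_on {z. fst z > 0} (A x)"
proof -
  have c1: "continuous_on (UNIV \<times> {0<..}) (\<lambda>y. H x (fst y) (snd y))"
    and c2: "continuous_on (UNIV \<times> {0<..}) (\<lambda>y. DpH H x (fst y) (snd y))"
    using g unfolding good_def by (simp_all add: split_beta')
  have "continuous_on {z. fst z > 0} (\<lambda>z::real \<times> real \<times> (real^'n). (snd (snd z), fst z))"
    by (intro continuous_intros)
  from continuous_on_compose2[OF c1 this] continuous_on_compose2[OF c2 this]
  have "continuous_on {z. fst z > 0} (\<lambda>z::real \<times> real \<times> (real^'n). H x (snd (snd z)) (fst z))"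
    "continuous_on {z. fst z > 0} (\<lambda>z::real \<times> real \<times> (real^'n). DpH H x (snd (snd z)) (fst z))" by auto
  then show ?thesis unfolding A_def by (intro continuous_intros)
qed

lemma open_pos: "open {z :: real \<times> real \<times> (real^'n). fst z > 0}"
  by (intro open_Collect_less continuous_intros)

lemma A_measurable:
  assumes z: "z \<in> borel_measurable torus" and pos: "AE x in torus. fst (z x) > 0"
  shows "(\<lambda>x. A x (z x)) \<in> borel_measurable torus"
proof (rule Caratheodory_measurable[OF open_pos _ _ z])
  show "(\<lambda>x. A x y) \<in> borel_measurable torus" if "y \<in> {z. fst z > 0}" for y
  proof -
    have [measurable]: "(\<lambda>x. H x (snd (snd y)) (fst y)) \<in> borel_measurable torus"
      "(\<lambda>x. DpH H x (snd (snd y)) (fst y)) \<in> borel_measurable torus"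
      using that by (auto intro: regular_measurable[OF reg] DpH_measurable[OF reg])
    show ?thesis unfolding A_def by measurable
  qed
  show "AE x in torus. continuous_on {z. fst z > 0} (A x)"
    using AE_good by eventually_elim (rule A_continuous)
qed (use pos in auto)

text \<open>The exponent \<open>\<beta> / \<alpha>\<close> makes \<open>norm Du powr \<alpha> \<le> m powr \<beta>\<close> hold where \<open>m = R\<close>.\<close>

definition K :: "real \<Rightarrow> (real^'n \<Rightarrow> real \<times> real \<times> (real^'n)) set" where
  "K R = {z. z \<in> borel_measurable torus
     \<and> (AE x in torus. 1 / R \<le> fst (z x) \<and> fst (z x) \<le> R \<and> \<bar>fst (snd (z x))\<bar> \<le> R
           \<and> norm (snd (snd (z x))) \<le> R powr (\<beta> / \<alpha>))
     \<and> torus_weak_gradient (\<lambda>x. fst (snd (z x))) (\<lambda>x. snd (snd (z x)))}"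

lemma K_D:
  assumes "z \<in> K R"
  shows "z \<in> borel_measurable torus"
    "AE x in torus. 1 / R \<le> fst (z x) \<and> fst (z x) \<le> R \<and> \<bar>fst (snd (z x))\<bar> \<le> R \<and> norm (snd (snd (z x))) \<le> R powr (\<beta> / \<alpha>)"
    "torus_weak_gradient (\<lambda>x. fst (snd (z x))) (\<lambda>x. snd (snd (z x)))"
  using assms by (auto simp: K_def)

lemma K_pos:
  assumes "z \<in> K R" "R > 0"
  shows "AE x in torus. fst (z x) > 0"
  using K_D(2)[OF assms(1)]
proof eventually_elim
  case (elim x)
  have "0 < 1 / R" using assms by simp
  then show ?case using elim by linarith
qed

lemma weak_gradient_zero: "torus_weak_gradient (\<lambda>x. 0) (\<lambda>x. 0)"
  by (simp add: torus_weak_gradient_def)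

lemma K_const: "1 / R \<le> s \<Longrightarrow> s \<le> R \<Longrightarrow> R > 0 \<Longrightarrow> (\<lambda>x. (s, 0, 0)) \<in> K R"
  using weak_gradient_zero by (simp add: K_def)

lemma K_mono: "K R \<subseteq> K R'" if "0 < R" "R \<le> R'"
proof
  fix z assume z: "z \<in> K R"
  have "1 / R' \<le> 1 / R" using that by (simp add: frac_le)
  moreover have "R powr (\<beta> / \<alpha>) \<le> R' powr (\<beta> / \<alpha>)" using that alpha beta by (intro powr_mono2) auto
  ultimately have "AE x in torus. 1 / R' \<le> fst (z x) \<and> fst (z x) \<le> R' \<and> \<bar>fst (snd (z x))\<bar> \<le> R'
           \<and> norm (snd (snd (z x))) \<le> R' powr (\<beta> / \<alpha>)"
    using K_D(2)[OF z] that by - (erule eventually_mono, auto)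
  then show "z \<in> K R'" using K_D[OF z] unfolding K_def by blast
qed

text \<open>A bound on p-th powers with \<open>p > 1\<close> upgrades a.e. convergence to
  convergence in mean, by \<open>Lp_bounded_ae_lim_weighted\<close> with weight 1, and weak
  gradients are stable under the latter.\<close>

lemma weak_gradient_closed:
  fixes u :: "nat \<Rightarrow> real^'n \<Rightarrow> real"
  assumes w: "\<And>k. torus_weak_gradient (u k) (G k)" and p: "p > 1"
    and vF: "v \<in> borel_measurable torus" "F \<in> borel_measurable torus"
    and u: "\<And>k. integrable torus (\<lambda>x. \<bar>u k x\<bar> powr p)" "\<And>k. (\<integral>x. \<bar>u k x\<bar> powr p \<partial>torus) \<le> B"
    and G: "\<And>k. integrable torus (\<lambda>x. norm (G k x) powr p)" "\<And>k. (\<integral>x. norm (G k x) powr p \<partial>torus) \<le> B"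
    and ul: "AE x in torus. (\<lambda>k. u k x) \<longlonglongrightarrow> v x" and Gl: "AE x in torus. (\<lambda>k. G k x) \<longlonglongrightarrow> F x"
  shows "torus_weak_gradient v F"
proof -
  interpret finite_measure "torus :: (real^'n) measure" by (rule finite_measure_torus)
  note wd = torus_weak_gradientD[OF w]
  have m: "u k \<in> borel_measurable torus" "G k \<in> borel_measurable torus" for k
    using wd(1)[of k] wd(2)[of k] by auto
  have g: "(\<lambda>x. 1::real) \<in> borel_measurable torus" "integrable torus (\<lambda>x::real^'n. \<bar>1::real\<bar> powr (p / (p - 1)))" by auto
  have u': "\<And>k. integrable torus (\<lambda>x. norm (u k x) powr p)" "\<And>k. (\<integral>x. norm (u k x) powr p \<partial>torus) \<le> B"
    using u by auto
  note 1 = Lp_bounded_ae_lim_weighted[OF m(1) vF(1) u' ul p g, simplified]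
  note 2 = Lp_bounded_ae_lim_weighted[OF m(2) vF(2) G Gl p g, simplified]
  have "integrable torus (\<lambda>x. u 0 x - v x)"
    by (rule iffD1[OF integrable_norm_iff]) (use 1(2)[of 0] m vF in auto)
  then have iv: "integrable torus v" using Bochner_Integration.integrable_diff[OF wd(1)[of 0], of "\<lambda>x. u 0 x - v x"] by simp
  have "integrable torus (\<lambda>x. G 0 x - F x)"
    by (rule iffD1[OF integrable_norm_iff]) (use 2(2)[of 0] m vF in auto)
  then have iF: "integrable torus F" using Bochner_Integration.integrable_diff[OF wd(2)[of 0], of "\<lambda>x. G 0 x - F x"] by simp
  show ?thesis by (rule torus_weak_gradient_limit[OF w iv iF]) (use 1(1) 2(1) in auto)
qed

lemma bounded_powr_integral:
  fixes u :: "real^'n \<Rightarrow> 'b::euclidean_space"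
  assumes u: "u \<in> borel_measurable torus" and b: "AE x in torus. norm (u x) \<le> B" and p: "p > 0" and B: "B \<ge> 0"
  shows "integrable torus (\<lambda>x. norm (u x) powr p)" "(\<integral>x. norm (u x) powr p \<partial>torus) \<le> B powr p"
proof -
  interpret finite_measure "torus :: (real^'n) measure" by (rule finite_measure_torus)
  note [measurable] = u
  have *: "AE x in torus. norm (u x) powr p \<le> B powr p"
    using b by eventually_elim (use p in \<open>auto intro!: powr_mono2\<close>)
  show i: "integrable torus (\<lambda>x. norm (u x) powr p)"
    by (rule integrable_const_bound[of _ "B powr p"]) (use * in auto)
  have "(\<integral>x. norm (u x) powr p \<partial>torus) \<le> (\<integral>x. B powr p \<partial>(torus :: (real^'n) measure))"
    by (intro integral_mono_AE i *) auto
  then show "(\<integral>x. norm (u x) powr p \<partial>torus) \<le> B powr p" by simp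
qed

lemma K_closed:
  assumes R: "R > 0" and zs: "\<And>k. zs k \<in> K R" and z: "z \<in> borel_measurable torus"
    and lim: "AE x in torus. (\<lambda>k. zs k x) \<longlonglongrightarrow> z x"
  shows "z \<in> K R"
proof -
  let ?B = "max R (R powr (\<beta> / \<alpha>))"
  note [measurable] = z K_D(1)[OF zs]
  have "AE x in torus. \<forall>k. 1 / R \<le> fst (zs k x) \<and> fst (zs k x) \<le> R \<and> \<bar>fst (snd (zs k x))\<bar> \<le> R \<and> norm (snd (snd (zs k x))) \<le> R powr (\<beta> / \<alpha>)"
    unfolding AE_all_countable using K_D(2)[OF zs] by blast
  with lim have b: "AE x in torus. 1 / R \<le> fst (z x) \<and> fst (z x) \<le> R \<and> \<bar>fst (snd (z x))\<bar> \<le> R \<and> norm (snd (snd (z x))) \<le> R powr (\<beta> / \<alpha>)"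
  proof eventually_elim
    case (elim x)
    note l = tendsto_fst[OF elim(1)] tendsto_snd[OF elim(1)]
    note l2 = tendsto_fst[OF l(2)] tendsto_snd[OF l(2)]
    show ?case
    proof (intro conjI)
      show "1 / R \<le> fst (z x)" by (rule LIMSEQ_le_const[OF l(1)]) (use elim in auto)
      show "fst (z x) \<le> R" by (rule LIMSEQ_le_const2[OF l(1)]) (use elim in auto)
      show "\<bar>fst (snd (z x))\<bar> \<le> R" by (rule LIMSEQ_le_const2[OF tendsto_rabs[OF l2(1)]]) (use elim in auto)
      show "norm (snd (snd (z x))) \<le> R powr (\<beta> / \<alpha>)" by (rule LIMSEQ_le_const2[OF tendsto_norm[OF l2(2)]]) (use elim in auto)
    qed
  qed
  have "torus_weak_gradient (\<lambda>x. fst (snd (z x))) (\<lambda>x. snd (snd (z x)))"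
  \<comment> \<open>Elements of \<open>K R\<close> are uniformly bounded, so any exponent above 1
    would serve; 2 is taken.\<close>
  proof (rule weak_gradient_closed[OF K_D(3)[OF zs], where p=2 and B="?B powr 2"])
    have bu: "AE x in torus. norm (fst (snd (zs k x))) \<le> ?B" and bG: "AE x in torus. norm (snd (snd (zs k x))) \<le> ?B" for k
      by (rule eventually_mono[OF K_D(2)[OF zs[of k]]], force)+
    have B0: "?B \<ge> 0" using R by simp
    have two: "(2::real) > 0" by simp
    note cm = borel_measurable_components[OF K_D(1)[OF zs]] borel_measurable_components[OF z]
    show "integrable torus (\<lambda>x. \<bar>fst (snd (zs k x))\<bar> powr 2)" "(\<integral>x. \<bar>fst (snd (zs k x))\<bar> powr 2 \<partial>torus) \<le> ?B powr 2" for k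
      using bounded_powr_integral[OF cm(2) bu two B0, of k] by (simp_all only: real_norm_def)
    show "integrable torus (\<lambda>x. norm (snd (snd (zs k x))) powr 2)" "(\<integral>x. norm (snd (snd (zs k x))) powr 2 \<partial>torus) \<le> ?B powr 2" for k
      using bounded_powr_integral[OF cm(3) bG two B0, of k] by (simp_all only: real_norm_def)
    show "AE x in torus. (\<lambda>k. fst (snd (zs k x))) \<longlonglongrightarrow> fst (snd (z x))"
      "AE x in torus. (\<lambda>k. snd (snd (zs k x))) \<longlonglongrightarrow> snd (snd (z x))"
      using lim by (auto elim!: eventually_mono intro: tendsto_fst tendsto_snd)
  qed (use borel_measurable_components[OF z] in auto)
  with b z show ?thesis by (simp add: K_def)
qed

lemma K_convex:
  assumes "z \<in> K R" "w \<in> K R" "0 \<le> t" "t \<le> 1"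
  shows "(\<lambda>x. (1 - t) *\<^sub>R z x + t *\<^sub>R w x) \<in> K R"
proof -
  have c: "(1 - t) * a + t * b \<le> c" if "a \<le> c" "b \<le> c" for a b c :: real
    by (rule convex_bound_le) (use that assms in auto)
  note [measurable] = K_D(1)[OF assms(1)] K_D(1)[OF assms(2)]
  have "AE x in torus. 1 / R \<le> fst ((1 - t) *\<^sub>R z x + t *\<^sub>R w x) \<and> fst ((1 - t) *\<^sub>R z x + t *\<^sub>R w x) \<le> R
    \<and> \<bar>fst (snd ((1 - t) *\<^sub>R z x + t *\<^sub>R w x))\<bar> \<le> R \<and> norm (snd (snd ((1 - t) *\<^sub>R z x + t *\<^sub>R w x))) \<le> R powr (\<beta> / \<alpha>)"
    using K_D(2)[OF assms(1)] K_D(2)[OF assms(2)]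
  proof eventually_elim
    case (elim x)
    have "norm ((1 - t) *\<^sub>R snd (snd (z x)) + t *\<^sub>R snd (snd (w x))) \<le> (1 - t) * norm (snd (snd (z x))) + t * norm (snd (snd (w x)))"
      by (rule norm_triangle_le) (use assms in simp)
    also have "\<dots> \<le> R powr (\<beta> / \<alpha>)" by (rule c) (use elim in auto)
    finally have 1: "norm ((1 - t) *\<^sub>R snd (snd (z x)) + t *\<^sub>R snd (snd (w x))) \<le> R powr (\<beta> / \<alpha>)" .
    have "\<bar>(1 - t) * fst (snd (z x)) + t * fst (snd (w x))\<bar> \<le> R"
      using c[of "fst (snd (z x))" R "fst (snd (w x))"] c[of "- fst (snd (z x))" R "- fst (snd (w x))"] elim
      unfolding abs_le_iff by simp
    moreover have "1 / R \<le> (1 - t) * fst (z x) + t * fst (w x)"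
      using c[of "- fst (z x)" "- (1 / R)" "- fst (w x)"] elim by auto
    ultimately show ?case using 1 c[of "fst (z x)" R "fst (w x)"] elim by simp
  qed
  moreover have "torus_weak_gradient (\<lambda>x. (1 - t) * fst (snd (z x)) + t * fst (snd (w x))) (\<lambda>x. (1 - t) *\<^sub>R snd (snd (z x)) + t *\<^sub>R snd (snd (w x)))"
    by (rule torus_weak_gradient_lincomb[OF K_D(3)[OF assms(1)] K_D(3)[OF assms(2)]])
  ultimately show ?thesis unfolding K_def by simp
qed

lemma norm_triple_le: "norm z \<le> \<bar>fst z\<bar> + \<bar>fst (snd z)\<bar> + norm (snd (snd z))" for z :: "real \<times> real \<times> (real^'n)"
  using norm_Pair_le[of "fst z" "snd z"] norm_Pair_le[of "fst (snd z)" "snd (snd z)"] by simp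

text \<open>The barrier \<open>1 / R\<close> acts here: the admissible \<open>(p, m)\<close> form a
  compact set away from \<open>m = 0\<close>, on which \<open>f\<close> is bounded. The unbounded
  \<open>V\<close> enters the first component only.\<close>

lemma A_component_bounds:
  assumes R: "R \<ge> 1"
  shows "\<exists>b\<ge>0. \<forall>z\<in>K R. AE x in torus. \<bar>fst (A x (z x))\<bar> \<le> \<bar>V x\<bar> + b
     \<and> \<bar>fst (snd (A x (z x)))\<bar> \<le> b \<and> norm (snd (snd (A x (z x)))) \<le> b"
proof -
  let ?P = "R powr (\<beta> / \<alpha>)"
  let ?S = "cball (0::real^'n) ?P \<times> {1/R..R}"
  have "compact (f ` ?S)"
    by (intro compact_continuous_image continuous_on_subset[OF f_cont] compact_Times)
       (use R in \<open>auto intro: less_le_trans[of 0 "1 / R"]\<close>)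
  then obtain F where F: "F > 0" "\<And>y. y \<in> ?S \<Longrightarrow> \<bar>f y\<bar> \<le> F"
    by (metis bounded_pos compact_imp_bounded imageI real_norm_def)
  define b where "b = R + (C * (R powr \<beta> + 1) + F * ?P) + (R + 1) + R * F"
  have nn: "C * (R powr \<beta> + 1) \<ge> 0" "F * ?P \<ge> 0" "R * F \<ge> 0" using C F R by auto
  have "AE x in torus. \<bar>fst (A x (z x))\<bar> \<le> \<bar>V x\<bar> + b \<and> \<bar>fst (snd (A x (z x)))\<bar> \<le> b \<and> norm (snd (snd (A x (z x)))) \<le> b"
    if z: "z \<in> K R" for z
    using K_D(2)[OF z] AE_good
  proof eventually_elim
    case (elim x)
    obtain m u p where zx: "z x = (m, u, p)" by (cases "z x")
    have mb: "1 / R \<le> m" "m \<le> R" "\<bar>u\<bar> \<le> R" "norm p \<le> ?P" using elim(1) by (auto simp: zx)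
    then have m: "m > 0" using R by (smt (verit) divide_pos_pos)
    have fb: "\<bar>f (p, m)\<bar> \<le> F" 
    proof (rule F(2))
      show "(p, m) \<in> ?S" using mb(1,2,4) by simp
    qed
    have "f (p, m) * norm p \<le> F * ?P" using fb mb F by (intro mult_mono order_trans[OF abs_ge_self fb]) auto
    moreover have "C * (m powr \<beta> + 1) \<le> C * (R powr \<beta> + 1)"
      using mb m beta C by (intro mult_left_mono add_right_mono powr_mono2) auto
    ultimately have Hb: "\<bar>H x p m\<bar> \<le> C * (R powr \<beta> + 1) + F * ?P"
      using H_abs_le[OF elim(2) m, of p] by linarith
    have "norm (DpH H x p m) \<le> F" using DpH_le[OF elim(2) m, of p] fb by linarith
    then have "m * norm (DpH H x p m) \<le> R * F" using mb m by (intro mult_mono) auto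
    moreover have "norm (m *\<^sub>R DpH H x p m) = m * norm (DpH H x p m)" using m by simp
    moreover have "0 \<le> C * (R powr \<beta> + 1) + F * ?P" using nn by simp
    ultimately show ?case
      using Hb mb m R nn(3) unfolding zx A_def b_def fst_conv snd_conv by (intro conjI) linarith+
  qed
  moreover have "b \<ge> 0" using nn R F by (simp add: b_def)
  ultimately show ?thesis by blast
qed

lemma V_abs_integrable: "integrable torus V"
proof -
  interpret finite_measure "torus :: (real^'n) measure" by (rule finite_measure_torus)
  have q1: "q \<ge> 1" using beta by (simp add: q_def field_simps)
  have "v \<le> 1 + v powr q" if "v \<ge> 0" for v :: real
  proof (cases "v \<le> 1")
    case False
    then have "v powr 1 \<le> v powr q" using q1 by (intro powr_mono) auto
    then show ?thesis using that by simp
  qed (use powr_ge_zero[of v q] in linarith)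
  then show ?thesis
    by (intro Bochner_Integration.integrable_bound[where f="\<lambda>x. 1 + \<bar>V x\<bar> powr q" and g=V])
       (use V_int in \<open>auto simp: q_def\<close>)
qed

lemma variational_inequality:
  assumes R: "R \<ge> 1"
  shows "\<exists>z\<in>K R. \<forall>w\<in>K R. 0 \<le> (\<integral>x. A x (z x) \<bullet> (w x - z x) \<partial>torus) \<and> 0 \<le> (\<integral>x. A x (w x) \<bullet> (w x - z x) \<partial>torus)"
proof -
  interpret finite_measure "torus :: (real^'n) measure" by (rule finite_measure_torus)
  have R0: "R > 0" using R by simp
  obtain b where b: "b \<ge> 0" "\<And>z. z \<in> K R \<Longrightarrow> AE x in torus. \<bar>fst (A x (z x))\<bar> \<le> \<bar>V x\<bar> + b
     \<and> \<bar>fst (snd (A x (z x)))\<bar> \<le> b \<and> norm (snd (snd (A x (z x)))) \<le> b"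
    using A_component_bounds[OF R] by blast
  show ?thesis
  proof (rule monotone_variational_inequality[where \<rho>="R + R + R powr (\<beta> / \<alpha>)" and \<kappa>="\<lambda>x. \<bar>V x\<bar> + 3 * b"])
    show "finite_measure torus" by (rule finite_measure_torus)
    have "(\<lambda>x. (1, 0, 0)) \<in> K R" using R by (intro K_const) auto
    then show "K R \<noteq> {}" by auto
    show "(\<lambda>x. (1 - t) *\<^sub>R z x + t *\<^sub>R w x) \<in> K R" if "z \<in> K R" "w \<in> K R" "0 \<le> t" "t \<le> 1" for z w t
      by (rule K_convex[OF that])
    show "z \<in> borel_measurable torus" if "z \<in> K R" for z by (rule K_D(1)[OF that])
    show "AE x in torus. norm (z x) \<le> R + R + R powr (\<beta> / \<alpha>)" if z: "z \<in> K R" for z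
      using K_D(2)[OF z] K_pos[OF z R0]
    proof eventually_elim
      case (elim x)
      then show ?case using norm_triple_le[of "z x"] by linarith
    qed
    show "z \<in> K R" if "\<And>k. zs k \<in> K R" "z \<in> borel_measurable torus" "AE x in torus. (\<lambda>k. zs k x) \<longlonglongrightarrow> z x" for zs z
      by (rule K_closed[OF R0 that])
    show "(\<lambda>x. A x (z x)) \<in> borel_measurable torus" if "z \<in> K R" for z
      by (rule A_measurable[OF K_D(1)[OF that] K_pos[OF that R0]])
    show "integrable torus (\<lambda>x. \<bar>V x\<bar> + 3 * b)" using V_abs_integrable by auto
    show "AE x in torus. norm (A x (z x)) \<le> \<bar>V x\<bar> + 3 * b" if "z \<in> K R" for z
      using b(2)[OF that]
    proof eventually_elim
      case (elim x)
      then show ?case using norm_triple_le[of "A x (z x)"] b(1) by linarith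
    qed
    show "AE x in torus. 0 \<le> (A x (z x) - A x (w x)) \<bullet> (z x - w x)" if "z \<in> K R" "w \<in> K R" for z w
      using AE_good K_pos[OF that(1) R0] K_pos[OF that(2) R0] by eventually_elim (rule A_monotone)
    show "AE x in torus. ((\<lambda>t. A x ((1 - t) *\<^sub>R z x + t *\<^sub>R w x)) \<longlongrightarrow> A x (z x)) (at_right 0)"
      if "z \<in> K R" "w \<in> K R" for z w
      using AE_good K_pos[OF that(1) R0]
    proof eventually_elim
      case (elim x)
      have "isCont (A x) (z x)"
        by (rule continuous_on_interior[OF A_continuous[OF elim(1)]]) (use elim(2) open_pos in \<open>simp add: interior_open\<close>)
      moreover have "((\<lambda>t. (1 - t) *\<^sub>R z x + t *\<^sub>R w x) \<longlongrightarrow> (1 - 0) *\<^sub>R z x + 0 *\<^sub>R w x) (at_right 0)"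
        by (intro tendsto_intros)
      ultimately show ?case using isCont_tendsto_compose[of "z x" "A x"] by simp
    qed
  qed
qed

section \<open>Estimates uniform in the truncation\<close>

lemma q_gt_1: "q > 1"
  using beta by (simp add: q_def field_simps)

lemma beta_q: "\<beta> * q = \<beta> + 1"
  using beta by (simp add: q_def)

lemma K_pair_integrable:
  assumes R: "R \<ge> 1" and vwz: "v \<in> K R" "w \<in> K R" "z \<in> K R"
  shows "integrable torus (\<lambda>x. A x (v x) \<bullet> (w x - z x))"
proof -
  have R0: "R > 0" using R by simp
  obtain b where b: "b \<ge> 0" "\<And>z. z \<in> K R \<Longrightarrow> AE x in torus. \<bar>fst (A x (z x))\<bar> \<le> \<bar>V x\<bar> + b
     \<and> \<bar>fst (snd (A x (z x)))\<bar> \<le> b \<and> norm (snd (snd (A x (z x)))) \<le> b"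
    using A_component_bounds[OF R] by blast
  define \<rho> where "\<rho> = R + R + R powr (\<beta> / \<alpha>)"
  have \<rho>: "AE x in torus. norm (z x) \<le> \<rho>" if "z \<in> K R" for z
    using K_D(2)[OF that] K_pos[OF that R0]
  proof eventually_elim
    case (elim x)
    then show ?case using norm_triple_le[of "z x"] unfolding \<rho>_def by linarith
  qed
  note [measurable] = A_measurable[OF K_D(1)[OF vwz(1)] K_pos[OF vwz(1) R0]] K_D(1)[OF vwz(2)] K_D(1)[OF vwz(3)]
  show ?thesis
  proof (rule Bochner_Integration.integrable_bound[where f="\<lambda>x. (\<bar>V x\<bar> + 3 * b) * (2 * \<rho>)"])
    show "integrable torus (\<lambda>x. (\<bar>V x\<bar> + 3 * b) * (2 * \<rho>))"
    proof -
      interpret finite_measure "torus :: (real^'n) measure" by (rule finite_measure_torus)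
      show ?thesis using V_abs_integrable by auto
    qed
    show "AE x in torus. norm (A x (v x) \<bullet> (w x - z x)) \<le> norm ((\<bar>V x\<bar> + 3 * b) * (2 * \<rho>))"
      using b(2)[OF vwz(1)] \<rho>[OF vwz(2)] \<rho>[OF vwz(3)]
    proof eventually_elim
      case (elim x)
      have "norm (A x (v x)) \<le> \<bar>V x\<bar> + 3 * b" using norm_triple_le[of "A x (v x)"] elim(1) b(1) by linarith
      moreover have "norm (w x - z x) \<le> 2 * \<rho>" using norm_triangle_ineq4[of "w x" "z x"] elim by linarith
      ultimately have "norm (A x (v x)) * norm (w x - z x) \<le> (\<bar>V x\<bar> + 3 * b) * (2 * \<rho>)"
        using b(1) by (intro mult_mono) auto
      then show ?case using Cauchy_Schwarz_ineq2[of "A x (v x)" "w x - z x"] by auto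
    qed
  qed measurable
qed

text \<open>The terms \<open>m * v\<close>, \<open>C * m\<close> and
  \<open>s * (C * m powr \<beta>)\<close> are each absorbed into a quarter of the coercive term,
  which leaves the last quarter. Here \<open>q\<close> is conjugate to \<open>\<beta> + 1\<close>,
  and \<open>m powr \<beta>\<close> to the power \<open>q\<close> is again
  \<open>m powr (\<beta> + 1)\<close>.\<close>

lemma Young_energy:
  "\<exists>K1\<ge>0. \<forall>m>0. \<forall>v\<ge>0. \<forall>s. 0 \<le> s \<and> s \<le> 2 \<longrightarrow>
     s * (C * (m powr \<beta> + 1)) + C * m + v * (s + m) - (1 / C) * m powr (\<beta> + 1)
       \<le> - (1 / (4 * C)) * m powr (\<beta> + 1) + K1 * (1 + v powr q)"
proof -
  have p: "\<beta> + 1 > 1" "1 / (4 * C) > 0" using beta C by auto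
  have pq: "(\<beta> + 1) / (\<beta> + 1 - 1) = q" by (simp add: q_def)
  obtain Ka where Ka: "Ka \<ge> 0" "\<And>a b. a \<ge> 0 \<Longrightarrow> b \<ge> 0 \<Longrightarrow> a * b \<le> (1 / (4 * C)) * a powr (\<beta> + 1) + Ka * b powr q"
    using Young_eps[OF p] unfolding pq by blast
  obtain Kb where Kb: "Kb \<ge> 0" "\<And>a b. a \<ge> 0 \<Longrightarrow> b \<ge> 0 \<Longrightarrow> a * b \<le> (1 / (4 * C)) * a powr q + Kb * b powr (q / (q - 1))"
    using Young_eps[OF q_gt_1 p(2)] by blast
  define K1 where "K1 = 2 * C + 4 + Ka + Ka * C powr q + Kb * (2 * C) powr (q / (q - 1))"
  show ?thesis
  proof (intro exI[of _ K1] conjI allI impI)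
    show "K1 \<ge> 0" using Ka Kb C by (auto simp: K1_def intro!: add_nonneg_nonneg)
    fix m v s :: real assume m: "0 < m" and v: "0 \<le> v" and s: "0 \<le> s \<and> s \<le> 2"
    let ?M = "m powr (\<beta> + 1)"
    have 1: "m * v \<le> (1 / (4 * C)) * ?M + Ka * v powr q" using Ka(2)[of m v] m v by simp
    have 2: "m * C \<le> (1 / (4 * C)) * ?M + Ka * C powr q" using Ka(2)[of m C] m C by simp
    have 3: "m powr \<beta> * (2 * C) \<le> (1 / (4 * C)) * ?M + Kb * (2 * C) powr (q / (q - 1))"
      using Kb(2)[of "m powr \<beta>" "2 * C"] C by (simp add: powr_powr beta_q)
    have 4: "v \<le> 1 + v powr q"
    proof (cases "v \<le> 1")
      case False
      then have "v powr 1 \<le> v powr q" using q_gt_1 by (intro powr_mono) auto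
      then show ?thesis using v by simp
    qed (use powr_ge_zero[of v q] in linarith)
    have 5: "s * (C * (m powr \<beta> + 1)) \<le> 2 * (C * (m powr \<beta> + 1))"
      using s C by (intro mult_right_mono) auto
    have 6: "v * s \<le> v * 2" using s v by (intro mult_left_mono) auto
    have 7: "(1 / C) * ?M = 4 * ((1 / (4 * C)) * ?M)" by simp
    have 8: "K1 * (1 + v powr q) = K1 + K1 * v powr q" by (simp add: distrib_left)
    have 9: "(2 + Ka) * v powr q \<le> K1 * v powr q"
      using Ka Kb C by (intro mult_right_mono) (auto simp: K1_def)
    have 10: "2 * C + 2 + Ka * C powr q + Kb * (2 * C) powr (q / (q - 1)) \<le> K1"
      using Ka(1) by (simp add: K1_def)
    have "2 * (C * (m powr \<beta> + 1)) = m powr \<beta> * (2 * C) + 2 * C" "v * (s + m) = v * s + m * v"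
      "(2 + Ka) * v powr q = 2 * v powr q + Ka * v powr q" "C * m = m * C"
      by (simp_all add: algebra_simps)
    then show "s * (C * (m powr \<beta> + 1)) + C * m + v * (s + m) - (1 / C) * ?M
       \<le> - (1 / (4 * C)) * ?M + K1 * (1 + v powr q)"
      using 1 2 3 4 5 6 9 10 unfolding 7 8 by linarith
  qed
qed

text \<open>Test functions \<open>(s, 0)\<close> with \<open>s = 2\<close> and \<open>s = 1 / 2\<close>: the factor \<open>1 - s\<close> of the mean of \<open>u\<close>
  has both signs, so the mean is bounded as well.\<close>

lemma energy_bound:
  "\<exists>M\<ge>0. \<forall>R\<ge>2. \<forall>z\<in>K R. (\<forall>w\<in>K R. 0 \<le> (\<integral>x. A x (z x) \<bullet> (w x - z x) \<partial>torus)) \<longrightarrow>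
     \<bar>\<integral>x. fst (snd (z x)) \<partial>torus\<bar> \<le> M \<and> (\<integral>x. \<bar>fst (z x)\<bar> powr (\<beta> + 1) \<partial>torus) \<le> M"
proof -
  interpret finite_measure "torus :: (real^'n) measure" by (rule finite_measure_torus)
  obtain K1 where K1: "K1 \<ge> 0" "\<And>m v s. 0 < m \<Longrightarrow> 0 \<le> v \<Longrightarrow> 0 \<le> s \<Longrightarrow> s \<le> 2 \<Longrightarrow>
     s * (C * (m powr \<beta> + 1)) + C * m + v * (s + m) - (1 / C) * m powr (\<beta> + 1)
       \<le> - (1 / (4 * C)) * m powr (\<beta> + 1) + K1 * (1 + v powr q)"
    using Young_energy by blast
  define K' where "K' = K1 * (1 + (\<integral>x. \<bar>V x\<bar> powr q \<partial>torus))"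
  have Vq: "integrable torus (\<lambda>x. \<bar>V x\<bar> powr q)" using V_int by (simp add: q_def)
  have K'0: "K' \<ge> 0" using K1 by (auto simp: K'_def intro!: mult_nonneg_nonneg add_nonneg_nonneg)
  show ?thesis
  proof (intro exI[of _ "2 * K' + 4 * C * K'"] conjI allI impI ballI)
    show "0 \<le> 2 * K' + 4 * C * K'" using K'0 C by auto
    fix R z assume R: "R \<ge> 2" and z: "z \<in> K R"
      and st: "\<forall>w\<in>K R. 0 \<le> (\<integral>x. A x (z x) \<bullet> (w x - z x) \<partial>torus)"
    have R0: "R > 0" "R \<ge> 1" using R by auto
    define U where "U = (\<integral>x. fst (snd (z x)) \<partial>torus)"
    define I where "I = (\<integral>x. \<bar>fst (z x)\<bar> powr (\<beta> + 1) \<partial>torus)"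
    note wd = torus_weak_gradientD[OF K_D(3)[OF z]]
    have Ii: "integrable torus (\<lambda>x. \<bar>fst (z x)\<bar> powr (\<beta> + 1))"
    proof -
      have b: "AE x in torus. norm (fst (z x)) \<le> R"
        using K_D(2)[OF z] K_pos[OF z R0(1)] by eventually_elim auto
      show ?thesis
        using bounded_powr_integral(1)[OF borel_measurable_components(1)[OF K_D(1)[OF z]] b, of "\<beta> + 1"] beta R0
        by (simp add: real_norm_def)
    qed
    have I0: "I \<ge> 0" unfolding I_def by simp
    have test: "0 \<le> (1 - s) * U - (1 / (4 * C)) * I + K'" if s: "1 / R \<le> s" "0 \<le> s" "s \<le> 2" for s
    proof -
      have w: "(\<lambda>x. (s, 0, 0)) \<in> K R" using s R by (intro K_const) auto
      let ?L = "\<lambda>x. (1 - s) * fst (snd (z x)) - (1 / (4 * C)) * \<bar>fst (z x)\<bar> powr (\<beta> + 1) + K1 * (1 + \<bar>V x\<bar> powr q)"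
      have "0 \<le> (\<integral>x. A x (z x) \<bullet> ((s, 0, 0) - z x) \<partial>torus)" using bspec[OF st w] by simp
      also have "\<dots> \<le> (\<integral>x. ?L x \<partial>torus)"
      proof (rule integral_mono_AE)
        show "integrable torus (\<lambda>x. A x (z x) \<bullet> ((s, 0, 0) - z x))" by (rule K_pair_integrable[OF R0(2) z w z])
        show "integrable torus ?L" using wd(1) Ii Vq by auto
        show "AE x in torus. A x (z x) \<bullet> ((s, 0, 0) - z x) \<le> ?L x"
          using AE_good K_pos[OF z R0(1)]
        proof eventually_elim
          case (elim x)
          obtain m u G where zx: "z x = (m, u, G)" by (cases "z x")
          have m: "m > 0" using elim by (simp add: zx)
          \<comment> \<open>The products of \<open>m\<close> and \<open>u\<close> from the first two
            components cancel. So \<open>u\<close> survives only with the factor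
            \<open>1 - s\<close>, and \<open>m\<close> multiplies the expression bounded by
            \<open>legendre_lower\<close>.\<close>
          have eq: "A x (z x) \<bullet> ((s, 0, 0) - z x)
              = (1 - s) * u - s * H x G m - m * (DpH H x G m \<bullet> G - H x G m) + V x * (s - m)"
            unfolding zx A_def by (simp add: algebra_simps)
          have "(1 / C) * norm G powr \<alpha> \<ge> 0" using C by simp
          then have "- (C * (m powr \<beta> + 1)) \<le> H x G m" using H_lower[OF elim(1) m, of G] by linarith
          then have 1: "s * (- (C * (m powr \<beta> + 1))) \<le> s * H x G m" using s by (intro mult_left_mono)
          have 2: "m * ((1 / C) * m powr \<beta> - C) \<le> m * (DpH H x G m \<bullet> G - H x G m)"
            using legendre_lower[OF elim(1) m, of G] m by (intro mult_left_mono) auto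
          have mm: "m * m powr \<beta> = m powr (\<beta> + 1)" using m by (simp add: powr_add)
          have 22: "m * ((1 / C) * m powr \<beta> - C) = (1 / C) * m powr (\<beta> + 1) - C * m"
            unfolding mm[symmetric] by (simp add: algebra_simps)
          have 3: "V x * (s - m) \<le> \<bar>V x\<bar> * (s + m)"
          proof -
            have "V x * (s - m) \<le> \<bar>V x\<bar> * \<bar>s - m\<bar>" by (metis abs_ge_self abs_mult)
            also have "\<dots> \<le> \<bar>V x\<bar> * (s + m)" using m s by (intro mult_left_mono) auto
            finally show ?thesis .
          qed
          show ?case
            using 1 2[unfolded 22] 3 K1(2)[OF m abs_ge_zero[of "V x"] s(2,3)] m unfolding eq by (simp add: zx)
        qed
      qed
      also have "\<dots> = (1 - s) * U - (1 / (4 * C)) * I + K'"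
        unfolding U_def I_def K'_def using wd(1) Ii Vq by simp
      finally show ?thesis .
    qed
    \<comment> \<open>\<open>R \<ge> 2\<close> makes both constants admissible. The two inequalities
      confine \<open>U\<close> from both sides, and the first plus twice the second eliminates
      \<open>U\<close> and bounds \<open>I\<close>.\<close>
    have t2: "0 \<le> - U - (1 / (4 * C)) * I + K'" using test[of 2] R by (simp add: field_simps)
    have th: "0 \<le> (1 / 2) * U - (1 / (4 * C)) * I + K'" using test[of "1/2"] R by (simp add: field_simps)
    have CI: "(1 / (4 * C)) * I \<ge> 0" using C I0 by simp
    have "\<bar>U\<bar> \<le> 2 * K'" using t2 th CI by linarith
    moreover have "0 \<le> 4 * C * K'" using C K'0 by simp
    ultimately show "\<bar>\<integral>x. fst (snd (z x)) \<partial>torus\<bar> \<le> 2 * K' + 4 * C * K'" by (simp add: U_def)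
    have "(1 / (4 * C)) * I \<le> K'" using t2 th by linarith
    then have "I \<le> 4 * C * K'" using C by (simp add: field_simps)
    then show "(\<integral>x. \<bar>fst (z x)\<bar> powr (\<beta> + 1) \<partial>torus) \<le> 2 * K' + 4 * C * K'" using K'0 by (simp add: I_def)
  qed
qed

text \<open>Varying only the first component of the test function gives \<open>u + H x Du m \<le> V\<close> wherever
  \<open>m < R\<close>; where \<open>m = R\<close> the constraint on the gradient in \<open>K R\<close> takes over.\<close>

lemma gradient_bound:
  assumes R: "R \<ge> 1" and z: "z \<in> K R"
    and st: "\<forall>w\<in>K R. 0 \<le> (\<integral>x. A x (z x) \<bullet> (w x - z x) \<partial>torus)"
  shows "AE x in torus. norm (snd (snd (z x))) powr \<alpha>
     \<le> (C + C * C + 1) * (\<bar>V x\<bar> + \<bar>fst (snd (z x))\<bar> + \<bar>fst (z x)\<bar> powr \<beta> + 1)"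
proof -
  have R0: "R > 0" using R by simp
  let ?g = "\<lambda>x. fst (A x (z x))"
  \<comment> \<open>On \<open>B\<close>, raising \<open>m\<close> to \<open>R\<close> makes the
    pairing strictly negative, so Stampacchia's inequality forces \<open>B\<close> to be a null set.
    The second and third components stay as they are, which keeps the gradient constraint intact
    however local the change.\<close>
  define B where "B x \<longleftrightarrow> fst (z x) < R \<and> ?g x < 0" for x
  define w where "w x = (if B x then R else fst (z x), snd (z x))" for x
  note [measurable] = borel_measurable_components[OF K_D(1)[OF z]]
    borel_measurable_components[OF A_measurable[OF K_D(1)[OF z] K_pos[OF z R0]]]
  have wm: "w \<in> borel_measurable torus"
  proof -
    have [measurable]: "(\<lambda>x. snd (z x)) \<in> borel_measurable torus"
      by (intro borel_measurable_continuous_on[OF _ K_D(1)[OF z]] continuous_intros)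
    have [measurable]: "Measurable.pred torus B" unfolding B_def by measurable
    show ?thesis unfolding w_def by measurable
  qed
  have "1 / R \<le> R" using R by (simp add: field_simps) (use mult_mono[OF R R] in simp)
  then have "AE x in torus. 1 / R \<le> fst (w x) \<and> fst (w x) \<le> R \<and> \<bar>fst (snd (w x))\<bar> \<le> R \<and> norm (snd (snd (w x))) \<le> R powr (\<beta> / \<alpha>)"
    using K_D(2)[OF z] by - (erule eventually_mono, simp add: w_def)
  then have w: "w \<in> K R" using wm K_D(3)[OF z] unfolding K_def by (simp add: w_def)
  let ?h = "\<lambda>x. - (A x (z x) \<bullet> (w x - z x))"
  have h: "?h x = (if B x then - (?g x * (R - fst (z x))) else 0)" for x
    by (simp add: w_def inner_prod_def)
  have h0: "?h x \<ge> 0" for x unfolding h by (auto simp: B_def mult_le_0_iff)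
  have hi: "integrable torus ?h" using K_pair_integrable[OF R z w z] by simp
  have "(\<integral>x. ?h x \<partial>torus) \<le> 0" using st w by simp
  then have "(\<integral>x. ?h x \<partial>torus) = 0" using h0 by (intro antisym Bochner_Integration.integral_nonneg) auto
  then have "AE x in torus. ?h x = 0"
    using integral_nonneg_eq_0_iff_AE[OF hi always_eventually[OF allI[OF h0]]] by simp
  then have nB: "AE x in torus. \<not> B x"
    by eventually_elim (auto simp: h B_def split: if_splits)
  show ?thesis
    using nB K_D(2)[OF z] K_pos[OF z R0] AE_good
  proof eventually_elim
    case (elim x)
    obtain m u G where zx: "z x = (m, u, G)" by (cases "z x")
    have m: "m > 0" "m \<le> R" "norm G \<le> R powr (\<beta> / \<alpha>)" using elim by (auto simp: zx)
    let ?W = "\<bar>V x\<bar> + \<bar>u\<bar> + m powr \<beta> + 1"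
    have W0: "?W \<ge> 0" by (intro add_nonneg_nonneg) auto
    have "norm G powr \<alpha> \<le> (C + C * C + 1) * ?W"
    proof (cases "m < R")
      case True
      then have "0 \<le> - u - H x G m + V x" using elim(1) by (simp add: B_def zx A_def)
      then have "(1 / C) * norm G powr \<alpha> \<le> V x - u + C * (m powr \<beta> + 1)"
        using H_lower[OF elim(4) m(1), of G] by linarith
      then have "norm G powr \<alpha> \<le> C * (V x - u + C * (m powr \<beta> + 1))"
        using C by (simp add: pos_divide_le_eq mult.commute)
      also have "\<dots> = C * (V x - u) + C * C * (m powr \<beta> + 1)" by (simp add: algebra_simps)
      \<comment> \<open>This case accounts for the summands \<open>C\<close> and
        \<open>C * C\<close> of the constant, the case \<open>m = R\<close> for the summand
        1.\<close>
      also have "\<dots> \<le> C * ?W + C * C * ?W"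
      proof (intro add_mono mult_left_mono)
        show "V x - u \<le> ?W" using powr_ge_zero[of m \<beta>] by linarith
      qed (use C in auto)
      also have "\<dots> \<le> (C + C * C + 1) * ?W" using W0 by (simp add: distrib_right)
      finally show ?thesis .
    next
      case False
      then have mR: "m = R" using m by simp
      have "norm G powr \<alpha> \<le> (R powr (\<beta> / \<alpha>)) powr \<alpha>" using m alpha by (intro powr_mono2) auto
      also have "\<dots> = m powr \<beta>" using alpha by (simp add: powr_powr mR)
      also have "\<dots> \<le> 1 * ?W" by simp
      also have "\<dots> \<le> (C + C * C + 1) * ?W" using C W0 by (intro mult_right_mono) auto
      finally show ?thesis .
    qed
    then show ?case using m by (simp add: zx)
  qed
qed

end

section \<open>Inequalities for powers, and the Poincare inequality with the mean on the
  right\<close>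

lemma powr_midpoint:
  fixes a b p :: real
  assumes "a \<ge> 0" "b \<ge> 0" "p \<ge> 1"
  shows "((a + b) / 2) powr p \<le> (a powr p + b powr p) / 2"
proof -
  \<comment> \<open>Convexity is invoked on the open half-line; this estimate settles the case where
    an argument is 0.\<close>
  have half: "(c / 2) powr p \<le> c powr p / 2" if "c \<ge> 0" for c :: real
  proof -
    have "(1 / 2 :: real) powr p \<le> (1 / 2) powr 1" using assms by (intro powr_mono') auto
    then have "c powr p * (1 / 2) powr p \<le> c powr p * (1 / 2)" by (intro mult_left_mono) auto
    then show ?thesis using that by (simp add: powr_divide powr_one_eq_one)
  qed
  show ?thesis
  proof (cases "a = 0 \<or> b = 0")
    case True
    then show ?thesis using half[of a] half[of b] assms by auto
  next
    case False
    then have "convex_on {0<..} (\<lambda>x::real. x powr p)" "a \<in> {0<..}" "b \<in> {0<..}"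
      using powr_convex[OF assms(3)] assms by auto
    from convex_onD[OF this(1), of "1/2" a b] this(2,3) show ?thesis
      by (simp add: field_simps)
  qed
qed

lemma powr_add4_le:
  fixes a b c d p :: real
  assumes "a \<ge> 0" "b \<ge> 0" "c \<ge> 0" "d \<ge> 0" "p \<ge> 0"
  shows "(a + b + c + d) powr p \<le> 4 powr p * (a powr p + b powr p + c powr p + d powr p)"
proof -
  let ?m = "max (max a b) (max c d)"
  have "(a + b + c + d) powr p \<le> (4 * ?m) powr p" using assms by (intro powr_mono2) auto
  also have "\<dots> = 4 powr p * ?m powr p" using assms by (subst powr_mult) auto
  also have "\<dots> \<le> 4 powr p * (a powr p + b powr p + c powr p + d powr p)"
    by (intro mult_left_mono) (auto simp: max_def intro: add_nonneg_nonneg)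
  finally show ?thesis .
qed

lemma integrable_mult_Young:
  fixes f g :: "'a \<Rightarrow> real"
  assumes f: "f \<in> borel_measurable M" "integrable M (\<lambda>x. \<bar>f x\<bar> powr p)"
    and g: "g \<in> borel_measurable M" "integrable M (\<lambda>x. \<bar>g x\<bar> powr (p / (p - 1)))" and p: "p > 1"
  shows "integrable M (\<lambda>x. f x * g x)"
proof -
  note [measurable] = f(1) g(1)
  obtain K where K: "K \<ge> 0" "\<And>a b. a \<ge> 0 \<Longrightarrow> b \<ge> 0 \<Longrightarrow> a * b \<le> 1 * a powr p + K * b powr (p / (p - 1))"
    using Young_eps[OF p, of 1] by auto
  show ?thesis
  proof (rule Bochner_Integration.integrable_bound)
    show "integrable M (\<lambda>x. \<bar>f x\<bar> powr p + K * \<bar>g x\<bar> powr (p / (p - 1)))" using f g by auto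
    have "\<bar>f x * g x\<bar> \<le> \<bar>f x\<bar> powr p + K * \<bar>g x\<bar> powr (p / (p - 1))" for x
      using K(2)[of "\<bar>f x\<bar>" "\<bar>g x\<bar>"] by (simp add: abs_mult)
    then show "AE x in M. norm (f x * g x) \<le> norm (\<bar>f x\<bar> powr p + K * \<bar>g x\<bar> powr (p / (p - 1)))"
      using K(1) by (intro AE_I2) (auto intro: order_trans)
  qed measurable
qed

text \<open>The gradient does not see constants; their contribution is the mean of \<open>u\<close>,
  which \<open>energy_bound\<close> controls.\<close>

lemma torus_Poincare_mean:
  fixes r :: real
  assumes r: "r > 1"
  shows "\<exists>C\<ge>0. \<forall>(u :: real^'n::finite \<Rightarrow> real) G B. torus_weak_gradient u G \<longrightarrow> (AE x in torus. \<bar>u x\<bar> \<le> B) \<longrightarrow>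
     integrable torus (\<lambda>x. norm (G x) powr r) \<longrightarrow>
     (\<integral>x. \<bar>u x\<bar> powr r \<partial>torus) \<le> C * ((\<integral>x. norm (G x) powr r \<partial>torus) + \<bar>\<integral>x. u x \<partial>torus\<bar> powr r)"
proof -
  interpret finite_measure "torus :: (real^'n) measure" by (rule finite_measure_torus)
  obtain C where C: "C \<ge> 0" "\<And>(u :: real^'n \<Rightarrow> real) G B. torus_weak_gradient u G \<Longrightarrow> (AE x in torus. \<bar>u x\<bar> \<le> B) \<Longrightarrow>
     integrable torus (\<lambda>x. norm (G x) powr r) \<Longrightarrow>
     (\<integral>x. \<bar>u x - (\<integral>y. u y \<partial>torus)\<bar> powr r \<partial>torus) \<le> C * (\<integral>x. norm (G x) powr r \<partial>torus)"
    using torus_Poincare[OF r, where 'n='n] by blast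
  show ?thesis
  proof (intro exI[of _ "2 powr r * (C + 1)"] conjI allI impI)
    show "0 \<le> 2 powr r * (C + 1)" using C by simp
    fix u :: "real^'n \<Rightarrow> real" and G B
    assume w: "torus_weak_gradient u G" and B: "AE x in torus. \<bar>u x\<bar> \<le> B" and G: "integrable torus (\<lambda>x. norm (G x) powr r)"
    define U where "U = (\<integral>y. u y \<partial>torus)"
    note [measurable] = borel_measurable_integrable[OF torus_weak_gradientD(1)[OF w]]
    have 1: "AE x in torus. norm (\<bar>u x\<bar> powr r) \<le> B powr r"
      using B by eventually_elim (use r in \<open>auto intro!: powr_mono2\<close>)
    have 2: "AE x in torus. norm (\<bar>u x - U\<bar> powr r) \<le> (B + \<bar>U\<bar>) powr r"
      using B by eventually_elim (use r in \<open>auto intro!: powr_mono2\<close>)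
    have i: "integrable torus (\<lambda>x. \<bar>u x\<bar> powr r)" "integrable torus (\<lambda>x. \<bar>u x - U\<bar> powr r)"
      by (rule integrable_const_bound[OF 1], measurable) (rule integrable_const_bound[OF 2], measurable)
    have "(\<integral>x. \<bar>u x\<bar> powr r \<partial>torus) \<le> (\<integral>x. 2 powr r * (\<bar>u x - U\<bar> powr r + \<bar>U\<bar> powr r) \<partial>torus)"
    proof (rule integral_mono)
      fix x
      have "\<bar>u x\<bar> powr r \<le> (\<bar>u x - U\<bar> + \<bar>U\<bar>) powr r" using r by (intro powr_mono2) auto
      also have "\<dots> \<le> 2 powr r * (\<bar>u x - U\<bar> powr r + \<bar>U\<bar> powr r)" using r by (intro powr_add_le) auto
      finally show "\<bar>u x\<bar> powr r \<le> 2 powr r * (\<bar>u x - U\<bar> powr r + \<bar>U\<bar> powr r)" .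
    qed (use i in auto)
    also have "\<dots> = 2 powr r * ((\<integral>x. \<bar>u x - U\<bar> powr r \<partial>torus) + \<bar>U\<bar> powr r)" using i by simp
    also have "\<dots> \<le> 2 powr r * ((C + 1) * ((\<integral>x. norm (G x) powr r \<partial>torus) + \<bar>U\<bar> powr r))"
    proof (intro mult_left_mono)
      have "0 \<le> C * \<bar>U\<bar> powr r" using C by simp
      moreover have "0 \<le> (\<integral>x. norm (G x) powr r \<partial>torus)" by simp
      ultimately show "(\<integral>x. \<bar>u x - U\<bar> powr r \<partial>torus) + \<bar>U\<bar> powr r \<le> (C + 1) * ((\<integral>x. norm (G x) powr r \<partial>torus) + \<bar>U\<bar> powr r)"
        using C(2)[OF w B G] unfolding U_def distrib_left distrib_right by linarith
    qed auto
    finally show "(\<integral>x. \<bar>u x\<bar> powr r \<partial>torus) \<le> 2 powr r * (C + 1) * ((\<integral>x. norm (G x) powr r \<partial>torus) + \<bar>\<integral>x. u x \<partial>torus\<bar> powr r)"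
      by (simp add: U_def mult.assoc)
  qed
qed

section \<open>Bounds independent of the truncation and the passage to the limit\<close>

context mfg
begin

text \<open>\<open>gradient_bound\<close> estimates the power \<open>\<alpha>\<close> of the
  gradient by \<open>V\<close>, \<open>u\<close> and \<open>m powr \<beta>\<close>. For
  \<open>V\<close> and \<open>m powr \<beta>\<close> the power \<open>q\<close> is integrable, which
  dictates the exponent \<open>\<alpha> * q\<close> for the gradient.\<close>

definition \<gamma> :: real where "\<gamma> = \<alpha> * q"

lemma gamma_gt_1: "\<gamma> > 1"
  unfolding \<gamma>_def using alpha q_gt_1 by (simp add: less_1_mult)

text \<open>Bounded sets in the space of the final solution. In contrast to \<open>K R\<close> they
  carry no pointwise bounds; they are closed under a.e. limits by Fatou's lemma and
  \<open>weak_gradient_closed\<close>.\<close>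

definition Z :: "real \<Rightarrow> (real^'n \<Rightarrow> real \<times> real \<times> (real^'n)) set" where
  "Z M = {z. z \<in> borel_measurable torus
     \<and> integrable torus (\<lambda>x. \<bar>fst (z x)\<bar> powr (\<beta> + 1)) \<and> (\<integral>x. \<bar>fst (z x)\<bar> powr (\<beta> + 1) \<partial>torus) \<le> M
     \<and> integrable torus (\<lambda>x. \<bar>fst (snd (z x))\<bar> powr \<gamma>) \<and> (\<integral>x. \<bar>fst (snd (z x))\<bar> powr \<gamma> \<partial>torus) \<le> M
     \<and> integrable torus (\<lambda>x. norm (snd (snd (z x))) powr \<gamma>) \<and> (\<integral>x. norm (snd (snd (z x))) powr \<gamma> \<partial>torus) \<le> M
     \<and> torus_weak_gradient (\<lambda>x. fst (snd (z x))) (\<lambda>x. snd (snd (z x)))}"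

lemma Z_D:
  assumes "z \<in> Z M"
  shows "z \<in> borel_measurable torus"
    "integrable torus (\<lambda>x. \<bar>fst (z x)\<bar> powr (\<beta> + 1))" "(\<integral>x. \<bar>fst (z x)\<bar> powr (\<beta> + 1) \<partial>torus) \<le> M"
    "integrable torus (\<lambda>x. \<bar>fst (snd (z x))\<bar> powr \<gamma>)" "(\<integral>x. \<bar>fst (snd (z x))\<bar> powr \<gamma> \<partial>torus) \<le> M"
    "integrable torus (\<lambda>x. norm (snd (snd (z x))) powr \<gamma>)" "(\<integral>x. norm (snd (snd (z x))) powr \<gamma> \<partial>torus) \<le> M"
    "torus_weak_gradient (\<lambda>x. fst (snd (z x))) (\<lambda>x. snd (snd (z x)))"
  using assms by (auto simp: Z_def)

lemma K_AE_bounds: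
  assumes "z \<in> K R" "R > 0"
  shows "AE x in torus. norm (fst (z x)) \<le> R" "AE x in torus. norm (fst (snd (z x))) \<le> R"
    "AE x in torus. norm (snd (snd (z x))) \<le> R powr (\<beta> / \<alpha>)"
proof -
  show "AE x in torus. norm (fst (z x)) \<le> R"
    using K_D(2)[OF assms(1)] K_pos[OF assms] by eventually_elim auto
  show "AE x in torus. norm (fst (snd (z x))) \<le> R" "AE x in torus. norm (snd (snd (z x))) \<le> R powr (\<beta> / \<alpha>)"
    by (rule eventually_mono[OF K_D(2)[OF assms(1)]], force)+
qed

lemma K_integrable_powr:
  assumes z: "z \<in> K R" "R > 0" and p: "p > 0"
  shows "integrable torus (\<lambda>x. \<bar>fst (z x)\<bar> powr p)" "integrable torus (\<lambda>x. \<bar>fst (snd (z x))\<bar> powr p)"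
    "integrable torus (\<lambda>x. norm (snd (snd (z x))) powr p)"
proof -
  note c = borel_measurable_components[OF K_D(1)[OF z(1)]] and b = K_AE_bounds[OF z]
  show "integrable torus (\<lambda>x. \<bar>fst (z x)\<bar> powr p)"
    using bounded_powr_integral(1)[OF c(1) b(1) p] z by (simp only: real_norm_def)
  show "integrable torus (\<lambda>x. \<bar>fst (snd (z x))\<bar> powr p)"
    using bounded_powr_integral(1)[OF c(2) b(2) p] z by (simp only: real_norm_def)
  show "integrable torus (\<lambda>x. norm (snd (snd (z x))) powr p)"
    using bounded_powr_integral(1)[OF c(3) b(3) p] by simp
qed

lemma K_subset_Z:
  assumes "z \<in> K R" "R > 0"
  shows "\<exists>M. z \<in> Z M"
proof -
  let ?a = "\<integral>x. \<bar>fst (z x)\<bar> powr (\<beta> + 1) \<partial>torus" and ?b = "\<integral>x. \<bar>fst (snd (z x))\<bar> powr \<gamma> \<partial>torus"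
    and ?c = "\<integral>x. norm (snd (snd (z x))) powr \<gamma> \<partial>torus"
  have "z \<in> Z (max ?a (max ?b ?c))"
    unfolding Z_def using K_D[OF assms(1)] K_integrable_powr[OF assms] beta gamma_gt_1 by (simp add: le_max_iff_disj)
  then show ?thesis by blast
qed

text \<open>The bound on the gradient is superlinear in it, \<open>\<alpha> > 1\<close>, whereas the Poincare inequality
  bounds \<open>u\<close> linearly by the gradient; so the estimate closes.\<close>

lemma uniform_bound:
  "\<exists>M. \<forall>R\<ge>2. \<forall>z\<in>K R. (\<forall>w\<in>K R. 0 \<le> (\<integral>x. A x (z x) \<bullet> (w x - z x) \<partial>torus)) \<longrightarrow> z \<in> Z M"
proof -
  interpret finite_measure "torus :: (real^'n) measure" by (rule finite_measure_torus)
  obtain M1 where M1: "M1 \<ge> 0" "\<And>R z. R \<ge> 2 \<Longrightarrow> z \<in> K R \<Longrightarrow> \<forall>w\<in>K R. 0 \<le> (\<integral>x. A x (z x) \<bullet> (w x - z x) \<partial>torus) \<Longrightarrow>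
     \<bar>\<integral>x. fst (snd (z x)) \<partial>torus\<bar> \<le> M1 \<and> (\<integral>x. \<bar>fst (z x)\<bar> powr (\<beta> + 1) \<partial>torus) \<le> M1"
    using energy_bound by blast
  obtain Cq where Cq: "Cq \<ge> 0" "\<And>(u :: real^'n \<Rightarrow> real) G B. torus_weak_gradient u G \<Longrightarrow> (AE x in torus. \<bar>u x\<bar> \<le> B) \<Longrightarrow>
     integrable torus (\<lambda>x. norm (G x) powr q) \<Longrightarrow>
     (\<integral>x. \<bar>u x\<bar> powr q \<partial>torus) \<le> Cq * ((\<integral>x. norm (G x) powr q \<partial>torus) + \<bar>\<integral>x. u x \<partial>torus\<bar> powr q)"
    using torus_Poincare_mean[OF q_gt_1, where 'n='n] by blast
  obtain Cg where Cg: "Cg \<ge> 0" "\<And>(u :: real^'n \<Rightarrow> real) G B. torus_weak_gradient u G \<Longrightarrow> (AE x in torus. \<bar>u x\<bar> \<le> B) \<Longrightarrow>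
     integrable torus (\<lambda>x. norm (G x) powr \<gamma>) \<Longrightarrow>
     (\<integral>x. \<bar>u x\<bar> powr \<gamma> \<partial>torus) \<le> Cg * ((\<integral>x. norm (G x) powr \<gamma> \<partial>torus) + \<bar>\<integral>x. u x \<partial>torus\<bar> powr \<gamma>)"
    using torus_Poincare_mean[OF gamma_gt_1, where 'n='n] by blast
  define C2 where "C2 = C + C * C + 1"
  define C3 where "C3 = C2 powr q * 4 powr q"
  have C2: "C2 > 0" using C by (simp add: C2_def add_pos_pos)
  have C3: "C3 \<ge> 0" by (simp add: C3_def)
  define c where "c = C3 * Cq"
  have c: "c \<ge> 0" using C3 Cq by (simp add: c_def)
  \<comment> \<open>\<open>c\<close> is the factor with which the gradient returns through the
    Poincare inequality; \<open>c * \<epsilon> \<le> 1 / 2\<close> lets this contribution be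
    absorbed, leaving \<open>X \<le> 2 * D\<close>.\<close>
  define \<epsilon> where "\<epsilon> = 1 / (2 * (c + 1))"
  have \<epsilon>: "\<epsilon> > 0" using c by (simp add: \<epsilon>_def)
  have c\<epsilon>: "c * \<epsilon> \<le> 1 / 2" using c by (simp add: \<epsilon>_def field_simps)
  obtain Ke where Ke: "Ke \<ge> 0" "\<And>a b. a \<ge> 0 \<Longrightarrow> b \<ge> 0 \<Longrightarrow> a * b \<le> \<epsilon> * a powr \<alpha> + Ke * b powr (\<alpha> / (\<alpha> - 1))"
    using Young_eps[OF alpha \<epsilon>] by blast
  define IV where "IV = (\<integral>x. \<bar>V x\<bar> powr q \<partial>torus)"
  have Vq: "integrable torus (\<lambda>x. \<bar>V x\<bar> powr q)" using V_int by (simp add: q_def)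
  define D where "D = C3 * (IV + M1 + 1) + c * (Ke + M1 powr q)"
  define M where "M = M1 + 2 * D + Cg * (2 * D + M1 powr \<gamma>)"
  have IV0: "IV \<ge> 0" by (simp add: IV_def)
  have D0: "D \<ge> 0" using C3 IV0 M1 c Ke by (simp add: D_def)
  have M_ge: "M1 \<le> M" "2 * D \<le> M" "Cg * (2 * D + M1 powr \<gamma>) \<le> M" using M1 D0 Cg by (auto simp: M_def)
  show ?thesis
  proof (intro exI[of _ M] allI impI ballI)
    fix R z assume R: "R \<ge> 2" and z: "z \<in> K R"
      and st: "\<forall>w\<in>K R. 0 \<le> (\<integral>x. A x (z x) \<bullet> (w x - z x) \<partial>torus)"
    have R0: "R > 0" "R \<ge> 1" using R by auto
    define U where "U = (\<integral>x. fst (snd (z x)) \<partial>torus)"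
    have U: "\<bar>U\<bar> \<le> M1" and I: "(\<integral>x. \<bar>fst (z x)\<bar> powr (\<beta> + 1) \<partial>torus) \<le> M1"
      using M1(2)[OF R z st] by (auto simp: U_def)
    note int = K_integrable_powr[OF z R0(1)]
    have pos: "q > 0" "\<beta> + 1 > 0" "\<gamma> > 0" "\<beta> > 0" using q_gt_1 beta gamma_gt_1 by auto
    have ub: "AE x in torus. \<bar>fst (snd (z x))\<bar> \<le> R" using K_AE_bounds(2)[OF z R0(1)] by simp
    define X where "X = (\<integral>x. norm (snd (snd (z x))) powr \<gamma> \<partial>torus)"
    \<comment> \<open>Young's inequality with second factor 1: as
      \<open>\<gamma> = \<alpha> * q\<close> and \<open>\<alpha> > 1\<close>, the power
      \<open>q\<close> costs only a small multiple of the power \<open>\<gamma>\<close> and a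
      constant.\<close>
    have Gq: "(\<integral>x. norm (snd (snd (z x))) powr q \<partial>torus) \<le> \<epsilon> * X + Ke"
    proof -
      have "(\<integral>x. norm (snd (snd (z x))) powr q \<partial>torus) \<le> (\<integral>x. \<epsilon> * norm (snd (snd (z x))) powr \<gamma> + Ke \<partial>torus)"
      proof (rule integral_mono)
        show "norm (snd (snd (z x))) powr q \<le> \<epsilon> * norm (snd (snd (z x))) powr \<gamma> + Ke" for x
          using Ke(2)[of "norm (snd (snd (z x))) powr q" 1] by (simp add: powr_powr \<gamma>_def mult.commute)
      qed (use int pos in auto)
      then show ?thesis using int(3)[OF pos(3)] by (simp add: X_def)
    qed
    have uq: "(\<integral>x. \<bar>fst (snd (z x))\<bar> powr q \<partial>torus) \<le> Cq * (\<epsilon> * X + Ke + M1 powr q)"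
    proof -
      have "\<bar>U\<bar> powr q \<le> M1 powr q" using U pos by (intro powr_mono2) auto
      then have "Cq * ((\<integral>x. norm (snd (snd (z x))) powr q \<partial>torus) + \<bar>U\<bar> powr q) \<le> Cq * (\<epsilon> * X + Ke + M1 powr q)"
        using Gq Cq(1) by (intro mult_left_mono) auto
      then show ?thesis using Cq(2)[OF K_D(3)[OF z] ub int(3)[OF pos(1)]] by (simp add: U_def)
    qed
    have "X \<le> (\<integral>x. C3 * (\<bar>V x\<bar> powr q + \<bar>fst (snd (z x))\<bar> powr q + \<bar>fst (z x)\<bar> powr (\<beta> + 1) + 1) \<partial>torus)"
      unfolding X_def
    proof (rule integral_mono_AE)
      show "AE x in torus. norm (snd (snd (z x))) powr \<gamma> \<le> C3 * (\<bar>V x\<bar> powr q + \<bar>fst (snd (z x))\<bar> powr q + \<bar>fst (z x)\<bar> powr (\<beta> + 1) + 1)"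
        using gradient_bound[OF R0(2) z st]
      proof eventually_elim
        case (elim x)
        let ?W = "\<bar>V x\<bar> + \<bar>fst (snd (z x))\<bar> + \<bar>fst (z x)\<bar> powr \<beta> + 1"
        have "norm (snd (snd (z x))) powr \<gamma> = (norm (snd (snd (z x))) powr \<alpha>) powr q"
          by (simp add: powr_powr \<gamma>_def)
        also have "\<dots> \<le> (C2 * ?W) powr q"
          using elim pos by (intro powr_mono2) (auto simp: C2_def)
        also have "\<dots> = C2 powr q * ?W powr q" using C2 by (subst powr_mult) auto
        also have "\<dots> \<le> C2 powr q * (4 powr q * (\<bar>V x\<bar> powr q + \<bar>fst (snd (z x))\<bar> powr q + (\<bar>fst (z x)\<bar> powr \<beta>) powr q + 1 powr q))"
          using pos by (intro mult_left_mono powr_add4_le) auto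
        finally show ?case by (simp add: C3_def powr_powr beta_q mult.assoc)
      qed
    qed (use int pos Vq in auto)
    also have "\<dots> = C3 * (IV + (\<integral>x. \<bar>fst (snd (z x))\<bar> powr q \<partial>torus) + (\<integral>x. \<bar>fst (z x)\<bar> powr (\<beta> + 1) \<partial>torus) + 1)"
      using int(1)[OF pos(2)] int(2)[OF pos(1)] Vq by (simp add: IV_def)
    also have "\<dots> \<le> C3 * (IV + Cq * (\<epsilon> * X + Ke + M1 powr q) + M1 + 1)"
      using uq I C3 by (intro mult_left_mono) auto
    also have "\<dots> = D + (c * \<epsilon>) * X" by (simp add: D_def c_def algebra_simps)
    also have "\<dots> \<le> D + (1 / 2) * X"
      using c\<epsilon> by (intro add_left_mono mult_right_mono) (auto simp: X_def)
    finally have X: "X \<le> 2 * D" by simp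
    have "(\<integral>x. \<bar>fst (snd (z x))\<bar> powr \<gamma> \<partial>torus) \<le> Cg * (X + \<bar>U\<bar> powr \<gamma>)"
      using Cg(2)[OF K_D(3)[OF z] ub int(3)[OF pos(3)]] by (simp add: U_def X_def)
    also have "\<dots> \<le> Cg * (2 * D + M1 powr \<gamma>)"
      using X U Cg(1) pos by (intro mult_left_mono add_mono powr_mono2) auto
    finally have ug: "(\<integral>x. \<bar>fst (snd (z x))\<bar> powr \<gamma> \<partial>torus) \<le> M" using M_ge by linarith
    show "z \<in> Z M"
      unfolding Z_def using K_D[OF z] int pos I ug X M_ge by (simp add: X_def)
  qed
qed

text \<open>At a fixed test triple the first component of \<open>A\<close> grows at most like
  \<open>V\<close>, so its power \<open>q\<close> is integrable, and \<open>q\<close> is dual to the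
  exponent \<open>\<beta> + 1\<close> of the density. The other components are bounded.\<close>

lemma A_pair_integrable:
  assumes R: "R \<ge> 1" and w: "w \<in> K R" and z: "z \<in> Z M"
  shows "integrable torus (\<lambda>x. A x (w x) \<bullet> z x)"
    and "integrable torus (\<lambda>x. \<bar>fst (A x (w x))\<bar> powr q)"
proof -
  interpret finite_measure "torus :: (real^'n) measure" by (rule finite_measure_torus)
  have R0: "R > 0" using R by simp
  obtain b where b: "b \<ge> 0" "AE x in torus. \<bar>fst (A x (w x))\<bar> \<le> \<bar>V x\<bar> + b
     \<and> \<bar>fst (snd (A x (w x)))\<bar> \<le> b \<and> norm (snd (snd (A x (w x)))) \<le> b"
    using A_component_bounds[OF R] w by blast
  note Am = A_measurable[OF K_D(1)[OF w] K_pos[OF w R0]]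
  note [measurable] = borel_measurable_components[OF Am] borel_measurable_components[OF Z_D(1)[OF z]]
  show aq: "integrable torus (\<lambda>x. \<bar>fst (A x (w x))\<bar> powr q)"
  proof (rule Bochner_Integration.integrable_bound)
    show "integrable torus (\<lambda>x. 2 powr q * (\<bar>V x\<bar> powr q + b powr q))"
      using V_int by (auto simp: q_def)
    show "AE x in torus. norm (\<bar>fst (A x (w x))\<bar> powr q) \<le> norm (2 powr q * (\<bar>V x\<bar> powr q + b powr q))"
      using b(2)
    proof eventually_elim
      case (elim x)
      have "\<bar>fst (A x (w x))\<bar> powr q \<le> (\<bar>V x\<bar> + b) powr q" using elim q_gt_1 by (intro powr_mono2) auto
      also have "\<dots> \<le> 2 powr q * (\<bar>V x\<bar> powr q + b powr q)" using b(1) q_gt_1 by (intro powr_add_le) auto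
      finally show ?case by simp
    qed
  qed measurable
  note wd = torus_weak_gradientD[OF Z_D(8)[OF z]]
  have 1: "integrable torus (\<lambda>x. fst (z x) * fst (A x (w x)))"
    by (rule integrable_mult_Young[where p="\<beta> + 1"]) (use aq Z_D(2)[OF z] beta in \<open>auto simp: q_def\<close>)
  have 2: "integrable torus (\<lambda>x. fst (snd (A x (w x))) * fst (snd (z x)))"
  proof (rule Bochner_Integration.integrable_bound[where f="\<lambda>x. b * \<bar>fst (snd (z x))\<bar>"])
    show "AE x in torus. norm (fst (snd (A x (w x))) * fst (snd (z x))) \<le> norm (b * \<bar>fst (snd (z x))\<bar>)"
      using b(2) by eventually_elim (use b(1) in \<open>auto simp: abs_mult intro!: mult_right_mono\<close>)
  qed (use wd in auto)
  have 3: "integrable torus (\<lambda>x. snd (snd (A x (w x))) \<bullet> snd (snd (z x)))"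
  proof (rule Bochner_Integration.integrable_bound[where f="\<lambda>x. b * norm (snd (snd (z x)))"])
    show "AE x in torus. norm (snd (snd (A x (w x))) \<bullet> snd (snd (z x))) \<le> norm (b * norm (snd (snd (z x))))"
      using b(2)
    proof eventually_elim
      case (elim x)
      have "norm (snd (snd (A x (w x))) \<bullet> snd (snd (z x))) \<le> norm (snd (snd (A x (w x)))) * norm (snd (snd (z x)))"
        using Cauchy_Schwarz_ineq2 by auto
      also have "\<dots> \<le> b * norm (snd (snd (z x)))" using elim by (intro mult_right_mono) auto
      finally show ?case using b(1) by simp
    qed
  qed (use wd in auto)
  have "A x (w x) \<bullet> z x = fst (z x) * fst (A x (w x)) + (fst (snd (A x (w x))) * fst (snd (z x)) + snd (snd (A x (w x))) \<bullet> snd (snd (z x)))" for x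
    by (simp add: inner_prod_def mult.commute)
  then show "integrable torus (\<lambda>x. A x (w x) \<bullet> z x)" using 1 2 3 by auto
qed

lemma A_diff_integrable:
  assumes R: "R \<ge> 1" and w: "w \<in> K R" and z: "z \<in> Z M"
  shows "integrable torus (\<lambda>x. A x (w x) \<bullet> (w x - z x))"
proof -
  obtain M' where "w \<in> Z M'" using K_subset_Z[OF w] R by auto
  from Bochner_Integration.integrable_diff[OF A_pair_integrable(1)[OF R w this] A_pair_integrable(1)[OF R w z]]
  show ?thesis by (simp add: inner_diff_right)
qed

lemma Z_closed:
  assumes zs: "\<And>k::nat. zs k \<in> Z M" and z: "z \<in> borel_measurable torus"
    and lim: "AE x in torus. (\<lambda>k. zs k x) \<longlonglongrightarrow> z x"
  shows "z \<in> Z M"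
proof -
  note cs = borel_measurable_components[OF Z_D(1)[OF zs]] and c = borel_measurable_components[OF z]
  have l: "AE x in torus. (\<lambda>k. fst (zs k x)) \<longlonglongrightarrow> fst (z x)"
    "AE x in torus. (\<lambda>k. fst (snd (zs k x))) \<longlonglongrightarrow> fst (snd (z x))"
    "AE x in torus. (\<lambda>k. snd (snd (zs k x))) \<longlonglongrightarrow> snd (snd (z x))"
    using lim by (auto elim!: eventually_mono intro: tendsto_fst tendsto_snd)
  have pos: "\<beta> + 1 > 0" "\<gamma> > 0" using beta gamma_gt_1 by auto
  note D = Z_D[OF zs]
  note 1 = Fatou_powr[OF cs(1) c(1) D(2)[folded real_norm_def] D(3)[folded real_norm_def] l(1) pos(1), unfolded real_norm_def]
  note 2 = Fatou_powr[OF cs(2) c(2) D(4)[folded real_norm_def] D(5)[folded real_norm_def] l(2) pos(2), unfolded real_norm_def]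
  note 3 = Fatou_powr[OF cs(3) c(3) D(6) D(7) l(3) pos(2)]
  have "torus_weak_gradient (\<lambda>x. fst (snd (z x))) (\<lambda>x. snd (snd (z x)))"
    by (rule weak_gradient_closed[OF D(8) gamma_gt_1 c(2,3) D(4,5,6,7) l(2,3)])
  then show ?thesis using 1 2 3 z by (simp add: Z_def)
qed

text \<open>Since the test triple is fixed, the three component differences are integrated against
  weights in the dual exponents; bounded norms and a.e. convergence then suffice, by
  \<open>Lp_bounded_ae_lim_weighted\<close>.\<close>

lemma Z_pair_limit:
  assumes R: "R \<ge> 1" and w: "w \<in> K R" and zs: "\<And>k::nat. zs k \<in> Z M" and z: "z \<in> Z M"
    and lim: "AE x in torus. (\<lambda>k. zs k x) \<longlonglongrightarrow> z x"
  shows "(\<lambda>k. \<integral>x. A x (w x) \<bullet> (w x - zs k x) \<partial>torus) \<longlonglongrightarrow> (\<integral>x. A x (w x) \<bullet> (w x - z x) \<partial>torus)"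
proof -
  interpret finite_measure "torus :: (real^'n) measure" by (rule finite_measure_torus)
  have R0: "R > 0" using R by simp
  obtain b where b: "b \<ge> 0" "AE x in torus. \<bar>fst (A x (w x))\<bar> \<le> \<bar>V x\<bar> + b
     \<and> \<bar>fst (snd (A x (w x)))\<bar> \<le> b \<and> norm (snd (snd (A x (w x)))) \<le> b"
    using A_component_bounds[OF R] w by blast
  note Am = A_measurable[OF K_D(1)[OF w] K_pos[OF w R0]]
  note cA = borel_measurable_components[OF Am]
  note cs = borel_measurable_components[OF Z_D(1)[OF zs]] and c = borel_measurable_components[OF Z_D(1)[OF z]]
  have l: "AE x in torus. (\<lambda>k. fst (zs k x)) \<longlonglongrightarrow> fst (z x)"
    "AE x in torus. (\<lambda>k. fst (snd (zs k x))) \<longlonglongrightarrow> fst (snd (z x))"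
    "AE x in torus. (\<lambda>k. snd (snd (zs k x))) \<longlonglongrightarrow> snd (snd (z x))"
    using lim by (auto elim!: eventually_mono intro: tendsto_fst tendsto_snd)
  have p: "\<beta> + 1 > 1" using beta by simp
  note D = Z_D[OF zs]
  have aq: "integrable torus (\<lambda>x. \<bar>fst (A x (w x))\<bar> powr ((\<beta> + 1) / (\<beta> + 1 - 1)))"
    using A_pair_integrable(2)[OF R w z] by (simp add: q_def)
  have g: "(\<lambda>x. b) \<in> borel_measurable torus" "integrable torus (\<lambda>x::real^'n. \<bar>b\<bar> powr (\<gamma> / (\<gamma> - 1)))" by auto
  note 1 = Lp_bounded_ae_lim_weighted[OF cs(1) c(1) D(2)[folded real_norm_def] D(3)[folded real_norm_def] l(1) p cA(1) aq]
  note 2 = Lp_bounded_ae_lim_weighted[OF cs(2) c(2) D(4)[folded real_norm_def] D(5)[folded real_norm_def] l(2) gamma_gt_1 g]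
  note 3 = Lp_bounded_ae_lim_weighted[OF cs(3) c(3) D(6) D(7) l(3) gamma_gt_1 g]
  let ?e = "\<lambda>k. (\<integral>x. norm (fst (zs k x) - fst (z x)) * \<bar>fst (A x (w x))\<bar> \<partial>torus)
     + (\<integral>x. norm (fst (snd (zs k x)) - fst (snd (z x))) * \<bar>b\<bar> \<partial>torus)
     + (\<integral>x. norm (snd (snd (zs k x)) - snd (snd (z x))) * \<bar>b\<bar> \<partial>torus)"
  have e: "?e \<longlonglongrightarrow> 0" using tendsto_add[OF tendsto_add[OF 1(1) 2(1)] 3(1)] by simp
  have "\<bar>(\<integral>x. A x (w x) \<bullet> (w x - zs k x) \<partial>torus) - (\<integral>x. A x (w x) \<bullet> (w x - z x) \<partial>torus)\<bar> \<le> ?e k" for k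
  proof -
    let ?r = "\<lambda>x. norm (fst (zs k x) - fst (z x)) * \<bar>fst (A x (w x))\<bar>
     + norm (fst (snd (zs k x)) - fst (snd (z x))) * \<bar>b\<bar> + norm (snd (snd (zs k x)) - snd (snd (z x))) * \<bar>b\<bar>"
    note i = A_diff_integrable[OF R w zs[of k]] A_diff_integrable[OF R w z]
    have "(\<integral>x. A x (w x) \<bullet> (w x - zs k x) \<partial>torus) - (\<integral>x. A x (w x) \<bullet> (w x - z x) \<partial>torus)
        = (\<integral>x. A x (w x) \<bullet> (w x - zs k x) - A x (w x) \<bullet> (w x - z x) \<partial>torus)"
      using i by simp
    also have "\<bar>\<dots>\<bar> \<le> (\<integral>x. \<bar>A x (w x) \<bullet> (w x - zs k x) - A x (w x) \<bullet> (w x - z x)\<bar> \<partial>torus)"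
      by (rule integral_abs_bound)
    also have "\<dots> \<le> (\<integral>x. ?r x \<partial>torus)"
    proof (rule integral_mono_AE)
      show "integrable torus ?r" using 1(2) 2(2) 3(2) by auto
      show "AE x in torus. \<bar>A x (w x) \<bullet> (w x - zs k x) - A x (w x) \<bullet> (w x - z x)\<bar> \<le> ?r x"
        using b(2)
      proof eventually_elim
        case (elim x)
        let ?a = "fst (A x (w x))" and ?b = "fst (snd (A x (w x)))" and ?c = "snd (snd (A x (w x)))"
        let ?m = "fst (zs k x) - fst (z x)" and ?u = "fst (snd (zs k x)) - fst (snd (z x))" and ?G = "snd (snd (zs k x)) - snd (snd (z x))"
        have eq: "A x (w x) \<bullet> (w x - zs k x) - A x (w x) \<bullet> (w x - z x) = - (?a * ?m + ?b * ?u + ?c \<bullet> ?G)"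
          by (simp add: inner_prod_def algebra_simps)
        have "\<bar>?a * ?m\<bar> = norm ?m * \<bar>?a\<bar>" by (simp add: abs_mult)
        moreover have "\<bar>?b * ?u\<bar> \<le> norm ?u * \<bar>b\<bar>"
          using elim b(1) by (simp add: abs_mult mult.commute[of _ b] mult_right_mono)
        moreover have "\<bar>?c \<bullet> ?G\<bar> \<le> norm ?G * \<bar>b\<bar>"
        proof -
          have "\<bar>?c \<bullet> ?G\<bar> \<le> norm ?c * norm ?G" by (rule Cauchy_Schwarz_ineq2)
          also have "\<dots> \<le> b * norm ?G" using elim by (intro mult_right_mono) auto
          finally show ?thesis using b(1) by (simp add: mult.commute)
        qed
        ultimately show ?case unfolding eq by linarith
      qed
    qed (use i in auto)
    also have "\<dots> = ?e k" using 1(2)[of k] 2(2)[of k] 3(2)[of k] by simp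
    finally show ?thesis .
  qed
  then have "(\<lambda>k. (\<integral>x. A x (w x) \<bullet> (w x - zs k x) \<partial>torus) - (\<integral>x. A x (w x) \<bullet> (w x - z x) \<partial>torus)) \<longlonglongrightarrow> 0"
    by (intro Lim_null_comparison[OF always_eventually e]) auto
  then show ?thesis by (simp add: LIM_zero_iff)
qed

lemma Z_midpoint:
  assumes z: "z \<in> Z M" and w: "w \<in> Z M"
  shows "(\<lambda>x. (1/2) *\<^sub>R (z x + w x)) \<in> Z M"
proof -
  have mid: "integrable torus (\<lambda>x. norm ((1/2) *\<^sub>R (f x + g x)) powr p)
      \<and> (\<integral>x. norm ((1/2) *\<^sub>R (f x + g x)) powr p \<partial>torus) \<le> M"
    if m: "f \<in> borel_measurable torus" "g \<in> borel_measurable torus"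
      and f: "integrable torus (\<lambda>x. norm (f x) powr p)" "(\<integral>x. norm (f x) powr p \<partial>torus) \<le> M"
      and g: "integrable torus (\<lambda>x. norm (g x) powr p)" "(\<integral>x. norm (g x) powr p \<partial>torus) \<le> M" and p: "p \<ge> 1"
    for f g :: "real^'n \<Rightarrow> 'c::euclidean_space" and p
  proof -
    note [measurable] = m
    have le: "norm ((1/2) *\<^sub>R (f x + g x)) powr p \<le> (norm (f x) powr p + norm (g x) powr p) / 2" for x
    proof -
      have "norm ((1/2) *\<^sub>R (f x + g x)) powr p \<le> ((norm (f x) + norm (g x)) / 2) powr p"
        using p norm_triangle_ineq[of "f x" "g x"] by (intro powr_mono2) auto
      also have "\<dots> \<le> (norm (f x) powr p + norm (g x) powr p) / 2" using p by (intro powr_midpoint) auto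
      finally show ?thesis .
    qed
    have i: "integrable torus (\<lambda>x. norm ((1/2) *\<^sub>R (f x + g x)) powr p)"
      by (rule Bochner_Integration.integrable_bound[where f="\<lambda>x. (norm (f x) powr p + norm (g x) powr p) / 2"])
         (use f g le in auto)
    have "(\<integral>x. norm ((1/2) *\<^sub>R (f x + g x)) powr p \<partial>torus) \<le> (\<integral>x. (norm (f x) powr p + norm (g x) powr p) / 2 \<partial>torus)"
      by (rule integral_mono[OF i _ le]) (use f g in auto)
    also have "\<dots> \<le> M" using f g by simp
    finally show ?thesis using i by simp
  qed
  note D = Z_D[OF z] and E = Z_D[OF w]
  note cz = borel_measurable_components[OF D(1)] and cw = borel_measurable_components[OF E(1)]
  have p: "\<beta> + 1 \<ge> 1" "\<gamma> \<ge> 1" using beta gamma_gt_1 by auto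
  note 1 = mid[OF cz(1) cw(1) D(2,3)[folded real_norm_def] E(2,3)[folded real_norm_def] p(1)]
  note 2 = mid[OF cz(2) cw(2) D(4,5)[folded real_norm_def] E(4,5)[folded real_norm_def] p(2)]
  note 3 = mid[OF cz(3) cw(3) D(6,7) E(6,7) p(2)]
  have 4: "torus_weak_gradient (\<lambda>x. (1/2) * fst (snd (z x)) + (1/2) * fst (snd (w x))) (\<lambda>x. (1/2) *\<^sub>R snd (snd (z x)) + (1/2) *\<^sub>R snd (snd (w x)))"
    by (rule torus_weak_gradient_lincomb[OF D(8) E(8)])
  have "(\<lambda>x. (1/2) *\<^sub>R (z x + w x)) \<in> borel_measurable torus" using D(1) E(1) by measurable
  then show ?thesis using 1 2 3 4 unfolding Z_def by (simp add: scaleR_add_right distrib_left)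
qed

lemma Z_norm_integral:
  assumes z: "z \<in> Z M"
  shows "integrable torus z" "(\<integral>x. norm (z x) \<partial>torus) \<le> 3 + 3 * M"
proof -
  interpret finite_measure "torus :: (real^'n) measure" by (rule finite_measure_torus)
  note D = Z_D[OF z]
  note [measurable] = D(1)
  have le1: "t \<le> 1 + t powr p" if "t \<ge> 0" "p \<ge> 1" for t p :: real
  proof (cases "t \<le> 1")
    case False
    then have "t powr 1 \<le> t powr p" using that by (intro powr_mono) auto
    then show ?thesis using that by simp
  qed (use powr_ge_zero[of t p] in linarith)
  \<comment> \<open>Each component is at most 1 plus its power, hence the 3; the torus has mass
    1.\<close>
  let ?r = "\<lambda>x. 3 + \<bar>fst (z x)\<bar> powr (\<beta> + 1) + \<bar>fst (snd (z x))\<bar> powr \<gamma> + norm (snd (snd (z x))) powr \<gamma>"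
  have p: "\<beta> + 1 \<ge> 1" "\<gamma> \<ge> 1" using beta gamma_gt_1 by auto
  have le: "norm (z x) \<le> ?r x" for x
    using norm_triple_le[of "z x"] le1[OF abs_ge_zero p(1), of "fst (z x)"] le1[OF abs_ge_zero p(2), of "fst (snd (z x))"]
      le1[OF norm_ge_zero p(2), of "snd (snd (z x))"] by linarith
  have ir: "integrable torus ?r" using D by auto
  show i: "integrable torus z"
    by (rule Bochner_Integration.integrable_bound[OF ir]) (use le in \<open>auto intro: order_trans\<close>)
  have "(\<integral>x. norm (z x) \<partial>torus) \<le> (\<integral>x. ?r x \<partial>torus)" by (rule integral_mono[OF _ ir le]) (use i in auto)
  also have "\<dots> \<le> 3 + 3 * M" using D by simp
  finally show "(\<integral>x. norm (z x) \<partial>torus) \<le> 3 + 3 * M" .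
qed

text \<open>The sets \<open>K (real j + 2)\<close> increase with \<open>j\<close>, so finitely many
  constraints reduce to the one of largest index, which a truncated solution satisfies. The bound
  \<open>M\<close> common to all truncations lets \<open>convex_ae_closed_fip\<close> meet every
  constraint at once. The shift by 2 provides the \<open>R \<ge> 2\<close> of
  \<open>uniform_bound\<close>.\<close>

lemma limit_solution:
  "\<exists>M. \<exists>z\<in>Z M. (AE x in torus. fst (z x) \<ge> 0) \<and>
     (\<forall>j::nat. \<forall>w\<in>K (real j + 2). 0 \<le> (\<integral>x. A x (w x) \<bullet> (w x - z x) \<partial>torus))"
proof -
  obtain M where M: "\<And>R z. R \<ge> 2 \<Longrightarrow> z \<in> K R \<Longrightarrow> \<forall>w\<in>K R. 0 \<le> (\<integral>x. A x (z x) \<bullet> (w x - z x) \<partial>torus) \<Longrightarrow> z \<in> Z M"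
    using uniform_bound by blast
  define D where "D j = {z\<in>Z M. (AE x in torus. fst (z x) \<ge> 0) \<and>
     (\<forall>w\<in>K (real j + 2). 0 \<le> (\<integral>x. A x (w x) \<bullet> (w x - z x) \<partial>torus))}" for j :: nat
  have j1: "real j + 2 \<ge> 1" for j by simp
  have "\<Inter>(range D) \<noteq> {}"
  proof (rule convex_ae_closed_fip[where M=torus and B="3 + 3 * M"])
    show "finite_measure torus" by (rule finite_measure_torus)
    show "range D \<noteq> {}" by simp
  next
    fix F assume F: "finite F" "F \<noteq> {}" "F \<subseteq> range D"
    then obtain J where J: "finite J" "F = D ` J" by (meson finite_subset_image)
    define n where "n = Max J"
    have R: "real n + 2 \<ge> 1" "real n + 2 \<ge> 2" "real n + 2 > 0" by auto
    obtain z where z: "z \<in> K (real n + 2)"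
      "\<And>w. w \<in> K (real n + 2) \<Longrightarrow> 0 \<le> (\<integral>x. A x (z x) \<bullet> (w x - z x) \<partial>torus)"
      "\<And>w. w \<in> K (real n + 2) \<Longrightarrow> 0 \<le> (\<integral>x. A x (w x) \<bullet> (w x - z x) \<partial>torus)"
      using variational_inequality[OF R(1)] by blast
    have zZ: "z \<in> Z M" using M[OF R(2) z(1)] z(2) by blast
    have "AE x in torus. fst (z x) \<ge> 0" using K_pos[OF z(1) R(3)] by eventually_elim simp
    moreover have "K (real j + 2) \<subseteq> K (real n + 2)" if "j \<in> J" for j
      using Max_ge[OF J(1) that] by (intro K_mono) (auto simp: n_def)
    ultimately have "z \<in> D j" if "j \<in> J" for j
      using that z(3) zZ unfolding D_def by blast
    then show "\<Inter>F \<noteq> {}" using J by auto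
  next
    fix E z assume "E \<in> range D" "z \<in> E"
    then have "z \<in> Z M" by (auto simp: D_def)
    then show "integrable torus z \<and> (\<integral>x. norm (z x) \<partial>torus) \<le> 3 + 3 * M" using Z_norm_integral by blast
  next
    fix E z v assume "E \<in> range D" "z \<in> E" "v \<in> E"
    then obtain j where j: "E = D j" "z \<in> D j" "v \<in> D j" by auto
    then have zv: "z \<in> Z M" "v \<in> Z M" by (auto simp: D_def)
    have pos: "AE x in torus. fst ((1/2) *\<^sub>R (z x + v x)) \<ge> 0"
    proof -
      have "AE x in torus. fst (z x) \<ge> 0" "AE x in torus. fst (v x) \<ge> 0" using j by (auto simp: D_def)
      then show ?thesis by eventually_elim simp
    qed
    have "0 \<le> (\<integral>x. A x (w x) \<bullet> (w x - (1/2) *\<^sub>R (z x + v x)) \<partial>torus)" if w: "w \<in> K (real j + 2)" for w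
    proof -
      note i = A_diff_integrable[OF j1 w zv(1)] A_diff_integrable[OF j1 w zv(2)]
      have n: "0 \<le> (\<integral>x. A x (w x) \<bullet> (w x - z x) \<partial>torus)" "0 \<le> (\<integral>x. A x (w x) \<bullet> (w x - v x) \<partial>torus)"
        using j w by (auto simp: D_def)
      have "(\<integral>x. A x (w x) \<bullet> (w x - (1/2) *\<^sub>R (z x + v x)) \<partial>torus)
        = (\<integral>x. (1/2) * (A x (w x) \<bullet> (w x - z x)) + (1/2) * (A x (w x) \<bullet> (w x - v x)) \<partial>torus)"
        by (intro Bochner_Integration.integral_cong refl) (simp add: inner_diff_right inner_add_right field_simps)
      also have "\<dots> \<ge> 0" using i n by simp
      finally show ?thesis .
    qed
    then show "(\<lambda>x. (1/2) *\<^sub>R (z x + v x)) \<in> E"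
      using pos Z_midpoint[OF zv] unfolding j(1) D_def by blast
  next
    fix E and zs :: "nat \<Rightarrow> real^'n \<Rightarrow> real \<times> real \<times> (real^'n)" and z
    assume E: "E \<in> range D" and zs: "\<And>k. zs k \<in> E" and zm: "z \<in> borel_measurable torus"
      and lim: "AE x in torus. (\<lambda>k. zs k x) \<longlonglongrightarrow> z x"
    then obtain j where j: "E = D j" by auto
    have zsZ: "zs k \<in> Z M" and zp: "AE x in torus. fst (zs k x) \<ge> 0"
      and zi: "\<And>w. w \<in> K (real j + 2) \<Longrightarrow> 0 \<le> (\<integral>x. A x (w x) \<bullet> (w x - zs k x) \<partial>torus)" for k
      using zs[of k] unfolding j D_def by blast+
    have zZ: "z \<in> Z M" by (rule Z_closed[OF zsZ zm lim])
    have "AE x in torus. \<forall>k. fst (zs k x) \<ge> 0" unfolding AE_all_countable using zp by blast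
    with lim have "AE x in torus. fst (z x) \<ge> 0"
    proof eventually_elim
      case (elim x)
      show ?case by (rule LIMSEQ_le_const[OF tendsto_fst[OF elim(1)]]) (use elim in auto)
    qed
    moreover have "0 \<le> (\<integral>x. A x (w x) \<bullet> (w x - z x) \<partial>torus)" if "w \<in> K (real j + 2)" for w
      by (rule LIMSEQ_le_const[OF Z_pair_limit[OF j1 that zsZ zZ lim]]) (use zi[OF that] in auto)
    ultimately show "z \<in> E" using zZ unfolding j D_def by blast
  qed
  then obtain z where "\<And>j. z \<in> D j" by blast
  then show ?thesis unfolding D_def by blast
qed

end

section \<open>Existence of weak solutions\<close>

text \<open>The periodic function with the values of \<open>g\<close> on the half-open cube; on
  \<open>torus\<close> it changes \<open>g\<close> on boundary points only.\<close>

definition periodize :: "(real^'n \<Rightarrow> 'b) \<Rightarrow> real^'n \<Rightarrow> 'b" where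
  "periodize g x = g (\<chi> i. frac (x $ i))"

lemma periodic_periodize: "periodic (periodize g)" for g :: "real^'n::finite \<Rightarrow> 'b"
proof -
  have "(\<chi> i. frac ((x + axis j 1) $ i)) = (\<chi> i. frac (x $ i))" for x :: "real^'n" and j
    by (auto simp: vec_eq_iff axis_def frac_1_eq)
  then show ?thesis by (simp add: periodic_def periodize_def)
qed

lemma AE_periodize: "AE x in torus. g x = periodize g x" for g :: "real^'n::finite \<Rightarrow> 'b"
  using AE_torus_interior
proof eventually_elim
  case (elim x)
  then have "frac (x $ i) = x $ i" for i by (auto simp: mem_box_cart frac_eq less_imp_le)
  then show ?case by (simp add: periodize_def)
qed

lemma Lp_1_iff: "g \<in> Lp 1 \<longleftrightarrow> periodic g \<and> integrable torus g"
  for g :: "real^'n::finite \<Rightarrow> 'b::euclidean_space"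
  by (auto simp: Lp_def integrable_norm_iff dest: borel_measurable_integrable)

lemma Lp_ereal_iff: "g \<in> Lp (ereal p) \<longleftrightarrow> periodic g \<and> g \<in> borel_measurable torus \<and> integrable torus (\<lambda>x. norm (g x) powr p)"
  by (simp add: Lp_def)

lemma Lp_infinity_bound:
  assumes "g \<in> Lp \<infinity>"
  shows "\<exists>B. AE x in torus. norm (g x) \<le> B"
proof -
  let ?e = "esssup torus (\<lambda>x. ereal (norm (g x)))"
  have e: "?e < \<infinity>" using assms by (simp add: Lp_def)
  have "AE x in torus. norm (g x) \<le> real_of_ereal ?e"
    using esssup_AE[where M=torus and f="\<lambda>x. ereal (norm (g x))"]
    by eventually_elim (use e in \<open>cases ?e; auto\<close>)
  then show ?thesis by blast
qed

lemma ess_inf_pos_bound: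
  assumes "ess_inf M g > 0"
  shows "\<exists>\<delta>>0. AE x in M. \<delta> \<le> g x"
proof -
  let ?e = "esssup M (\<lambda>x. ereal (- g x))"
  have e: "?e < 0" using assms by (simp add: ess_inf_def ereal_less_uminus_reorder)
  have ae: "AE x in M. ereal (- g x) \<le> ?e" by (rule esssup_AE)
  show ?thesis
  proof (cases ?e)
    case (real r)
    then have "- r > 0" using e by simp
    moreover have "AE x in M. - r \<le> g x" using ae by eventually_elim (simp add: real)
    ultimately show ?thesis by blast
  next
    case PInf
    then show ?thesis using e by simp
  next
    case MInf
    \<comment> \<open>Here a real number is at most \<open>-\<infinity>\<close> almost everywhere,
      so every pointwise claim holds a.e. and any positive constant serves.\<close>
    have "AE x in M. 1 \<le> g x" using ae by eventually_elim (simp add: MInf)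
    then show ?thesis by (intro exI[of _ 1]) simp
  qed
qed

lemma weak_gradient_iff: "weak_gradient u G \<longleftrightarrow> periodic u \<and> periodic G \<and> torus_weak_gradient u G"
  by (auto simp: weak_gradient_def torus_weak_gradient_def Lp_1_iff)

lemma wgrad_weak_gradient: "weak_gradient u G \<Longrightarrow> weak_gradient u (wgrad u)"
  unfolding wgrad_def by (rule someI[of "weak_gradient u"])

lemma wgrad_AE: "weak_gradient u G \<Longrightarrow> AE x in torus. wgrad u x = G x"
  using torus_weak_gradient_unique[of u "wgrad u" G] wgrad_weak_gradient weak_gradient_iff by blast

context mfg
begin

text \<open>Admissible test pairs are bounded, with density bounded away from 0, so the truncations
  exhaust them.\<close>

lemma test_pair_in_K:
  assumes \<mu>: "\<mu> \<in> Lp \<infinity>" and \<upsilon>: "\<upsilon> \<in> W1p \<infinity>" and pos: "ess_inf torus \<mu> > 0"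
  shows "\<exists>j::nat. (\<lambda>x. (\<mu> x, \<upsilon> x, wgrad \<upsilon> x)) \<in> K (real j + 2)"
proof -
  obtain G where G: "\<upsilon> \<in> Lp \<infinity>" "G \<in> Lp \<infinity>" "weak_gradient \<upsilon> G" using \<upsilon> by (auto simp: W1p_def)
  obtain B1 where B1: "AE x in torus. norm (\<mu> x) \<le> B1" using Lp_infinity_bound[OF \<mu>] by blast
  obtain B2 where B2: "AE x in torus. norm (\<upsilon> x) \<le> B2" using Lp_infinity_bound[OF G(1)] by blast
  obtain B3 where B3: "AE x in torus. norm (G x) \<le> B3" using Lp_infinity_bound[OF G(2)] by blast
  obtain \<delta> where \<delta>: "\<delta> > 0" "AE x in torus. \<delta> \<le> \<mu> x" using ess_inf_pos_bound[OF pos] by blast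
  \<comment> \<open>The exponent \<open>\<alpha> / \<beta>\<close> inverts the cap
    \<open>R powr (\<beta> / \<alpha>)\<close> on the gradient.\<close>
  obtain j :: nat where j: "max (max B1 B2) (max (1 / \<delta>) (\<bar>B3\<bar> powr (\<alpha> / \<beta>))) \<le> real j"
    using real_arch_simple by blast
  define R where "R = real j + 2"
  have R: "R > 0" "B1 \<le> R" "B2 \<le> R" "1 / \<delta> \<le> R" "\<bar>B3\<bar> powr (\<alpha> / \<beta>) \<le> R" using j by (auto simp: R_def)
  have R\<delta>: "1 / R \<le> \<delta>" using R \<delta> by (simp add: field_simps)
  have "(\<bar>B3\<bar> powr (\<alpha> / \<beta>)) powr (\<beta> / \<alpha>) \<le> R powr (\<beta> / \<alpha>)"
    using R alpha beta by (intro powr_mono2) auto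
  then have R3: "B3 \<le> R powr (\<beta> / \<alpha>)" using alpha beta by (simp add: powr_powr)
  have tw: "torus_weak_gradient \<upsilon> (wgrad \<upsilon>)"
    using wgrad_weak_gradient[OF G(3)] by (simp add: weak_gradient_iff)
  have "\<mu> \<in> borel_measurable torus" using \<mu> by (simp add: Lp_def)
  then have m: "(\<lambda>x. (\<mu> x, \<upsilon> x, wgrad \<upsilon> x)) \<in> borel_measurable torus"
    using torus_weak_gradientD(1,2)[OF tw] by (intro borel_measurable_Pair) auto
  have "AE x in torus. 1 / R \<le> \<mu> x \<and> \<mu> x \<le> R \<and> \<bar>\<upsilon> x\<bar> \<le> R \<and> norm (wgrad \<upsilon> x) \<le> R powr (\<beta> / \<alpha>)"
    using B1 B2 B3 \<delta>(2) wgrad_AE[OF G(3)]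
  proof eventually_elim
    case (elim x)
    then show ?case using R R\<delta> R3 by auto
  qed
  then have "(\<lambda>x. (\<mu> x, \<upsilon> x, wgrad \<upsilon> x)) \<in> K R" using m tw by (simp add: K_def)
  then show ?thesis unfolding R_def by blast
qed

lemma weak_integrand_eq_pairing:
  "weak_integrand H V m u \<mu> \<upsilon> x = A x (\<mu> x, \<upsilon> x, wgrad \<upsilon> x) \<bullet> ((\<mu> x, \<upsilon> x, wgrad \<upsilon> x) - (m x, u x, wgrad u x))"
  by (simp add: weak_integrand_def A_def)

lemma weak_solution_exists:
  "\<exists>m \<in> Lp (ereal (\<beta> + 1)). \<exists>u \<in> W1p (ereal \<gamma>). weak_solution H V m u"
proof -
  interpret finite_measure "torus :: (real^'n) measure" by (rule finite_measure_torus)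
  obtain M z where z: "z \<in> Z M" and zp: "AE x in torus. fst (z x) \<ge> 0"
    and minty: "\<And>j w. w \<in> K (real (j::nat) + 2) \<Longrightarrow> 0 \<le> (\<integral>x. A x (w x) \<bullet> (w x - z x) \<partial>torus)"
    using limit_solution by blast
  note D = Z_D[OF z]
  note c = borel_measurable_components[OF D(1)]
  define m where "m = periodize (\<lambda>x. fst (z x))"
  define u where "u = periodize (\<lambda>x. fst (snd (z x)))"
  define G where "G = periodize (\<lambda>x. snd (snd (z x)))"
  have ae: "AE x in torus. fst (z x) = m x" "AE x in torus. fst (snd (z x)) = u x" "AE x in torus. snd (snd (z x)) = G x"
    unfolding m_def u_def G_def by (rule AE_periodize)+
  have meas: "m \<in> borel_measurable torus" "u \<in> borel_measurable torus" "G \<in> borel_measurable torus"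
    using borel_measurable_torus_AE[OF c(1) ae(1)] borel_measurable_torus_AE[OF c(2) ae(2)] borel_measurable_torus_AE[OF c(3) ae(3)] by auto
  note [measurable] = c meas
  have tw: "torus_weak_gradient u G" by (rule torus_weak_gradient_cong[OF D(8) ae(2,3)])
  have wg: "weak_gradient u G"
    using tw by (simp add: weak_gradient_iff) (simp add: u_def G_def periodic_periodize)
  have im: "integrable torus (\<lambda>x. \<bar>m x\<bar> powr (\<beta> + 1))"
    by (rule integrable_cong_AE_imp[OF D(2)]) (use ae(1) in \<open>auto elim!: eventually_mono\<close>)
  have iu: "integrable torus (\<lambda>x. \<bar>u x\<bar> powr \<gamma>)"
    by (rule integrable_cong_AE_imp[OF D(4)]) (use ae(2) in \<open>auto elim!: eventually_mono\<close>)
  have iG: "integrable torus (\<lambda>x. norm (G x) powr \<gamma>)"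
    by (rule integrable_cong_AE_imp[OF D(6)]) (use ae(3) in \<open>auto elim!: eventually_mono\<close>)
  have mL: "m \<in> Lp (ereal (\<beta> + 1))"
    using im by (simp add: Lp_ereal_iff meas) (simp add: m_def periodic_periodize)
  have uL: "u \<in> Lp (ereal \<gamma>)"
    using iu by (simp add: Lp_ereal_iff meas) (simp add: u_def periodic_periodize)
  have GL: "G \<in> Lp (ereal \<gamma>)"
    using iG by (simp add: Lp_ereal_iff meas) (simp add: G_def periodic_periodize)
  have uW: "u \<in> W1p (ereal \<gamma>)" using uL GL wg by (auto simp: W1p_def)
  have uW1: "u \<in> W1p 1" using wg by (auto simp: W1p_def weak_gradient_def)
  have m1: "m \<in> Lp 1"
  proof -
    have le: "norm (fst (z x)) \<le> norm (z x)" for x using norm_fst_le[of "fst (z x)" "snd (z x)"] by simp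
    have "integrable torus (\<lambda>x. fst (z x))"
      by (rule Bochner_Integration.integrable_bound[OF Z_norm_integral(1)[OF z]]) (use le in auto)
    then have "integrable torus m"
      by (rule integrable_cong_AE_imp) (use ae(1) in auto)
    then show ?thesis by (simp add: Lp_1_iff) (simp add: m_def periodic_periodize)
  qed
  have mp: "AE x in torus. m x \<ge> 0" using zp ae(1) by eventually_elim simp
  have "integrable torus (weak_integrand H V m u \<mu> \<upsilon>) \<and> 0 \<le> (\<integral>x. weak_integrand H V m u \<mu> \<upsilon> x \<partial>torus)"
    if test: "\<mu> \<in> Lp \<infinity>" "\<upsilon> \<in> W1p \<infinity>" "ess_inf torus \<mu> > 0" for \<mu> \<upsilon>
  proof -
    define w where "w x = (\<mu> x, \<upsilon> x, wgrad \<upsilon> x)" for x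
    obtain j :: nat where w: "w \<in> K (real j + 2)" using test_pair_in_K[OF test] unfolding w_def by blast
    have i: "integrable torus (\<lambda>x. A x (w x) \<bullet> (w x - z x))" by (rule A_diff_integrable[OF _ w z]) simp
    \<comment> \<open>\<open>wgrad u\<close> is a chosen representative, so it agrees with the
      gradient component of \<open>z\<close> only a.e.; this equality carries integrability and the
      sign over to the integrand of the definition.\<close>
    have eq: "AE x in torus. A x (w x) \<bullet> (w x - z x) = weak_integrand H V m u \<mu> \<upsilon> x"
      using ae wgrad_AE[OF wg]
    proof eventually_elim
      case (elim x)
      have "z x = (m x, u x, wgrad u x)" using elim by (simp add: prod_eq_iff)
      then show ?case unfolding weak_integrand_eq_pairing w_def by simp
    qed
    have mw: "weak_integrand H V m u \<mu> \<upsilon> \<in> borel_measurable torus"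
      by (rule borel_measurable_torus_AE[OF borel_measurable_integrable[OF i] eq])
    have "integrable torus (weak_integrand H V m u \<mu> \<upsilon>)" by (rule integrable_cong_AE_imp[OF i mw]) (use eq in auto)
    moreover have "(\<integral>x. weak_integrand H V m u \<mu> \<upsilon> x \<partial>torus) = (\<integral>x. A x (w x) \<bullet> (w x - z x) \<partial>torus)"
      by (rule integral_cong_AE[OF mw borel_measurable_integrable[OF i]]) (use eq in \<open>auto elim!: eventually_mono\<close>)
    ultimately show ?thesis using minty[OF w] by simp
  qed
  then have "weak_solution H V m u" using m1 uW1 mp by (simp add: weak_solution_def)
  then show ?thesis using mL uW by blast
qed

end

theorem theorem1p6:
  fixes H :: "'n::finite hamiltonian"
    and V :: "real^'n \<Rightarrow> real"
    and \<alpha> \<beta> \<beta>bar \<gamma>bar :: real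
  assumes "\<alpha> > 1" and "\<beta> > 0"
    and "\<And>p m. m > 0 \<Longrightarrow> periodic (\<lambda>x. H x p m)"
    and "monotone_hamiltonian H"
    and "weak_growth \<alpha> \<beta> H"
    and "\<beta>bar = \<beta> + 1"
    and "\<gamma>bar = \<alpha> * ((\<beta> + 1) / \<beta>)"
    and "V \<in> Lp (ereal (\<beta>bar / (\<beta>bar - 1)))"
  shows "\<exists>m \<in> Lp (ereal \<beta>bar). \<exists>u \<in> W1p (ereal \<gamma>bar). weak_solution H V m u"
proof -
  obtain C f where Cf: "C > 0" "continuous_on (UNIV \<times> {0<..}) f"
    "AE x in torus. \<forall>p. \<forall>m>0.
           H x 0 m \<le> - (1 / C) * m powr \<beta> + C \<and>
           norm (DpH H x p m) \<le> f (p, m) \<and>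
           H x p m \<ge> (1 / C) * norm p powr \<alpha> - C * (m powr \<beta> + 1)"
    using assms(5) unfolding weak_growth_def by blast
  \<comment> \<open>With \<open>\<beta>bar = \<beta> + 1\<close> the exponent
    \<open>\<beta>bar / (\<beta>bar - 1)\<close> becomes
    \<open>(\<beta> + 1) / \<beta>\<close>.\<close>
  have V: "V \<in> borel_measurable torus" "integrable torus (\<lambda>x. \<bar>V x\<bar> powr ((\<beta> + 1) / \<beta>))"
    using assms(6,8) by (auto simp: Lp_ereal_iff)
  interpret mfg H V \<alpha> \<beta> C f
    by unfold_locales (use assms(1,2,4) Cf V in \<open>auto simp: monotone_hamiltonian_def\<close>)
  show ?thesis using weak_solution_exists assms(6,7) by (simp add: \<gamma>_def q_def)
qed

end
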